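(* Let $\alpha,\beta\ge-\frac12$. The maximal operator $W_*^{\alpha,\beta,D}$ of the discrete heat semigroup associated with Dunkl-Jacobi polynomials satisfies the following. (1) If $1<p<\infty$ and $\omega\in A_p(\mathbb Z)$, then there is a constant $C$ such that for all $f\in l^2(\mathbb Z)\cap l^p(\mathbb Z,\omega)$ $$\|W^{\alpha,\beta,D}_*f\|_{p,\omega}\le C\|f\|_{p,\omega},$$ where $C$ is independent of $f$. That is, $W^{\alpha,\beta,D}_*$ can be extended uniquely to a bounded operator from $l^p(\mathbb Z,\omega)$ into itself. (2) If $\omega\in A_1(\mathbb Z)$, then there is a constant $C$ such that for all $f\in l^2(\mathbb Z)\cap l^1(\mathbb Z,\omega)$ $$\|W^{\alpha,\beta,D}_*f\|_{1,\infty,\omega}\le C\|f\|_{1,\omega},$$ where $C$ is independent of $f$. That is, $W^{\alpha,\beta,D}_*$ can be extended uniquely to a bounded operator from $l^1(\mathbb Z,\omega)$ into $l^{1,\infty}(\mathbb Z,\omega)$.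
   Context: Sequences are complex valued and indexed by $\mathbb Z$. Dunkl-Jacobi polynomials: let $P_k^{\alpha,\beta}$ be the classical Jacobi polynomials (Szegő's normalization, $P_k^{\alpha,\beta}(1)=\binom{k+\alpha}{k}$), and on $[-\pi,\pi]$ put $$A_{\alpha,\beta}(\tau)=(1-\cos\tau)^\alpha(1+\cos\tau)^\beta|\sin\tau|,\qquad \varphi_k(\tau)=\frac{P_k^{\alpha,\beta}(\cos\tau)}{P_k^{\alpha,\beta}(1)},\qquad \lambda_k=\sqrt{k(k+\alpha+\beta+1)}\quad(k\ge0).$$ Define $e_0\equiv 1$ and, for $k\ge1$, $e_k=\varphi_k+\frac{1}{i\lambda_k}\varphi_k'$ and $e_{-k}=\overline{e_k}$. The system $\{e_k\}_{k\in\mathbb Z}$ is orthogonal and complete in $L^2([-\pi,\pi],A_{\alpha,\beta}(\tau)d\tau)$. Let $\psi_k=e_k/\|e_k\|_{L^2(A_{\alpha,\beta})}$, $k\in\mathbb Z$, be the orthonormalized system. Semigroup and maximal operator: for $t\ge0$, $n,m\in\mathbb Z$, $$K^{\alpha,\beta,D}_t(n,m)=\int_{-\pi}^\pi e^{-(1-\cos\tau)t}\psi_n(\tau)\overline{\psi_m(\tau)}A_{\alpha,\beta}(\tau)\,d\tau,$$ and for $f\in l^2(\mathbb Z)$, $W_t^{\alpha,\beta,D}f(n)=\sum_{m\in\mathbb Z}f(m)K_t^{\alpha,\beta,D}(n,m)$, $\;W_*^{\alpha,\beta,D}f(n)=\sup_{t>0}|W_t^{\alpha,\beta,D}f(n)|$.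 Weighted spaces: a weight on $\mathbb Z$ is a strictly positive sequence $\omega=\{\omega(n)\}_{n\in\mathbb Z}$. For $1\le p<\infty$, $l^p(\mathbb Z,\omega)$ is the space of sequences with $\|f\|_{p,\omega}^p=\sum_{m}|f(m)|^p\omega(m)<\infty$, and $l^{1,\infty}(\mathbb Z,\omega)$ is the space of sequences with $\|f\|_{1,\infty,\omega}=\sup_{s>0}s\sum_{m:|f(m)|>s}\omega(m)<\infty$. Discrete Muckenhoupt classes: for $1<p<\infty$, $\omega\in A_p(\mathbb Z)$ if $$\sup_{m\le n}\frac{1}{(n-m+1)^p}\Big(\sum_{k=m}^n\omega(k)\Big)\Big(\sum_{k=m}^n\omega(k)^{-\frac1{p-1}}\Big)^{p-1}<\infty,$$ and $\omega\in A_1(\mathbb Z)$ if $$\sup_{m\le n}\frac{1}{n-m+1}\Big(\sum_{k=m}^n\omega(k)\Big)\max_{m\le k\le n}\omega(k)^{-1}<\infty,$$ the suprema being over $m,n\in\mathbb Z$ with $m\le n$. *)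

theory Defs
  imports "HOL-Analysis.Analysis"
begin

text \<open>
  The explicit sum (4.3.2) in Szego, "Orthogonal Polynomials"; it has the normalization
  \<open>P k 1 = (k + \<alpha>) gchoose k\<close> proved below.
\<close>

definition jacobi_P :: "real \<Rightarrow> real \<Rightarrow> nat \<Rightarrow> real \<Rightarrow> real" where
  "jacobi_P \<alpha> \<beta> k x =
     (\<Sum>s\<le>k. ((real k + \<alpha>) gchoose (k - s)) * ((real k + \<beta>) gchoose s) *
              ((x - 1) / 2) ^ s * ((x + 1) / 2) ^ (k - s))"

lemma jacobi_P_at_1: "jacobi_P \<alpha> \<beta> k 1 = (real k + \<alpha>) gchoose k"
proof -
  have "jacobi_P \<alpha> \<beta> k 1 = (\<Sum>s\<le>k. if s = 0 then (real k + \<alpha>) gchoose k else 0)"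
    unfolding jacobi_P_def by (rule sum.cong) auto
  then show ?thesis by simp
qed

text \<open>
  Since \<open>0 powr a = 0\<close> for every \<open>a\<close>, this density vanishes at the multiples of \<open>\<pi>\<close>; this is a
  null set, so integrals against it are unaffected.
\<close>

definition jacobi_weight :: "real \<Rightarrow> real \<Rightarrow> real \<Rightarrow> real" where
  "jacobi_weight \<alpha> \<beta> \<tau> = (1 - cos \<tau>) powr \<alpha> * (1 + cos \<tau>) powr \<beta> * \<bar>sin \<tau>\<bar>"

definition jacobi_phi :: "real \<Rightarrow> real \<Rightarrow> nat \<Rightarrow> real \<Rightarrow> real" where
  "jacobi_phi \<alpha> \<beta> k \<tau> = jacobi_P \<alpha> \<beta> k (cos \<tau>) / jacobi_P \<alpha> \<beta> k 1"

definition jacobi_lambda :: "real \<Rightarrow> real \<Rightarrow> nat \<Rightarrow> real" where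
  "jacobi_lambda \<alpha> \<beta> k = sqrt (real k * (real k + \<alpha> + \<beta> + 1))"

definition dunkl_pos :: "real \<Rightarrow> real \<Rightarrow> nat \<Rightarrow> real \<Rightarrow> complex" where
  "dunkl_pos \<alpha> \<beta> k \<tau> =
     complex_of_real (jacobi_phi \<alpha> \<beta> k \<tau>) +
     1 / (\<i> * complex_of_real (jacobi_lambda \<alpha> \<beta> k)) *
       complex_of_real (deriv (jacobi_phi \<alpha> \<beta> k) \<tau>)"

definition dunkl_e :: "real \<Rightarrow> real \<Rightarrow> int \<Rightarrow> real \<Rightarrow> complex" where
  "dunkl_e \<alpha> \<beta> k \<tau> =
     (if k = 0 then 1
      else if k > 0 then dunkl_pos \<alpha> \<beta> (nat k) \<tau>
      else cnj (dunkl_pos \<alpha> \<beta> (nat (- k)) \<tau>))"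

definition dunkl_psi :: "real \<Rightarrow> real \<Rightarrow> int \<Rightarrow> real \<Rightarrow> complex" where
  "dunkl_psi \<alpha> \<beta> k \<tau> =
     dunkl_e \<alpha> \<beta> k \<tau> /
     complex_of_real (sqrt (LINT \<theta>:{-pi..pi}|lborel.
       (cmod (dunkl_e \<alpha> \<beta> k \<theta>))\<^sup>2 * jacobi_weight \<alpha> \<beta> \<theta>))"

definition dunkl_heat_kernel :: "real \<Rightarrow> real \<Rightarrow> real \<Rightarrow> int \<Rightarrow> int \<Rightarrow> complex" where
  "dunkl_heat_kernel \<alpha> \<beta> t n m =
     (LINT \<tau>:{-pi..pi}|lborel.
        complex_of_real (exp (- (1 - cos \<tau>) * t)) *
        dunkl_psi \<alpha> \<beta> n \<tau> * cnj (dunkl_psi \<alpha> \<beta> m \<tau>) *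
        complex_of_real (jacobi_weight \<alpha> \<beta> \<tau>))"

text \<open>
  For square-summable \<open>f\<close> the series converges absolutely by Bessel's inequality, so the
  unconditional sum is the intended one.
\<close>

definition dunkl_heat :: "real \<Rightarrow> real \<Rightarrow> real \<Rightarrow> (int \<Rightarrow> complex) \<Rightarrow> int \<Rightarrow> complex" where
  "dunkl_heat \<alpha> \<beta> t f n = (\<Sum>\<^sub>\<infinity>m\<in>UNIV. f m * dunkl_heat_kernel \<alpha> \<beta> t n m)"

text \<open>
  The supremum is taken in the reals, hence is meaningful only where the set of values is bounded;
  results about the operator should assert this alongside. The value is embedded into the complex
  numbers so that the operator acts between spaces of complex sequences.
\<close>

definition dunkl_max :: "real \<Rightarrow> real \<Rightarrow> (int \<Rightarrow> complex) \<Rightarrow> int \<Rightarrow> complex" where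
  "dunkl_max \<alpha> \<beta> f n = complex_of_real (SUP t\<in>{0<..}. cmod (dunkl_heat \<alpha> \<beta> t f n))"

definition lp_space :: "real \<Rightarrow> (int \<Rightarrow> real) \<Rightarrow> (int \<Rightarrow> complex) set" where
  "lp_space p \<omega> = {f. (\<lambda>m. cmod (f m) powr p * \<omega> m) summable_on UNIV}"

definition lp_norm :: "real \<Rightarrow> (int \<Rightarrow> real) \<Rightarrow> (int \<Rightarrow> complex) \<Rightarrow> real" where
  "lp_norm p \<omega> f = (\<Sum>\<^sub>\<infinity>m\<in>UNIV. cmod (f m) powr p * \<omega> m) powr (1 / p)"

abbreviation l2_space :: "(int \<Rightarrow> complex) set" where
  "l2_space \<equiv> lp_space 2 (\<lambda>_. 1)"

definition weak_l1_space :: "(int \<Rightarrow> real) \<Rightarrow> (int \<Rightarrow> complex) set" where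
  "weak_l1_space \<omega> =
     {f. (\<forall>s>0. \<omega> summable_on {m. cmod (f m) > s}) \<and>
         bdd_above ((\<lambda>s. s * (\<Sum>\<^sub>\<infinity>m\<in>{m. cmod (f m) > s}. \<omega> m)) ` {0<..})}"

definition weak_l1_norm :: "(int \<Rightarrow> real) \<Rightarrow> (int \<Rightarrow> complex) \<Rightarrow> real" where
  "weak_l1_norm \<omega> f = (SUP s\<in>{0<..}. s * (\<Sum>\<^sub>\<infinity>m\<in>{m. cmod (f m) > s}. \<omega> m))"

definition muckenhoupt_Ap :: "real \<Rightarrow> (int \<Rightarrow> real) set" where
  "muckenhoupt_Ap p =
     {\<omega>. (\<forall>n. \<omega> n > 0) \<and>
         bdd_above {1 / real_of_int (n - m + 1) powr p * (\<Sum>k=m..n. \<omega> k) *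
                    (\<Sum>k=m..n. \<omega> k powr (- 1 / (p - 1))) powr (p - 1) | m n. m \<le> n}}"

definition muckenhoupt_A1 :: "(int \<Rightarrow> real) set" where
  "muckenhoupt_A1 =
     {\<omega>. (\<forall>n. \<omega> n > 0) \<and>
         bdd_above {1 / real_of_int (n - m + 1) * (\<Sum>k=m..n. \<omega> k) *
                    (MAX k\<in>{m..n}. inverse (\<omega> k)) | m n. m \<le> n}}"

text \<open>
  The operators considered here are sublinear rather than linear, so continuity does not come with
  the norm bound and is required separately; without it an extension from a dense subspace would
  not be determined.
\<close>

definition bounded_extension ::
  "(int \<Rightarrow> complex) set \<Rightarrow> ((int \<Rightarrow> complex) \<Rightarrow> int \<Rightarrow> complex) \<Rightarrow>
   (int \<Rightarrow> complex) set \<Rightarrow> ((int \<Rightarrow> complex) \<Rightarrow> real) \<Rightarrow>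
   (int \<Rightarrow> complex) set \<Rightarrow> ((int \<Rightarrow> complex) \<Rightarrow> real) \<Rightarrow>
   ((int \<Rightarrow> complex) \<Rightarrow> int \<Rightarrow> complex) \<Rightarrow> bool" where
  "bounded_extension D S X NX Y NY T \<longleftrightarrow>
     T \<in> X \<rightarrow> Y \<and>
     (\<forall>f\<in>D. T f = S f) \<and>
     (\<exists>C. \<forall>f\<in>X. NY (T f) \<le> C * NX f) \<and>
     (\<forall>f\<in>X. \<forall>\<epsilon>>0. \<exists>\<delta>>0. \<forall>g\<in>X.
        NX (\<lambda>m. g m - f m) < \<delta> \<longrightarrow> NY (\<lambda>m. T g m - T f m) < \<epsilon>)"

definition sublinear_on ::
  "(int \<Rightarrow> complex) set \<Rightarrow> ((int \<Rightarrow> complex) \<Rightarrow> int \<Rightarrow> complex) \<Rightarrow> bool" where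
  "sublinear_on X T \<longleftrightarrow>
     (\<forall>f\<in>X. \<forall>g\<in>X. \<forall>n. cmod (T (\<lambda>m. f m + g m) n) \<le> cmod (T f n) + cmod (T g n)) \<and>
     (\<forall>f\<in>X. \<forall>c n. cmod (T (\<lambda>m. c * f m) n) = cmod c * cmod (T f n))"

definition extends_uniquely ::
  "(int \<Rightarrow> complex) set \<Rightarrow> ((int \<Rightarrow> complex) \<Rightarrow> int \<Rightarrow> complex) \<Rightarrow>
   (int \<Rightarrow> complex) set \<Rightarrow> ((int \<Rightarrow> complex) \<Rightarrow> real) \<Rightarrow>
   (int \<Rightarrow> complex) set \<Rightarrow> ((int \<Rightarrow> complex) \<Rightarrow> real) \<Rightarrow> bool" where
  "extends_uniquely D S X NX Y NY \<longleftrightarrow>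
     (\<exists>T. bounded_extension D S X NX Y NY T \<and> sublinear_on X T \<and>
          (\<forall>T'. bounded_extension D S X NX Y NY T' \<longrightarrow> (\<forall>f\<in>X. T' f = T f)))"

end

theory Submission
  imports Defs
begin

text \<open>
  Write \<open>e\<^sub>n = c\<^sub>n - \<i> s\<^sub>n\<close>. With \<open>\<mu>\<^sub>n = sgn n * \<lambda>\<^sub>n\<close> and the logarithmic derivative \<open>g\<close> of the
  density \<open>A\<close>, the Jacobi equation becomes the first-order system \<open>c' = \<mu> s\<close>, \<open>s' = - \<mu> c - g s\<close>.
  A Gronwall argument for this system bounds \<open>A |e\<^sub>n|\<^sup>2\<close> by a multiple of the squared norm of \<open>e\<^sub>n\<close>, uniformly
  in \<open>n\<close>. Integrating by parts twice turns the factor \<open>(\<mu>\<^sub>n - \<mu>\<^sub>m)\<^sup>2\<close> into derivatives of the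
  multiplier \<open>exp (- t (1 - cos \<tau>))\<close>, and since \<open>|\<mu>\<^sub>n - \<mu>\<^sub>m| \<ge> |n - m|\<close> the heat kernel is bounded by a multiple of
  \<open>min (1 / r) (r / (n - m)\<^sup>2)\<close> with \<open>r = max 1 (sqrt t)\<close>.
  Summing over dyadic shells, the maximal operator is dominated pointwise by the Hardy-Littlewood maximal
  function, whose weighted bounds follow from the weighted one-sided maximal functions by Lerner's argument.
  The maximal operator is thus defined on the whole weighted space and is its own extension.
\<close>

section \<open>The Jacobi differential equation\<close>

text \<open>The obstacle is uniformity in n: the drift \<open>g\<close> may blow up at 0 and at pi,
  so a single Gronwall estimate on the whole interval is hopeless. The shifted parameters \<alpha> +
  1/2 and \<beta> + 1/2 are nonnegative, which makes \<open>g\<close> decreasing; hence |g| \<le>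
  \<mu> holds exactly between two turning points. There the energies at any two points are
  comparable; beyond a turning point the drift dominates and monotonicity takes over. This serves
  large frequencies, while the finitely many others are bounded by compactness. The double
  integration by parts works because the antisymmetric product A (c_n s_m - s_n c_m) has derivative
  (\<mu>_n - \<mu>_m) A (c_n c_m + s_n s_m), with no drift in it; the drift returns only multiplied
  by sin, which cancels its singularities. The number \<open>r\<close> is the diffusion length at
  time \<open>t\<close>, cut off at the lattice spacing. On the weighted side, averages over
  intervals with respect to any positive weight obey maximal inequalities whose constants ignore the
  weight, thanks to a discrete rising sun lemma; this is what Lerner's argument iterates, once for
  \<open>w\<close> and once for its dual weight.\<close>

definition jterm :: "nat \<Rightarrow> nat \<Rightarrow> real \<Rightarrow> real" where
  "jterm s r x = ((x - 1) / 2) ^ s * ((x + 1) / 2) ^ r"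

lemma jterm_has_derivative [derivative_intros]:
  "(jterm s r has_real_derivative (real s * jterm (s - 1) r x + real r * jterm s (r - 1) x) / 2) (at x)"
  unfolding jterm_def
  by (auto intro!: derivative_eq_intros simp: algebra_simps add_divide_distrib)

definition jterm' :: "nat \<Rightarrow> nat \<Rightarrow> real \<Rightarrow> real" where
  "jterm' s r x = (real s * jterm (s - 1) r x + real r * jterm s (r - 1) x) / 2"

definition jterm'' :: "nat \<Rightarrow> nat \<Rightarrow> real \<Rightarrow> real" where
  "jterm'' s r x = (real s * jterm' (s - 1) r x + real r * jterm' s (r - 1) x) / 2"

lemma jterm'_has_derivative: "(jterm' s r has_real_derivative jterm'' s r x) (at x)"
  unfolding jterm'_def jterm''_def
  by (auto intro!: derivative_eq_intros sum.cong simp: jterm'_def)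

text \<open>Applied to one term of the explicit sum, the operator leaves two differences of
  neighbouring terms, prepared for telescoping. Truncated subtraction at \<open>s = 0\<close> or
  \<open>r = 0\<close> is harmless because the factor \<open>real s\<close> or \<open>real r\<close>
  vanishes there.\<close>

lemma jterm_ode:
  fixes x \<alpha> \<beta> :: real
  assumes "k = s + r"
  shows "(1 - x\<^sup>2) * jterm'' s r x + (\<beta> - \<alpha> - (\<alpha> + \<beta> + 2) * x) * jterm' s r x
           + real k * (real k + \<alpha> + \<beta> + 1) * jterm s r x
         = (real r * (real r + \<beta>) * jterm s r x - real s * (real s + \<alpha>) * jterm (s - 1) (r + 1) x)
           - (real r * (real r + \<beta>) * jterm (s + 1) (r - 1) x - real s * (real s + \<alpha>) * jterm s r x)"
proof -
  define u where "u = (x - 1) / 2"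
  have x: "x = 2 * u + 1" and v: "(x + 1) / 2 = u + 1" by (auto simp: u_def add_divide_distrib diff_divide_distrib)
  \<comment> \<open>A second derivative lowers an exponent by up to two, so truncated subtraction
    disappears only after separating 0, 1 and larger exponents.\<close>
  have s_cases: "s = 0 \<or> s = 1 \<or> (\<exists>s'. s = Suc (Suc s'))" by presburger
  have r_cases: "r = 0 \<or> r = 1 \<or> (\<exists>r'. r = Suc (Suc r'))" by presburger
  show ?thesis
    unfolding jterm''_def jterm'_def jterm_def v u_def[symmetric] assms
    using s_cases r_cases
    by (elim disjE exE) (simp_all add: x power2_eq_square field_simps)
qed

definition jcoeff :: "real \<Rightarrow> real \<Rightarrow> nat \<Rightarrow> nat \<Rightarrow> real" where
  "jcoeff \<alpha> \<beta> k s = ((real k + \<alpha>) gchoose (k - s)) * ((real k + \<beta>) gchoose s)"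

text \<open>The absorption identity
  \<open>(a - j) * (a gchoose j) = (j + 1) * (a gchoose (j + 1))\<close>, applied once to each
  binomial factor. It matches the two differences of \<open>jterm_ode\<close> across consecutive
  terms.\<close>

lemma jcoeff_rec:
  assumes "s < k"
  shows "jcoeff \<alpha> \<beta> k (Suc s) * (real (Suc s) * (real (Suc s) + \<alpha>)) =
         jcoeff \<alpha> \<beta> k s * (real (k - s) * (real (k - s) + \<beta>))"
proof -
  have *: "(a - real j) * (a gchoose j) = real (Suc j) * (a gchoose Suc j)" for a :: real and j
    using gbinomial_mult_1[of a j] by (simp add: algebra_simps)
  obtain j where j: "k - s = Suc j" and j': "k - Suc s = j"
    using assms by (metis Suc_diff_Suc)
  have kj: "real k = real j + real s + 1" using j assms by linarith
  have 1: "(real (Suc s) + \<alpha>) * ((real k + \<alpha>) gchoose j) = real (Suc j) * ((real k + \<alpha>) gchoose Suc j)"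
    using *[of "real k + \<alpha>" j] kj by (simp add: algebra_simps)
  have 2: "(real (Suc j) + \<beta>) * ((real k + \<beta>) gchoose s) = real (Suc s) * ((real k + \<beta>) gchoose Suc s)"
    using *[of "real k + \<beta>" s] kj by (simp add: algebra_simps)
  have "jcoeff \<alpha> \<beta> k (Suc s) * (real (Suc s) * (real (Suc s) + \<alpha>)) =
     ((real (Suc s) + \<alpha>) * ((real k + \<alpha>) gchoose j)) * (real (Suc s) * ((real k + \<beta>) gchoose Suc s))"
    by (simp add: jcoeff_def j' algebra_simps)
  also have "\<dots> = (real (Suc j) * ((real k + \<alpha>) gchoose Suc j)) * ((real (Suc j) + \<beta>) * ((real k + \<beta>) gchoose s))"
    by (simp only: 1 2)
  also have "\<dots> = jcoeff \<alpha> \<beta> k s * (real (k - s) * (real (k - s) + \<beta>))"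
    by (simp add: jcoeff_def j algebra_simps)
  finally show ?thesis .
qed

definition jacobi_P' :: "real \<Rightarrow> real \<Rightarrow> nat \<Rightarrow> real \<Rightarrow> real" where
  "jacobi_P' \<alpha> \<beta> k x = (\<Sum>s\<le>k. jcoeff \<alpha> \<beta> k s * jterm' s (k - s) x)"

definition jacobi_P'' :: "real \<Rightarrow> real \<Rightarrow> nat \<Rightarrow> real \<Rightarrow> real" where
  "jacobi_P'' \<alpha> \<beta> k x = (\<Sum>s\<le>k. jcoeff \<alpha> \<beta> k s * jterm'' s (k - s) x)"

lemma jacobi_P_eq: "jacobi_P \<alpha> \<beta> k x = (\<Sum>s\<le>k. jcoeff \<alpha> \<beta> k s * jterm s (k - s) x)"
  by (simp add: jacobi_P_def jcoeff_def jterm_def mult_ac)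

lemma jacobi_P_has_derivative: "(jacobi_P \<alpha> \<beta> k has_real_derivative jacobi_P' \<alpha> \<beta> k x) (at x)"
  unfolding jacobi_P_eq[abs_def] jacobi_P'_def
  by (auto intro!: derivative_eq_intros sum.cong simp: jterm'_def algebra_simps)

lemma jacobi_P'_has_derivative: "(jacobi_P' \<alpha> \<beta> k has_real_derivative jacobi_P'' \<alpha> \<beta> k x) (at x)"
  unfolding jacobi_P'_def[abs_def] jacobi_P''_def
  by (auto intro!: derivative_eq_intros jterm'_has_derivative sum.cong simp: mult.commute)

lemma jacobi_ode:
  "(1 - x\<^sup>2) * jacobi_P'' \<alpha> \<beta> k x + (\<beta> - \<alpha> - (\<alpha> + \<beta> + 2) * x) * jacobi_P' \<alpha> \<beta> k x
     + real k * (real k + \<alpha> + \<beta> + 1) * jacobi_P \<alpha> \<beta> k x = 0"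
proof -
  let ?c = "jcoeff \<alpha> \<beta> k"
  \<comment> \<open>The flux between the terms \<open>s - 1\<close> and \<open>s\<close>. It
    vanishes at \<open>s = 0\<close> by definition and at \<open>s = Suc k\<close> through the
    factor \<open>k - k\<close>.\<close>
  define h where "h s = (if s = 0 then 0 else ?c (s - 1) * (real (k - (s - 1)) * (real (k - (s - 1)) + \<beta>)) *
      (jterm (s - 1) (k - (s - 1)) x - jterm s (k - s) x))" for s
  have tele: "?c s * ((1 - x\<^sup>2) * jterm'' s (k - s) x
        + (\<beta> - \<alpha> - (\<alpha> + \<beta> + 2) * x) * jterm' s (k - s) x
        + real k * (real k + \<alpha> + \<beta> + 1) * jterm s (k - s) x) = h (Suc s) - h s" if "s \<le> k" for s
  proof -
    have "?c s * ((1 - x\<^sup>2) * jterm'' s (k - s) x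
        + (\<beta> - \<alpha> - (\<alpha> + \<beta> + 2) * x) * jterm' s (k - s) x
        + real k * (real k + \<alpha> + \<beta> + 1) * jterm s (k - s) x)
      = ?c s * (real (k - s) * (real (k - s) + \<beta>)) * (jterm s (k - s) x - jterm (s + 1) (k - s - 1) x)
        - ?c s * (real s * (real s + \<alpha>)) * (jterm (s - 1) (k - s + 1) x - jterm s (k - s) x)"
      using that by (subst jterm_ode[of k s "k - s"]) (auto simp: algebra_simps)
    also have "?c s * (real (k - s) * (real (k - s) + \<beta>)) * (jterm s (k - s) x - jterm (s + 1) (k - s - 1) x)
       = h (Suc s)" by (simp add: h_def)
    also have "?c s * (real s * (real s + \<alpha>)) * (jterm (s - 1) (k - s + 1) x - jterm s (k - s) x) = h s"
    proof (cases s)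
      case (Suc j)
      then have j: "j < k" using that by simp
      have "k - Suc j + 1 = k - j" using j by simp
      then show ?thesis using jcoeff_rec[OF j, of \<alpha> \<beta>] by (simp add: h_def Suc)
    qed (simp add: h_def)
    finally show ?thesis .
  qed
  have "(1 - x\<^sup>2) * jacobi_P'' \<alpha> \<beta> k x + (\<beta> - \<alpha> - (\<alpha> + \<beta> + 2) * x) * jacobi_P' \<alpha> \<beta> k x
     + real k * (real k + \<alpha> + \<beta> + 1) * jacobi_P \<alpha> \<beta> k x
     = (\<Sum>s\<le>k. h (Suc s) - h s)"
    unfolding jacobi_P_eq jacobi_P'_def jacobi_P''_def sum_distrib_left sum.distrib[symmetric]
    by (rule sum.cong) (use tele in \<open>auto simp: algebra_simps\<close>)
  also have "\<dots> = h (Suc k) - h 0"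
    by (rule sum_lessThan_telescope[of h "Suc k", unfolded lessThan_Suc_atMost])
  also have "\<dots> = 0" by (simp add: h_def)
  finally show ?thesis .
qed

section \<open>The uniform bound for the eigenfunctions\<close>

text \<open>Since \<open>0 powr 0 = 0\<close>, a plain power with exponent 0 would jump at the
  endpoint. The value 1 keeps the density continuous up to the boundary when \<alpha> or \<beta>
  equals -1/2.\<close>

definition cont_powr :: "real \<Rightarrow> real \<Rightarrow> real" where
  "cont_powr a x = (if a = 0 then 1 else x powr a)"

definition jacobi_density :: "real \<Rightarrow> real \<Rightarrow> real \<Rightarrow> real" where
  "jacobi_density a b \<tau> = cont_powr a (1 - cos \<tau>) * cont_powr b (1 + cos \<tau>)"

definition jacobi_drift :: "real \<Rightarrow> real \<Rightarrow> real \<Rightarrow> real" where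
  "jacobi_drift a b \<tau> = a * sin \<tau> / (1 - cos \<tau>) - b * sin \<tau> / (1 + cos \<tau>)"

lemma cont_powr_nonneg [simp]: "cont_powr a x \<ge> 0"
  by (simp add: cont_powr_def)

lemma cont_powr_pos [simp]: "x > 0 \<Longrightarrow> cont_powr a x > 0"
  by (simp add: cont_powr_def)

lemma cont_powr_has_derivative:
  assumes "x > 0"
  shows "(cont_powr a has_real_derivative a / x * cont_powr a x) (at x)"
proof (cases "a = 0")
  case True
  then have "cont_powr a = (\<lambda>_. 1)" by (auto simp: cont_powr_def)
  with True show ?thesis by simp
next
  case False
  then have "cont_powr a = (\<lambda>x. x powr a)" by (auto simp: cont_powr_def)
  then show ?thesis
    using assms by (auto intro!: derivative_eq_intros simp: powr_diff)
qed

lemma continuous_on_cont_powr [continuous_intros]: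
  assumes "a \<ge> 0" "continuous_on S f" "\<And>x. x \<in> S \<Longrightarrow> f x \<ge> 0"
  shows "continuous_on S (\<lambda>x. cont_powr a (f x))"
  using assms by (cases "a = 0") (auto simp: cont_powr_def intro!: continuous_on_powr')

lemma one_minus_cos_pos: "0 < x \<Longrightarrow> x < pi \<Longrightarrow> 0 < 1 - cos (x::real)"
  using cos_monotone_0_pi[of 0 x] by simp

lemma one_plus_cos_pos: "0 < x \<Longrightarrow> x < pi \<Longrightarrow> 0 < 1 + cos (x::real)"
  using cos_monotone_0_pi[of x pi] by simp

lemma cos_less_1: "0 < x \<Longrightarrow> x < pi \<Longrightarrow> cos (x::real) < 1"
  using one_minus_cos_pos[of x] by simp

lemma minus_1_le_cos: "0 \<le> 1 + cos (x::real)"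
  using cos_ge_minus_one[of x] by linarith

lemma continuous_jacobi_density [continuous_intros]:
  assumes "a \<ge> 0" "b \<ge> 0"
  shows "continuous_on S (jacobi_density a b)"
  unfolding jacobi_density_def[abs_def] by (intro continuous_intros) (use assms in \<open>auto simp: minus_1_le_cos\<close>)

lemma jacobi_density_nonneg [simp]: "jacobi_density a b \<tau> \<ge> 0"
  by (simp add: jacobi_density_def)

lemma jacobi_density_pos: "0 < \<tau> \<Longrightarrow> \<tau> < pi \<Longrightarrow> jacobi_density a b \<tau> > 0"
  by (simp add: jacobi_density_def cos_less_1 one_plus_cos_pos)

lemma jacobi_density_has_derivative:
  assumes "0 < \<tau>" "\<tau> < pi"
  shows "(jacobi_density a b has_real_derivative jacobi_drift a b \<tau> * jacobi_density a b \<tau>) (at \<tau>)"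
proof -
  have 1: "((\<lambda>\<tau>. cont_powr a (1 - cos \<tau>)) has_real_derivative
      (a / (1 - cos \<tau>) * cont_powr a (1 - cos \<tau>)) * sin \<tau>) (at \<tau>)"
    by (rule DERIV_chain2[OF cont_powr_has_derivative])
       (auto intro!: derivative_eq_intros cos_less_1 assms)
  have 2: "((\<lambda>\<tau>. cont_powr b (1 + cos \<tau>)) has_real_derivative
      (b / (1 + cos \<tau>) * cont_powr b (1 + cos \<tau>)) * (- sin \<tau>)) (at \<tau>)"
    by (rule DERIV_chain2[OF cont_powr_has_derivative])
       (auto intro!: derivative_eq_intros one_plus_cos_pos assms)
  show ?thesis
    using DERIV_mult[OF 1 2] unfolding jacobi_density_def[abs_def]
    by (rule DERIV_cong) (simp add: jacobi_drift_def algebra_simps)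
qed

lemma sin_times_sin: "sin x * sin x = (1 - cos x) * (1 + cos (x::real))"
  using sin_squared_eq[of x] by (simp add: power2_eq_square algebra_simps)

text \<open>The factor sin removes both endpoint singularities, which keeps the error terms of the
  integration by parts bounded.\<close>

lemma sin_times_jacobi_drift:
  assumes "0 < \<tau>" "\<tau> < pi"
  shows "sin \<tau> * jacobi_drift a b \<tau> = a * (1 + cos \<tau>) - b * (1 - cos \<tau>)"
proof -
  have "sin \<tau> * jacobi_drift a b \<tau> = a * (sin \<tau> * sin \<tau>) / (1 - cos \<tau>) - b * (sin \<tau> * sin \<tau>) / (1 + cos \<tau>)"
    by (simp add: jacobi_drift_def algebra_simps)
  also have "\<dots> = a * (1 + cos \<tau>) - b * (1 - cos \<tau>)"
    unfolding sin_times_sin using cos_less_1[OF assms] one_plus_cos_pos[OF assms] by simp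
  finally show ?thesis .
qed

lemma jacobi_drift_has_derivative:
  assumes "0 < \<tau>" "\<tau> < pi"
  shows "(jacobi_drift a b has_real_derivative - (a / (1 - cos \<tau>) + b / (1 + cos \<tau>))) (at \<tau>)"
proof -
  have p: "1 - cos \<tau> > 0" "1 + cos \<tau> > 0" using assms one_minus_cos_pos one_plus_cos_pos by auto
  have 1: "((\<lambda>\<tau>. a * sin \<tau> / (1 - cos \<tau>)) has_real_derivative - (a / (1 - cos \<tau>))) (at \<tau>)"
    using p by (auto intro!: derivative_eq_intros simp: divide_simps) (use sin_times_sin[of \<tau>] in algebra)
  have 2: "((\<lambda>\<tau>. b * sin \<tau> / (1 + cos \<tau>)) has_real_derivative (b / (1 + cos \<tau>))) (at \<tau>)"
    using p by (auto intro!: derivative_eq_intros simp: divide_simps) (use sin_times_sin[of \<tau>] in algebra)+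
  show ?thesis
    using DERIV_diff[OF 1 2] unfolding jacobi_drift_def[abs_def] by (rule DERIV_cong) simp
qed

text \<open>This monotonicity divides (0, pi) into a middle zone |g| \<le> l and two end
  zones.\<close>

lemma jacobi_drift_antimono:
  assumes "a \<ge> 0" "b \<ge> 0" "0 < x" "x \<le> y" "y < pi"
  shows "jacobi_drift a b y \<le> jacobi_drift a b x"
proof (rule DERIV_nonpos_imp_nonincreasing[OF assms(4)], intro exI conjI)
  fix \<tau> assume "x \<le> \<tau>" "\<tau> \<le> y"
  then have t: "0 < \<tau>" "\<tau> < pi" using assms by auto
  show "(jacobi_drift a b has_real_derivative - (a / (1 - cos \<tau>) + b / (1 + cos \<tau>))) (at \<tau>)"
    by (rule jacobi_drift_has_derivative[OF t])
  show "- (a / (1 - cos \<tau>) + b / (1 + cos \<tau>)) \<le> 0"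
    using one_minus_cos_pos[OF t] one_plus_cos_pos[OF t] assms(1,2)
    by (simp only: neg_le_0_iff_le) (intro add_nonneg_nonneg divide_nonneg_pos)
qed

lemma jacobi_drift_reflect: "jacobi_drift a b (pi - \<tau>) = - jacobi_drift b a \<tau>"
  by (simp add: jacobi_drift_def)

lemma jacobi_density_reflect: "jacobi_density a b (pi - \<tau>) = jacobi_density b a \<tau>"
  by (simp add: jacobi_density_def)

section \<open>The first-order system and its energy\<close>

text \<open>The equations are imposed inside the interval only, where the drift is finite; the
  endpoints enter through continuity and the vanishing of \<open>s\<close>.\<close>

definition dirac_pair :: "real \<Rightarrow> real \<Rightarrow> real \<Rightarrow> (real \<Rightarrow> real) \<Rightarrow> (real \<Rightarrow> real) \<Rightarrow> bool" where
  "dirac_pair a b \<mu> c s \<longleftrightarrow>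
     continuous_on {0..pi} c \<and> continuous_on {0..pi} s \<and> s 0 = 0 \<and> s pi = 0 \<and>
     (\<forall>\<tau>. 0 < \<tau> \<longrightarrow> \<tau> < pi \<longrightarrow>
        (c has_real_derivative \<mu> * s \<tau>) (at \<tau>) \<and>
        (s has_real_derivative - \<mu> * c \<tau> - jacobi_drift a b \<tau> * s \<tau>) (at \<tau>))"

definition dirac_energy :: "real \<Rightarrow> real \<Rightarrow> (real \<Rightarrow> real) \<Rightarrow> (real \<Rightarrow> real) \<Rightarrow> real \<Rightarrow> real" where
  "dirac_energy a b c s \<tau> = jacobi_density a b \<tau> * ((c \<tau>)\<^sup>2 + (s \<tau>)\<^sup>2)"

lemma dirac_energy_nonneg [simp]: "dirac_energy a b c s \<tau> \<ge> 0"
  by (simp add: dirac_energy_def)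

text \<open>Reflection at pi/2 exchanges the endpoints, and the sign in front of \<open>s\<close>
  keeps \<mu> unchanged. The right end zone is thereby reduced to the left one.\<close>

lemma dirac_pair_reflect:
  assumes "dirac_pair a b \<mu> c s"
  shows "dirac_pair b a \<mu> (\<lambda>\<tau>. c (pi - \<tau>)) (\<lambda>\<tau>. - s (pi - \<tau>))"
proof -
  have cont: "continuous_on {0..pi} c" "continuous_on {0..pi} s" "s 0 = 0" "s pi = 0"
    and d: "\<And>\<tau>. 0 < \<tau> \<Longrightarrow> \<tau> < pi \<Longrightarrow> (c has_real_derivative \<mu> * s \<tau>) (at \<tau>)"
      "\<And>\<tau>. 0 < \<tau> \<Longrightarrow> \<tau> < pi \<Longrightarrow>
        (s has_real_derivative - \<mu> * c \<tau> - jacobi_drift a b \<tau> * s \<tau>) (at \<tau>)"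
    using assms by (auto simp: dirac_pair_def)
  have refl: "((\<lambda>\<tau>. pi - \<tau>) has_real_derivative - 1) (at \<tau>)" for \<tau> :: real
    by (auto intro!: derivative_eq_intros)
  have "((\<lambda>\<tau>. c (pi - \<tau>)) has_real_derivative \<mu> * - s (pi - \<tau>)) (at \<tau>)"
    if "0 < \<tau>" "\<tau> < pi" for \<tau>
    using DERIV_chain2[OF d(1) refl, of \<tau>] that by simp
  moreover have "((\<lambda>\<tau>. - s (pi - \<tau>)) has_real_derivative
      - \<mu> * c (pi - \<tau>) - jacobi_drift b a \<tau> * - s (pi - \<tau>)) (at \<tau>)"
    if "0 < \<tau>" "\<tau> < pi" for \<tau>
    using DERIV_minus[OF DERIV_chain2[OF d(2) refl, of \<tau>]] that
    by (simp add: jacobi_drift_reflect algebra_simps)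
  moreover have "continuous_on {0..pi} (\<lambda>\<tau>. c (pi - \<tau>))" "continuous_on {0..pi} (\<lambda>\<tau>. s (pi - \<tau>))"
    by (rule continuous_on_compose2[OF cont(1)] continuous_on_compose2[OF cont(2)];
        auto intro!: continuous_intros)+
  ultimately show ?thesis
    using cont by (auto simp: dirac_pair_def intro!: continuous_intros)
qed

text \<open>
  The corrected energy \<open>H\<close> differs from the energy by a total derivative that removes the
  oscillating main term, so that \<open>H'\<close> is controlled by the derivative of the drift.
\<close>

lemma dirac_energy_middle:
  assumes ab: "a \<ge> 0" "b \<ge> 0" and l: "l > 0" and sys: "dirac_pair a b l c s"
    and xy: "0 < x" "x \<le> y" "y < pi"
    and gx: "jacobi_drift a b x \<le> l" and gy: "- l \<le> jacobi_drift a b y"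
  shows "dirac_energy a b c s x \<le> 3 * exp 2 * dirac_energy a b c s y"
    and "dirac_energy a b c s y \<le> 3 * exp 2 * dirac_energy a b c s x"
proof -
  let ?g = "jacobi_drift a b" and ?A = "jacobi_density a b" and ?F = "dirac_energy a b c s"
  have dc: "\<And>\<tau>. 0 < \<tau> \<Longrightarrow> \<tau> < pi \<Longrightarrow> (c has_real_derivative l * s \<tau>) (at \<tau>)"
    and ds: "\<And>\<tau>. 0 < \<tau> \<Longrightarrow> \<tau> < pi \<Longrightarrow> (s has_real_derivative - l * c \<tau> - ?g \<tau> * s \<tau>) (at \<tau>)"
    using sys by (auto simp: dirac_pair_def)
  define k where "k \<tau> = a / (1 - cos \<tau>) + b / (1 + cos \<tau>)" for \<tau>
  define H where "H \<tau> = ?A \<tau> * ((c \<tau>)\<^sup>2 + (s \<tau>)\<^sup>2 + ?g \<tau> / l * (c \<tau> * s \<tau>))" for \<tau>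
  have rng: "0 < \<tau> \<and> \<tau> < pi \<and> \<bar>?g \<tau>\<bar> \<le> l \<and> k \<tau> \<ge> 0" if "x \<le> \<tau>" "\<tau> \<le> y" for \<tau>
  proof -
    have t: "0 < \<tau>" "\<tau> < pi" using that xy by auto
    have "?g \<tau> \<le> ?g x" "?g y \<le> ?g \<tau>"
      using jacobi_drift_antimono[OF ab] that xy by auto
    then show ?thesis using t gx gy ab one_minus_cos_pos[OF t] one_plus_cos_pos[OF t] by (auto simp: k_def)
  qed
  have cs: "2 * \<bar>c \<tau> * s \<tau>\<bar> \<le> (c \<tau>)\<^sup>2 + (s \<tau>)\<^sup>2" for \<tau>
    using sum_squares_bound[of "\<bar>c \<tau>\<bar>" "\<bar>s \<tau>\<bar>"] by (simp add: abs_mult)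
  \<comment> \<open>As |g| \<le> l, the correction is at most half of the energy. From
    \<open>F \<le> 2 H \<le> 3 F\<close> comes the constant 3.\<close>
  have HF: "\<bar>H \<tau> - ?F \<tau>\<bar> \<le> ?F \<tau> / 2" if "x \<le> \<tau>" "\<tau> \<le> y" for \<tau>
  proof -
    have "\<bar>H \<tau> - ?F \<tau>\<bar> = ?A \<tau> * (\<bar>?g \<tau>\<bar> / l * \<bar>c \<tau> * s \<tau>\<bar>)"
      using l by (simp add: H_def dirac_energy_def algebra_simps abs_mult)
    also have "\<dots> \<le> ?A \<tau> * (1 * (((c \<tau>)\<^sup>2 + (s \<tau>)\<^sup>2) / 2))"
      by (intro mult_left_mono mult_mono) (use rng[OF that] l cs[of \<tau>] in auto)
    finally show ?thesis by (simp add: dirac_energy_def)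
  qed
  have dH: "(H has_real_derivative - (?A \<tau> * k \<tau> * (c \<tau> * s \<tau>) / l)) (at \<tau>)" if "x \<le> \<tau>" "\<tau> \<le> y" for \<tau>
  proof -
    have t: "0 < \<tau>" "\<tau> < pi" using rng[OF that] by auto
    have dg: "(?g has_real_derivative - k \<tau>) (at \<tau>)"
      unfolding k_def by (rule jacobi_drift_has_derivative[OF t])
    have alg: "g * A * (C\<^sup>2 + S\<^sup>2 + g / l * (C * S)) + (l * S * C + l * S * C + ((- l * C - g * S) * S + (- l * C - g * S) * S)
           + (- K / l * (C * S) + (l * S * S + (- l * C - g * S) * C) * (g / l))) * A = - (A * K * (C * S) / l)"
      for g A C S K :: real
    proof -
      have "l * (g * A * (C\<^sup>2 + S\<^sup>2 + g / l * (C * S)) + (l * S * C + l * S * C + ((- l * C - g * S) * S + (- l * C - g * S) * S)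
           + (- K / l * (C * S) + (l * S * S + (- l * C - g * S) * C) * (g / l))) * A) = l * (- (A * K * (C * S) / l))"
        using l by (simp add: power2_eq_square algebra_simps)
      then show ?thesis using l by (metis mult_left_cancel less_irrefl)
    qed
    have dcs: "((\<lambda>\<tau>. c \<tau> * c \<tau> + s \<tau> * s \<tau> + ?g \<tau> / l * (c \<tau> * s \<tau>)) has_real_derivative
       (l * s \<tau> * c \<tau> + l * s \<tau> * c \<tau> + ((- l * c \<tau> - ?g \<tau> * s \<tau>) * s \<tau> + (- l * c \<tau> - ?g \<tau> * s \<tau>) * s \<tau>)
           + (- k \<tau> / l * (c \<tau> * s \<tau>) + (l * s \<tau> * s \<tau> + (- l * c \<tau> - ?g \<tau> * s \<tau>) * c \<tau>) * (?g \<tau> / l)))) (at \<tau>)"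
      by (intro DERIV_add DERIV_mult DERIV_cdivide dc[OF t] ds[OF t] dg)
    show ?thesis
      using DERIV_mult[OF jacobi_density_has_derivative[OF t, of a b] dcs] alg[of "?g \<tau>" "?A \<tau>" "c \<tau>" "s \<tau>" "k \<tau>"]
      unfolding H_def[abs_def] by (simp add: power2_eq_square)
  qed
  have kH: "?A \<tau> * k \<tau> * \<bar>c \<tau> * s \<tau>\<bar> / l \<le> k \<tau> / l * H \<tau>" if "x \<le> \<tau>" "\<tau> \<le> y" for \<tau>
  proof -
    have "?A \<tau> * k \<tau> * \<bar>c \<tau> * s \<tau>\<bar> / l = k \<tau> / l * (?A \<tau> * \<bar>c \<tau> * s \<tau>\<bar>)" by simp
    also have "\<dots> \<le> k \<tau> / l * (?A \<tau> * (((c \<tau>)\<^sup>2 + (s \<tau>)\<^sup>2) / 2))"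
      by (intro mult_left_mono) (use rng[OF that] l cs[of \<tau>] in auto)
    also have "\<dots> \<le> k \<tau> / l * H \<tau>"
    proof (intro mult_left_mono)
      have "?F \<tau> \<le> 2 * H \<tau>" using HF[OF that] by linarith
      then show "?A \<tau> * (((c \<tau>)\<^sup>2 + (s \<tau>)\<^sup>2) / 2) \<le> H \<tau>" by (simp add: dirac_energy_def)
    qed (use rng[OF that] l in auto)
    finally show ?thesis .
  qed
  have dg: "(?g has_real_derivative - k \<tau>) (at \<tau>)" if "x \<le> \<tau>" "\<tau> \<le> y" for \<tau>
    unfolding k_def using rng[OF that] by (intro jacobi_drift_has_derivative) auto
  \<comment> \<open>\<open>k / l\<close> is minus the derivative of \<open>g / l\<close>, so
    \<open>exp (g / l)\<close> and \<open>exp (- g / l)\<close> are explicit integrating factors for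
    \<open>|H'| \<le> (k / l) H\<close>. As \<open>g / l\<close> stays in [-1, 1], the total loss is
    at most \<open>exp 2\<close>, whatever the size of \<open>l\<close>.\<close>
  have U: "H y * exp (?g y / l) \<le> H x * exp (?g x / l)"
  proof (rule DERIV_nonpos_imp_nonincreasing[OF xy(2)], intro exI conjI)
    fix \<tau> assume t: "x \<le> \<tau>" "\<tau> \<le> y"
    show "((\<lambda>\<tau>. H \<tau> * exp (?g \<tau> / l)) has_real_derivative
       exp (?g \<tau> / l) * (- (?A \<tau> * k \<tau> * (c \<tau> * s \<tau>) / l) - k \<tau> / l * H \<tau>)) (at \<tau>)"
      by (rule DERIV_cong, (rule derivative_intros DERIV_fun_exp DERIV_cdivide dH[OF t] dg[OF t])+)
         (simp add: algebra_simps)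
    have "- (?A \<tau> * k \<tau> * (c \<tau> * s \<tau>) / l) \<le> ?A \<tau> * k \<tau> * \<bar>c \<tau> * s \<tau>\<bar> / l"
    proof -
      have "(?A \<tau> * k \<tau> / l) * (- (c \<tau> * s \<tau>)) \<le> (?A \<tau> * k \<tau> / l) * \<bar>c \<tau> * s \<tau>\<bar>"
        using rng[OF t] l by (intro mult_left_mono) auto
      then show ?thesis by simp
    qed
    then show "exp (?g \<tau> / l) * (- (?A \<tau> * k \<tau> * (c \<tau> * s \<tau>) / l) - k \<tau> / l * H \<tau>) \<le> 0"
      using kH[OF t] by (intro mult_nonneg_nonpos) auto
  qed
  have V: "H x * exp (- ?g x / l) \<le> H y * exp (- ?g y / l)"
  proof (rule DERIV_nonneg_imp_nondecreasing[OF xy(2)], intro exI conjI)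
    fix \<tau> assume t: "x \<le> \<tau>" "\<tau> \<le> y"
    show "((\<lambda>\<tau>. H \<tau> * exp (- ?g \<tau> / l)) has_real_derivative
       exp (- ?g \<tau> / l) * (- (?A \<tau> * k \<tau> * (c \<tau> * s \<tau>) / l) + k \<tau> / l * H \<tau>)) (at \<tau>)"
      by (rule DERIV_cong, (rule derivative_intros DERIV_fun_exp DERIV_cdivide dH[OF t] dg[OF t])+)
         (simp add: algebra_simps)
    have "?A \<tau> * k \<tau> * (c \<tau> * s \<tau>) / l \<le> ?A \<tau> * k \<tau> * \<bar>c \<tau> * s \<tau>\<bar> / l"
      using rng[OF t] l by (simp add: mult_left_mono divide_right_mono)
    then show "0 \<le> exp (- ?g \<tau> / l) * (- (?A \<tau> * k \<tau> * (c \<tau> * s \<tau>) / l) + k \<tau> / l * H \<tau>)"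
      using kH[OF t] by (intro mult_nonneg_nonneg) auto
  qed
  have Hpos: "H x \<ge> 0" "H y \<ge> 0"
    using HF[of x] HF[of y] xy dirac_energy_nonneg[of a b c s x] dirac_energy_nonneg[of a b c s y]
    by linarith+
  have e2: "exp (?g x / l - ?g y / l) \<le> exp 2"
  proof -
    have "?g x / l \<le> 1" "?g y / l \<ge> - 1" using gx gy l by (auto simp: field_simps)
    then show ?thesis by simp
  qed
  have Hyx: "H y \<le> exp 2 * H x"
  proof -
    have "H y = (H y * exp (?g y / l)) * exp (- (?g y / l))" by (simp add: exp_minus field_simps)
    also have "\<dots> \<le> (H x * exp (?g x / l)) * exp (- (?g y / l))" using U by (intro mult_right_mono) auto
    also have "\<dots> = H x * exp (?g x / l - ?g y / l)" by (simp add: exp_diff exp_minus field_simps)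
    also have "\<dots> \<le> H x * exp 2" using Hpos e2 by (intro mult_left_mono)
    finally show ?thesis by (simp add: mult.commute)
  qed
  have Hxy: "H x \<le> exp 2 * H y"
  proof -
    have "H x = (H x * exp (- ?g x / l)) * exp (?g x / l)" by (simp add: exp_minus field_simps)
    also have "\<dots> \<le> (H y * exp (- ?g y / l)) * exp (?g x / l)" using V by (intro mult_right_mono) auto
    also have "\<dots> = H y * exp (?g x / l - ?g y / l)" by (simp add: exp_diff exp_minus field_simps)
    also have "\<dots> \<le> H y * exp 2" using Hpos e2 by (intro mult_left_mono)
    finally show ?thesis by (simp add: mult.commute)
  qed
  have hx: "?F x \<le> 2 * H x" "2 * H x \<le> 3 * ?F x" using HF[of x] xy unfolding abs_le_iff by linarith+
  have hy: "?F y \<le> 2 * H y" "2 * H y \<le> 3 * ?F y" using HF[of y] xy unfolding abs_le_iff by linarith+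
  have "?F x \<le> exp 2 * (2 * H y)" using hx Hxy by simp
  also have "\<dots> \<le> exp 2 * (3 * ?F y)" by (intro mult_left_mono hy) auto
  finally show "?F x \<le> 3 * exp 2 * ?F y" by simp
  have "?F y \<le> exp 2 * (2 * H x)" using hy Hyx by simp
  also have "\<dots> \<le> exp 2 * (3 * ?F x)" by (intro mult_left_mono hx) auto
  finally show "?F y \<le> 3 * exp 2 * ?F x" by simp
qed


section \<open>Elementary estimates for 1 - cos\<close>

lemma sin_times_self_le: "0 \<le> x \<Longrightarrow> x \<le> pi \<Longrightarrow> x * sin x \<le> 2 * (1 - cos x)" for x :: real
proof -
  assume x: "0 \<le> x" "x \<le> pi"
  have 1: "0 \<le> sin y - y * cos y" if "0 \<le> y" "y \<le> pi" for y :: real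
  proof -
    have "sin 0 - 0 * cos 0 \<le> sin y - y * cos (y::real)"
    proof (rule DERIV_nonneg_imp_nondecreasing[OF that(1)], intro exI conjI)
      fix z assume z: "0 \<le> z" "z \<le> y"
      show "((\<lambda>z. sin z - z * cos z) has_real_derivative z * sin z) (at z)"
        by (auto intro!: derivative_eq_intros)
      show "0 \<le> z * sin z" using z that by (intro mult_nonneg_nonneg sin_ge_zero) auto
    qed
    then show ?thesis by simp
  qed
  have "2 * (1 - cos 0) - 0 * sin 0 \<le> 2 * (1 - cos x) - x * sin x"
  proof (rule DERIV_nonneg_imp_nondecreasing[OF x(1)], intro exI conjI)
    fix y assume y: "0 \<le> y" "y \<le> x"
    show "((\<lambda>z. 2 * (1 - cos z) - z * sin z) has_real_derivative sin y - y * cos y) (at y)"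
      by (auto intro!: derivative_eq_intros)
    show "0 \<le> sin y - y * cos y" using 1 y x by auto
  qed
  then show ?thesis by simp
qed

text \<open>The quotient (1 - cos x) / x^2 decreases, its derivative having the sign given by
  \<open>sin_times_self_le\<close>. Compared with the endpoint pi it yields the quadratic lower
  bound for the heat exponent.\<close>

lemma one_minus_cos_ratio:
  fixes x y :: real
  assumes "0 < x" "x \<le> y" "y \<le> pi"
  shows "(1 - cos y) * x\<^sup>2 \<le> (1 - cos x) * y\<^sup>2"
proof -
  have "(1 - cos y) / y\<^sup>2 \<le> (1 - cos x) / x\<^sup>2"
  proof (rule DERIV_nonpos_imp_nonincreasing[OF assms(2)], intro exI conjI)
    fix z assume z: "x \<le> z" "z \<le> y"
    show "((\<lambda>z. (1 - cos z) / z\<^sup>2) has_real_derivative (z * sin z - 2 * (1 - cos z)) / z ^ 3) (at z)"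
      using z assms
      by (auto intro!: derivative_eq_intros simp: divide_simps) (simp add: algebra_simps power2_eq_square power3_eq_cube power4_eq_xxxx)
    show "(z * sin z - 2 * (1 - cos z)) / z ^ 3 \<le> 0"
      using z assms sin_times_self_le[of z] by (intro divide_nonpos_pos) auto
  qed
  then show ?thesis using assms by (simp add: field_simps)
qed

lemma one_minus_cos_ge:
  fixes x :: real
  assumes "0 \<le> x" "x \<le> pi"
  shows "2 * x\<^sup>2 / pi\<^sup>2 \<le> 1 - cos x"
  using one_minus_cos_ratio[of x pi] assms by (cases "x = 0") (auto simp: field_simps)

text \<open>Locates the left turning point: \<open>g y = l\<close> forces
  \<open>l y \<le> 2 a\<close>.\<close>

lemma jacobi_drift_le:
  assumes "a \<ge> 0" "b \<ge> 0" "0 < y" "y < pi"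
  shows "jacobi_drift a b y \<le> 2 * a / y"
proof -
  have "b * sin y / (1 + cos y) \<ge> 0"
    using assms one_plus_cos_pos[of y] sin_gt_zero[of y] by (intro divide_nonneg_pos mult_nonneg_nonneg) auto
  moreover have "a * (sin y / (1 - cos y)) \<le> a * (2 / y)"
    using assms sin_times_self_le[of y] cos_less_1[of y]
    by (intro mult_left_mono) (auto simp: field_simps)
  ultimately show ?thesis by (simp add: jacobi_drift_def mult.commute)
qed

text \<open>Left of the turning point \<open>y\<close> the drift exceeds \<open>l\<close>, so
  \<open>A\<close> increases while \<open>E = c^2 + s^2\<close> decreases; the energy is thus at
  most \<open>A y * E 0\<close>. It remains to bound \<open>E 0\<close> by \<open>E y\<close>: close
  to 0 the function \<open>c\<close> hardly moves, and further on \<open>E A^2\<close> increases.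
  The constant depends on \<open>a\<close> alone because \<open>l y \<le> 2 a\<close>.\<close>

lemma dirac_energy_left:
  assumes ab: "a \<ge> 0" "b \<ge> 0" and l: "l > 0" and sys: "dirac_pair a b l c s"
    and x: "0 < x" "x \<le> y" and y: "y < pi" and gy: "jacobi_drift a b y = l"
  shows "dirac_energy a b c s x \<le> 2 * (max 1 ((4 * a) powr (2 * a)))\<^sup>2 * dirac_energy a b c s y"
proof -
  let ?g = "jacobi_drift a b" and ?A = "jacobi_density a b" and ?F = "dirac_energy a b c s"
  have dc: "\<And>\<tau>. 0 < \<tau> \<Longrightarrow> \<tau> < pi \<Longrightarrow> (c has_real_derivative l * s \<tau>) (at \<tau>)"
    and ds: "\<And>\<tau>. 0 < \<tau> \<Longrightarrow> \<tau> < pi \<Longrightarrow> (s has_real_derivative - l * c \<tau> - ?g \<tau> * s \<tau>) (at \<tau>)"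
    and cc: "continuous_on {0..pi} c" and cs: "continuous_on {0..pi} s" and s0: "s 0 = 0"
    using sys by (auto simp: dirac_pair_def)
  have y0: "0 < y" using x by simp
  have sub: "{u..v} \<subseteq> {0..pi}" if "0 \<le> u" "v \<le> y" for u v using that y by auto
  have c_on: "continuous_on {u..v} c" and s_on: "continuous_on {u..v} s"
    and A_on: "continuous_on {u..v} ?A" if "0 \<le> u" "v \<le> y" for u v
    using continuous_on_subset[OF cc sub[OF that]] continuous_on_subset[OF cs sub[OF that]]
      continuous_jacobi_density[OF ab] by auto
  have g_ge: "?g \<tau> \<ge> l" if "0 < \<tau>" "\<tau> \<le> y" for \<tau>
    using jacobi_drift_antimono[OF ab that y] gy by simp
  have A_mono: "?A u \<le> ?A v" if "0 \<le> u" "u \<le> v" "v \<le> y" for u v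
  proof (rule DERIV_nonneg_imp_increasing_open[OF that(2)])
    show "\<exists>D. (?A has_real_derivative D) (at \<tau>) \<and> 0 \<le> D" if "u < \<tau>" "\<tau> < v" for \<tau>
      using that \<open>0 \<le> u\<close> \<open>v \<le> y\<close> y g_ge[of \<tau>] l
      by (intro exI[of _ "?g \<tau> * ?A \<tau>"] conjI jacobi_density_has_derivative mult_nonneg_nonneg) auto
  qed (use A_on that in auto)
  define E where "E \<tau> = c \<tau> * c \<tau> + s \<tau> * s \<tau>" for \<tau>
  have E_nonneg: "E \<tau> \<ge> 0" for \<tau> by (simp add: E_def)
  have F: "?F \<tau> = ?A \<tau> * E \<tau>" for \<tau> by (simp add: E_def dirac_energy_def power2_eq_square)
  have dE: "(E has_real_derivative - 2 * ?g \<tau> * (s \<tau> * s \<tau>)) (at \<tau>)" if "0 < \<tau>" "\<tau> < pi" for \<tau>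
    using DERIV_add[OF DERIV_mult[OF dc[OF that] dc[OF that]] DERIV_mult[OF ds[OF that] ds[OF that]]]
    unfolding E_def[abs_def] by (rule DERIV_cong) (simp add: algebra_simps)
  have E_mono: "E v \<le> E u" if "0 \<le> u" "u \<le> v" "v \<le> y" for u v
  proof (rule DERIV_nonpos_imp_decreasing_open[OF that(2)])
    show "\<exists>D. (E has_real_derivative D) (at \<tau>) \<and> D \<le> 0" if "u < \<tau>" "\<tau> < v" for \<tau>
      using that \<open>0 \<le> u\<close> \<open>v \<le> y\<close> y g_ge[of \<tau>] l
      by (intro exI[of _ "- 2 * ?g \<tau> * (s \<tau> * s \<tau>)"] conjI dE) (auto intro!: mult_nonneg_nonneg)
    show "continuous_on {u..v} E"
      unfolding E_def[abs_def] by (intro continuous_intros c_on s_on) (use that in auto)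
  qed
  have E0: "E 0 = (c 0)\<^sup>2" by (simp add: E_def s0 power2_eq_square)
  have c_le: "\<bar>c \<tau>\<bar> \<le> \<bar>c 0\<bar>" if "0 \<le> \<tau>" "\<tau> \<le> y" for \<tau>
  proof -
    have "(c \<tau>)\<^sup>2 \<le> E \<tau>" by (simp add: E_def power2_eq_square)
    also have "\<dots> \<le> (c 0)\<^sup>2" using E_mono[of 0 \<tau>] that E0 by simp
    finally show ?thesis by (simp add: abs_le_square_iff)
  qed
  \<comment> \<open>The derivative of \<open>A s\<close> is \<open>- l A c\<close>, free of drift;
    the mean value theorem and the monotonicity of \<open>A\<close> finish.\<close>
  have s_le: "\<bar>s \<tau>\<bar> \<le> l * \<tau> * \<bar>c 0\<bar>" if t: "0 < \<tau>" "\<tau> \<le> y" for \<tau>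
  proof -
    have "\<exists>l z. 0 < z \<and> z < \<tau> \<and> ((\<lambda>\<tau>. ?A \<tau> * s \<tau>) has_real_derivative l) (at z) \<and>
        ?A \<tau> * s \<tau> - ?A 0 * s 0 = (\<tau> - 0) * l"
    proof (rule MVT)
      show "(\<lambda>\<tau>. ?A \<tau> * s \<tau>) differentiable (at z)" if "0 < z" "z < \<tau>" for z
        using DERIV_mult[OF jacobi_density_has_derivative ds, of z] that t y
        by (auto simp: real_differentiable_def)
    qed (use t in \<open>auto intro!: continuous_intros A_on s_on\<close>)
    then obtain D z where z: "0 < z" "z < \<tau>" and D: "((\<lambda>\<tau>. ?A \<tau> * s \<tau>) has_real_derivative D) (at z)"
      "?A \<tau> * s \<tau> = \<tau> * D" using s0 by auto
    have "D = - l * (?A z * c z)"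
      by (rule DERIV_unique[OF D(1)], rule DERIV_cong[OF DERIV_mult[OF jacobi_density_has_derivative ds]])
         (use z t y in \<open>auto simp: algebra_simps\<close>)
    with D(2) have z3: "?A \<tau> * s \<tau> = - \<tau> * l * (?A z * c z)" by simp
    have Ap: "?A \<tau> > 0" using t y by (intro jacobi_density_pos) auto
    have "?A \<tau> * \<bar>s \<tau>\<bar> = \<bar>?A \<tau> * s \<tau>\<bar>" by (simp add: abs_mult)
    also have "\<dots> = \<tau> * l * (?A z * \<bar>c z\<bar>)" using z z3 t l by (simp add: abs_mult)
    also have "\<dots> \<le> \<tau> * l * (?A \<tau> * \<bar>c 0\<bar>)"
      using z t l A_mono[of z \<tau>] c_le[of z] by (intro mult_left_mono mult_mono) auto
    finally have "?A \<tau> * \<bar>s \<tau>\<bar> \<le> ?A \<tau> * (l * \<tau> * \<bar>c 0\<bar>)" by (simp add: algebra_simps)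
    then show ?thesis using Ap by (simp only: mult_le_cancel_left_pos)
  qed
  \<comment> \<open>On [0, \<sigma>] one has \<open>l \<tau> \<le> 1/2\<close>, so \<open>c\<close>
    changes by at most a quarter of \<open>c 0\<close>, and (3/4)^2 > 1/2. Either \<sigma> is
    \<open>y\<close> itself, or \<open>y / \<sigma> = 2 l y \<le> 4 a\<close>.\<close>
  define \<sigma> where "\<sigma> = min y (1 / (2 * l))"
  have \<sigma>: "0 < \<sigma>" "\<sigma> \<le> y" "l * \<sigma> \<le> 1 / 2" using y0 l by (auto simp: \<sigma>_def min_def field_simps)
  have E\<sigma>: "E 0 \<le> 2 * E \<sigma>"
  proof -
    have "\<exists>D z. 0 < z \<and> z < \<sigma> \<and> (c has_real_derivative D) (at z) \<and> c \<sigma> - c 0 = (\<sigma> - 0) * D"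
    proof (rule MVT)
      show "c differentiable (at z)" if "0 < z" "z < \<sigma>" for z
        using dc[of z] that \<sigma> y by (auto simp: real_differentiable_def)
    qed (use \<sigma> in \<open>auto intro!: c_on\<close>)
    then obtain D z where z': "0 < z" "z < \<sigma>" "(c has_real_derivative D) (at z)" "c \<sigma> - c 0 = \<sigma> * D" by auto
    moreover have "D = l * s z" by (rule DERIV_unique[OF z'(3) dc]) (use z' \<sigma> y in auto)
    ultimately have z: "0 < z" "z < \<sigma>" "c \<sigma> - c 0 = \<sigma> * (l * s z)" by auto
    have "\<bar>c \<sigma> - c 0\<bar> = \<sigma> * l * \<bar>s z\<bar>" using z \<sigma> l by (simp add: abs_mult)
    also have "\<dots> \<le> \<sigma> * l * (l * \<sigma> * \<bar>c 0\<bar>)"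
    proof (intro mult_left_mono)
      have "l * z * \<bar>c 0\<bar> \<le> l * \<sigma> * \<bar>c 0\<bar>" using z l by (intro mult_right_mono) auto
      then show "\<bar>s z\<bar> \<le> l * \<sigma> * \<bar>c 0\<bar>" using s_le[of z] z \<sigma> by auto
    qed (use \<sigma> l in auto)
    also have "\<dots> = (l * \<sigma>) * (l * \<sigma>) * \<bar>c 0\<bar>" by simp
    also have "\<dots> \<le> (1/2) * (1/2) * \<bar>c 0\<bar>"
      by (intro mult_right_mono mult_mono) (use \<sigma> l in auto)
    finally have "3 / 4 * \<bar>c 0\<bar> \<le> \<bar>c \<sigma>\<bar>" by linarith
    then have "(3 / 4 * \<bar>c 0\<bar>)\<^sup>2 \<le> \<bar>c \<sigma>\<bar>\<^sup>2" by (intro power_mono) auto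
    then have "9 / 16 * (c 0)\<^sup>2 \<le> (c \<sigma>)\<^sup>2" by (simp add: power_mult_distrib power_divide)
    moreover have "(c \<sigma>)\<^sup>2 \<le> E \<sigma>" by (simp add: E_def power2_eq_square)
    ultimately show ?thesis unfolding E0 using zero_le_power2[of "c 0"] by linarith
  qed
  \<comment> \<open>The derivative of \<open>E A^2\<close> is \<open>2 g A^2 c^2\<close>: the square
    of the density exactly compensates the loss \<open>- 2 g s^2\<close> of
    \<open>E\<close>.\<close>
  have EA: "E \<sigma> * (?A \<sigma> * ?A \<sigma>) \<le> E y * (?A y * ?A y)"
  proof (rule DERIV_nonneg_imp_nondecreasing[OF \<sigma>(2)], intro exI conjI)
    fix \<tau> assume t: "\<sigma> \<le> \<tau>" "\<tau> \<le> y"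
    then have t': "0 < \<tau>" "\<tau> < pi" using \<sigma> y by auto
    show "((\<lambda>\<tau>. E \<tau> * (?A \<tau> * ?A \<tau>)) has_real_derivative 2 * ?g \<tau> * (?A \<tau> * ?A \<tau>) * (c \<tau> * c \<tau>)) (at \<tau>)"
      using DERIV_mult[OF dE[OF t'] DERIV_mult[OF jacobi_density_has_derivative[OF t'] jacobi_density_has_derivative[OF t']]]
      by (rule DERIV_cong) (simp add: algebra_simps E_def)
    show "0 \<le> 2 * ?g \<tau> * (?A \<tau> * ?A \<tau>) * (c \<tau> * c \<tau>)"
      using g_ge[of \<tau>] t t' l by (intro mult_nonneg_nonneg zero_le_square) auto
  qed
  define M where "M = max 1 ((4 * a) powr (2 * a))"
  have M1: "1 \<le> M" by (simp add: M_def)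
  have AM: "?A y \<le> M * ?A \<sigma>"
  proof (cases "\<sigma> = y")
    case True
    then show ?thesis using M1 mult_right_mono[of 1 M "?A y"] by simp
  next
    case False
    then have s2: "\<sigma> = 1 / (2 * l)" by (auto simp: \<sigma>_def min_def split: if_splits)
    \<comment> \<open>The logarithmic derivative of \<open>A\<close> is at most
      \<open>2 a / \<tau>\<close>, so \<open>A\<close> grows no faster than the power
      \<open>\<tau>^(2 a)\<close>.\<close>
    have "?A y * y powr (- 2 * a) \<le> ?A \<sigma> * \<sigma> powr (- 2 * a)"
    proof (rule DERIV_nonpos_imp_nonincreasing[OF \<sigma>(2)], intro exI conjI)
      fix \<tau> assume t: "\<sigma> \<le> \<tau>" "\<tau> \<le> y"
      then have t': "0 < \<tau>" "\<tau> < pi" using \<sigma> y by auto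
      have p: "((\<lambda>\<tau>. \<tau> powr (- 2 * a)) has_real_derivative (- 2 * a) * \<tau> powr (- 2 * a - 1)) (at \<tau>)"
        using t' by (auto intro!: derivative_eq_intros)
      show "((\<lambda>\<tau>. ?A \<tau> * \<tau> powr (- 2 * a)) has_real_derivative
         (?g \<tau> - 2 * a / \<tau>) * (?A \<tau> * \<tau> powr (- 2 * a))) (at \<tau>)"
        using DERIV_mult[OF jacobi_density_has_derivative[OF t', of a b] p]
        by (rule DERIV_cong) (use t' in \<open>simp add: powr_diff algebra_simps\<close>)
      show "(?g \<tau> - 2 * a / \<tau>) * (?A \<tau> * \<tau> powr (- 2 * a)) \<le> 0"
        using jacobi_drift_le[OF ab t'] by (intro mult_nonpos_nonneg mult_nonneg_nonneg) auto
    qed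
    then have "?A y * y powr (- 2 * a) * y powr (2 * a) \<le> ?A \<sigma> * \<sigma> powr (- 2 * a) * y powr (2 * a)"
      by (rule mult_right_mono) auto
    then have 1: "?A y \<le> ?A \<sigma> * (y / \<sigma>) powr (2 * a)"
      using y0 \<sigma> by (simp add: powr_minus powr_divide field_simps)
    have "(y / \<sigma>) powr (2 * a) \<le> (4 * a) powr (2 * a)"
    proof (rule powr_mono2)
      have "l \<le> 2 * a / y" using jacobi_drift_le[OF ab y0 y] gy by simp
      then show "y / \<sigma> \<le> 4 * a" using y0 l unfolding s2 by (simp add: field_simps)
    qed (use ab y0 \<sigma> in auto)
    also have "\<dots> \<le> M" by (simp add: M_def)
    finally have "?A \<sigma> * (y / \<sigma>) powr (2 * a) \<le> ?A \<sigma> * M" by (intro mult_left_mono) auto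
    with 1 show ?thesis by (simp add: mult.commute)
  qed
  have Ay: "?A y > 0" using y0 y by (intro jacobi_density_pos)
  have "E 0 * (?A y * ?A y) \<le> 2 * E \<sigma> * (M * ?A \<sigma> * (M * ?A \<sigma>))"
    using E\<sigma> AM E_nonneg M1 by (intro mult_mono) auto
  also have "\<dots> = 2 * M\<^sup>2 * (E \<sigma> * (?A \<sigma> * ?A \<sigma>))" by (simp add: power2_eq_square)
  also have "\<dots> \<le> 2 * M\<^sup>2 * (E y * (?A y * ?A y))" using EA by (intro mult_left_mono) auto
  finally have "?A y * (?A y * E 0) \<le> ?A y * (2 * M\<^sup>2 * (?A y * E y))" by (simp add: algebra_simps)
  then have "?A y * E 0 \<le> 2 * M\<^sup>2 * ?F y" using Ay by (simp only: mult_le_cancel_left_pos F)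
  moreover have "?F x \<le> ?A y * E 0"
    unfolding F using x A_mono[of x y] E_mono[of 0 x] E_nonneg by (intro mult_mono) auto
  ultimately show ?thesis by (simp add: M_def)
qed

text \<open>The reference points in [1, 2] stay away from both ends and lie in the middle zone once
  \<open>l\<close> is large; the inequality will be averaged over them. A point of an end zone is
  first compared with its turning point, and that one with \<open>y\<close> through the middle
  zone.\<close>

lemma dirac_energy_bound:
  assumes ab: "a \<ge> 0" "b \<ge> 0"
  obtains C L where "C > 0" "L > 0"
    "\<And>l c s x y. L \<le> l \<Longrightarrow> dirac_pair a b l c s \<Longrightarrow> 0 < x \<Longrightarrow> x < pi \<Longrightarrow> 1 \<le> y \<Longrightarrow> y \<le> 2 \<Longrightarrow>
       dirac_energy a b c s x \<le> C * dirac_energy a b c s y"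
proof -
  define M where "M a = 2 * (max 1 ((4 * a) powr (2 * a)))\<^sup>2" for a :: real
  have M1: "M a \<ge> 1" for a
  proof -
    have "1 \<le> (max 1 ((4 * a) powr (2 * a)))\<^sup>2" by (intro one_le_power) auto
    then have "1 \<le> 2 * (max 1 ((4 * a) powr (2 * a)))\<^sup>2" by linarith
    then show ?thesis unfolding M_def .
  qed
  \<comment> \<open>Since the drift decreases, its values at 1 and 2 control it on [1, 2]. The entry
    1 makes \<open>L\<close> positive.\<close>
  define L where "L = Max {1, jacobi_drift a b 1, - jacobi_drift a b 2}"
  have L: "1 \<le> L" "jacobi_drift a b 1 \<le> L" "- jacobi_drift a b 2 \<le> L" by (auto simp: L_def)
  define K where "K = 3 * exp (2::real)"
  have K0: "K > 0" by (simp add: K_def)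
  have pi3: "pi > 3" using pi_gt3 .
  have left: "dirac_energy a b c s x \<le> M a * K * dirac_energy a b c s y"
    if ab: "a \<ge> 0" "b \<ge> 0" and l: "l > 0" and sys: "dirac_pair a b l c s" and x: "0 < x" "x < pi"
      and y: "0 < y" "y < pi" and gx: "jacobi_drift a b x > l"
      and gy: "\<bar>jacobi_drift a b y\<bar> \<le> l" for a b l c s x y
  proof -
    have xy: "x \<le> y" using jacobi_drift_antimono[OF ab y(1), of x] x gx gy by (cases "x \<le> y") auto
    have "\<exists>z\<ge>x. z \<le> y \<and> jacobi_drift a b z = l"
    proof (rule IVT2')
      show "continuous_on {x..y} (jacobi_drift a b)"
        using x y by (intro continuous_at_imp_continuous_on ballI DERIV_isCont[OF jacobi_drift_has_derivative]) auto
    qed (use gx gy xy in auto)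
    then obtain z where z: "x \<le> z" "z \<le> y" "jacobi_drift a b z = l" by auto
    have "dirac_energy a b c s x \<le> M a * dirac_energy a b c s z"
      unfolding M_def using z y by (intro dirac_energy_left[OF ab l sys x(1) z(1) _ z(3)]) auto
    also have "\<dots> \<le> M a * (K * dirac_energy a b c s y)"
      unfolding K_def using z x y gy M1[of a]
      by (intro mult_left_mono dirac_energy_middle(1)[OF ab l sys]) auto
    finally show ?thesis by simp
  qed
  show thesis
  proof (rule that[of "M a * K + M b * K + K" L])
    show "M a * K + M b * K + K > 0" using K0 M1[of a] M1[of b] by (intro add_pos_pos mult_pos_pos) auto
    show "L > 0" using L by simp
    fix l c s x y
    assume l: "L \<le> l" and sys: "dirac_pair a b l c s" and x: "0 < x" "x < pi" and y: "(1::real) \<le> y" "y \<le> 2"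
    have l0: "l > 0" using l L by simp
    have y': "0 < y" "y < pi" using y pi3 by auto
    have gy: "\<bar>jacobi_drift a b y\<bar> \<le> l"
      using jacobi_drift_antimono[OF ab, of 1 y] jacobi_drift_antimono[OF ab, of y 2] y y' L l pi3 by auto
    let ?F = "dirac_energy a b c s"
    have F0: "?F y \<ge> 0" by simp
    have *: "M a * K * ?F y \<ge> 0" "M b * K * ?F y \<ge> 0" "K * ?F y \<ge> 0"
      using K0 M1[of a] M1[of b] by (auto intro!: mult_nonneg_nonneg)
    have "?F x \<le> M a * K * ?F y \<or> ?F x \<le> M b * K * ?F y \<or> ?F x \<le> K * ?F y"
    proof -
      consider "jacobi_drift a b x > l" | "jacobi_drift a b x < - l" | "\<bar>jacobi_drift a b x\<bar> \<le> l" by linarith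
      then show ?thesis
      proof cases
        case 1
        then show ?thesis using left[OF ab l0 sys x y' _ gy] by simp
      next
        case 2
        \<comment> \<open>After reflection the drift at \<open>pi - x\<close> exceeds
          \<open>l\<close> and the parameters are exchanged, whence the constant
          \<open>M b\<close>.\<close>
        let ?R = "dirac_energy b a (\<lambda>\<tau>. c (pi - \<tau>)) (\<lambda>\<tau>. - s (pi - \<tau>))"
        have refl: "?R (pi - \<tau>) = ?F \<tau>" for \<tau>
          by (simp add: dirac_energy_def jacobi_density_reflect)
        have "?R (pi - x)
           \<le> M b * K * ?R (pi - y)"
          using x y' gy 2 by (intro left[OF ab(2,1) l0 dirac_pair_reflect[OF sys]]) (auto simp: jacobi_drift_reflect)
        then show ?thesis unfolding refl by simp
      next
        case 3
        have "?F x \<le> K * ?F y"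
        proof (cases "x \<le> y")
          case True
          then show ?thesis unfolding K_def using 3 gy x y' by (intro dirac_energy_middle(1)[OF ab l0 sys]) auto
        next
          case False
          then show ?thesis unfolding K_def using 3 gy x y' by (intro dirac_energy_middle(2)[OF ab l0 sys]) auto
        qed
        then show ?thesis by simp
      qed
    qed
    then show "?F x \<le> (M a * K + M b * K + K) * ?F y"
      using * by (auto simp: distrib_right)
  qed
qed

section \<open>Heat integrals\<close>

definition heat_mult :: "real \<Rightarrow> real \<Rightarrow> real" where
  "heat_mult t \<tau> = exp (- (1 - cos \<tau>) * t)"

text \<open>The density times the real part of
  \<open>(c - \<i> s) * cnj (c' - \<i> s')\<close>.\<close>

definition pair_density ::
  "real \<Rightarrow> real \<Rightarrow> (real \<Rightarrow> real) \<Rightarrow> (real \<Rightarrow> real) \<Rightarrow> (real \<Rightarrow> real) \<Rightarrow> (real \<Rightarrow> real) \<Rightarrow> real \<Rightarrow> real" where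
  "pair_density a b c s c' s' \<tau> = jacobi_density a b \<tau> * (c \<tau> * c' \<tau> + s \<tau> * s' \<tau>)"

lemma continuous_heat_mult [continuous_intros]: "continuous_on S (heat_mult t)"
  unfolding heat_mult_def[abs_def] by (intro continuous_intros)

lemma heat_mult_nonneg [simp]: "heat_mult t \<tau> \<ge> 0"
  by (simp add: heat_mult_def)

text \<open>The integrand is the derivative of \<open>U\<close>. Here \<open>Q' = \<delta> P\<close>
  has no drift and \<open>P' = g R - \<delta> Q\<close>, so the two terms in \<open>Q\<close> cancel
  and \<open>g\<close> survives only as \<open>sin * g\<close>. At the endpoints \<open>U\<close>
  vanishes together with sin, \<open>s\<close> and \<open>s'\<close>.\<close>

lemma pair_heat_identity:
  assumes ab: "a \<ge> 0" "b \<ge> 0" and 1: "dirac_pair a b \<mu> c s" and 2: "dirac_pair a b \<nu> c' s'"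
  shows "((\<lambda>\<tau>. (\<mu> - \<nu>)\<^sup>2 * (heat_mult t \<tau> * pair_density a b c s c' s' \<tau>)
            + heat_mult t \<tau> * ((t\<^sup>2 * (sin \<tau>)\<^sup>2 - t * cos \<tau>) * pair_density a b c s c' s' \<tau>
               - t * (a * (1 + cos \<tau>) - b * (1 - cos \<tau>)) * pair_density a b c s c' (\<lambda>\<tau>. - s' \<tau>) \<tau>))
          has_integral 0) {0..pi}"
proof -
  let ?A = "jacobi_density a b" and ?g = "jacobi_drift a b" and ?G = "heat_mult t"
  have cont: "continuous_on {0..pi} c" "continuous_on {0..pi} s" "continuous_on {0..pi} c'" "continuous_on {0..pi} s'"
    and z: "s 0 = 0" "s pi = 0" "s' 0 = 0" "s' pi = 0"
    using 1 2 by (auto simp: dirac_pair_def)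
  have dc: "(c has_real_derivative \<mu> * s \<tau>) (at \<tau>)"
    and ds: "(s has_real_derivative - \<mu> * c \<tau> - ?g \<tau> * s \<tau>) (at \<tau>)"
    and dc': "(c' has_real_derivative \<nu> * s' \<tau>) (at \<tau>)"
    and ds': "(s' has_real_derivative - \<nu> * c' \<tau> - ?g \<tau> * s' \<tau>) (at \<tau>)" if "0 < \<tau>" "\<tau> < pi" for \<tau>
    using 1 2 that by (auto simp: dirac_pair_def)
  define P where "P \<tau> = ?A \<tau> * (c \<tau> * c' \<tau> + s \<tau> * s' \<tau>)" for \<tau>
  define Q where "Q \<tau> = ?A \<tau> * (c \<tau> * s' \<tau> - s \<tau> * c' \<tau>)" for \<tau>
  define R where "R \<tau> = ?A \<tau> * (c \<tau> * c' \<tau> - s \<tau> * s' \<tau>)" for \<tau>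
  define \<delta> where "\<delta> = \<mu> - \<nu>"
  define U where "U \<tau> = ?G \<tau> * (\<delta> * Q \<tau> - t * sin \<tau> * P \<tau>)" for \<tau>
  have dP: "(P has_real_derivative ?g \<tau> * R \<tau> - \<delta> * Q \<tau>) (at \<tau>)" if "0 < \<tau>" "\<tau> < pi" for \<tau>
    using DERIV_mult[OF jacobi_density_has_derivative[OF that, of a b]
       DERIV_add[OF DERIV_mult[OF dc[OF that] dc'[OF that]] DERIV_mult[OF ds[OF that] ds'[OF that]]]]
    unfolding P_def[abs_def] by (rule DERIV_cong) (simp add: R_def Q_def \<delta>_def algebra_simps)
  have dQ: "(Q has_real_derivative \<delta> * P \<tau>) (at \<tau>)" if "0 < \<tau>" "\<tau> < pi" for \<tau>
    using DERIV_mult[OF jacobi_density_has_derivative[OF that, of a b]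
       DERIV_diff[OF DERIV_mult[OF dc[OF that] ds'[OF that]] DERIV_mult[OF ds[OF that] dc'[OF that]]]]
    unfolding Q_def[abs_def] by (rule DERIV_cong) (simp add: P_def \<delta>_def algebra_simps)
  have dG: "(?G has_real_derivative - t * sin \<tau> * ?G \<tau>) (at \<tau>)" for \<tau>
    unfolding heat_mult_def[abs_def] by (auto intro!: derivative_eq_intros)
  have "((\<lambda>\<tau>. \<delta>\<^sup>2 * (?G \<tau> * P \<tau>) + ?G \<tau> * ((t\<^sup>2 * (sin \<tau>)\<^sup>2 - t * cos \<tau>) * P \<tau>
               - t * (a * (1 + cos \<tau>) - b * (1 - cos \<tau>)) * R \<tau>)) has_integral U pi - U 0) {0..pi}"
  proof (rule fundamental_theorem_of_calculus_interior)
    show "continuous_on {0..pi} U"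
      unfolding U_def[abs_def] Q_def P_def by (intro continuous_intros cont ab)
    fix \<tau> assume "\<tau> \<in> {0<..<pi}"
    then have t: "0 < \<tau>" "\<tau> < pi" by auto
    have "(U has_real_derivative (- t * sin \<tau> * ?G \<tau>) * (\<delta> * Q \<tau> - t * sin \<tau> * P \<tau>)
       + (\<delta> * (\<delta> * P \<tau>) - (t * cos \<tau> * P \<tau> + (?g \<tau> * R \<tau> - \<delta> * Q \<tau>) * (t * sin \<tau>))) * ?G \<tau>) (at \<tau>)"
      unfolding U_def[abs_def]
      by (intro DERIV_mult dG DERIV_diff DERIV_cmult dQ[OF t] dP[OF t] DERIV_sin)
    moreover have "(- t * sin \<tau> * ?G \<tau>) * (\<delta> * Q \<tau> - t * sin \<tau> * P \<tau>)
       + (\<delta> * (\<delta> * P \<tau>) - (t * cos \<tau> * P \<tau> + (?g \<tau> * R \<tau> - \<delta> * Q \<tau>) * (t * sin \<tau>))) * ?G \<tau>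
      = \<delta>\<^sup>2 * (?G \<tau> * P \<tau>) + ?G \<tau> * ((t\<^sup>2 * (sin \<tau>)\<^sup>2 - t * cos \<tau>) * P \<tau> - t * (sin \<tau> * ?g \<tau>) * R \<tau>)"
      by (simp add: power2_eq_square algebra_simps)
    ultimately show "(U has_vector_derivative \<delta>\<^sup>2 * (?G \<tau> * P \<tau>) + ?G \<tau> * ((t\<^sup>2 * (sin \<tau>)\<^sup>2 - t * cos \<tau>) * P \<tau>
               - t * (a * (1 + cos \<tau>) - b * (1 - cos \<tau>)) * R \<tau>)) (at \<tau>)"
      unfolding sin_times_jacobi_drift[OF t] has_real_derivative_iff_has_vector_derivative by simp
  qed simp
  moreover have "U pi - U 0 = 0" by (simp add: U_def Q_def z)
  ultimately show ?thesis by (simp add: P_def R_def \<delta>_def pair_density_def[abs_def])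
qed

section \<open>Lorentzian majorants of the heat multiplier\<close>

text \<open>A Lorentzian majorant has an elementary primitive, unlike a Gaussian one; the arctangent
  is bounded, which leaves the order 1 / sqrt t.\<close>

lemma lorentz_integral:
  assumes "t > 0"
  shows "((\<lambda>\<tau>. inverse (1 + t * \<tau>\<^sup>2 / pi\<^sup>2)) has_integral pi / sqrt t * arctan (sqrt t)) {0..pi}"
proof -
  have "((\<lambda>\<tau>. inverse (1 + t * \<tau>\<^sup>2 / pi\<^sup>2)) has_integral
      pi / sqrt t * arctan (sqrt t * pi / pi) - pi / sqrt t * arctan (sqrt t * 0 / pi)) {0..pi}"
  proof (rule fundamental_theorem_of_calculus)
    fix \<tau> :: real
    have "((\<lambda>\<tau>. pi / sqrt t * arctan (sqrt t * \<tau> / pi)) has_real_derivative inverse (1 + t * \<tau>\<^sup>2 / pi\<^sup>2)) (at \<tau> within {0..pi})"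
    proof (rule DERIV_cong)
      have "((\<lambda>\<tau>. sqrt t * \<tau> / pi) has_real_derivative sqrt t / pi) (at \<tau> within {0..pi})"
        by (auto intro!: derivative_eq_intros)
      then show "((\<lambda>\<tau>. pi / sqrt t * arctan (sqrt t * \<tau> / pi)) has_real_derivative
          pi / sqrt t * (inverse (1 + (sqrt t * \<tau> / pi)\<^sup>2) * (sqrt t / pi))) (at \<tau> within {0..pi})"
        by (intro DERIV_cmult DERIV_chain2[OF DERIV_arctan])
    qed (use assms in \<open>simp add: power_mult_distrib power_divide\<close>)
    then show "((\<lambda>\<tau>. pi / sqrt t * arctan (sqrt t * \<tau> / pi)) has_vector_derivative inverse (1 + t * \<tau>\<^sup>2 / pi\<^sup>2)) (at \<tau> within {0..pi})"
      by (simp add: has_real_derivative_iff_has_vector_derivative)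
  qed simp
  then show ?thesis by simp
qed

text \<open>Combines 1 + y \<le> exp y with the quadratic lower bound for 1 - cos. Only half of the
  exponent is spent, so that the other half can absorb polynomial factors.\<close>

lemma exp_half_le_lorentz:
  assumes "t > 0" "0 \<le> \<tau>" "\<tau> \<le> pi"
  shows "exp (- (1 - cos \<tau>) * t / 2) \<le> inverse (1 + t * \<tau>\<^sup>2 / pi\<^sup>2)"
proof -
  have "t * \<tau>\<^sup>2 / pi\<^sup>2 = t / 2 * (2 * \<tau>\<^sup>2 / pi\<^sup>2)" by simp
  also have "\<dots> \<le> t / 2 * (1 - cos \<tau>)"
    using one_minus_cos_ge[OF assms(2,3)] assms by (intro mult_left_mono) auto
  finally have 1: "1 + t * \<tau>\<^sup>2 / pi\<^sup>2 \<le> exp (t / 2 * (1 - cos \<tau>))"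
    using exp_ge_add_one_self[of "t / 2 * (1 - cos \<tau>)"] by linarith
  have 2: "exp (- (1 - cos \<tau>) * t / 2) = inverse (exp (t / 2 * (1 - cos \<tau>)))"
    unfolding exp_minus[symmetric] by (simp add: field_simps)
  have "0 < 1 + t * \<tau>\<^sup>2 / pi\<^sup>2" using assms by (intro add_pos_nonneg) auto
  from le_imp_inverse_le[OF 1 this] show ?thesis unfolding 2 .
qed

text \<open>The multiplier is \<open>e * e\<close> with \<open>e\<close> the half exponential: one
  factor pays for \<open>x e \<le> 2\<close>, the other supplies the Lorentzian. Since sin^2 \<le> 2
  (1 - cos), this trades one of the two powers of \<open>t\<close>.\<close>

lemma heat_mult_le_lorentz:
  assumes "t > 0" "0 \<le> \<tau>" "\<tau> \<le> pi"
  shows "heat_mult t \<tau> \<le> inverse (1 + t * \<tau>\<^sup>2 / pi\<^sup>2)"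
    and "heat_mult t \<tau> * (t\<^sup>2 * (sin \<tau>)\<^sup>2 + k * t) \<le> (4 + \<bar>k\<bar>) * t * inverse (1 + t * \<tau>\<^sup>2 / pi\<^sup>2)"
proof -
  define x where "x = (1 - cos \<tau>) * t"
  define e where "e = exp (- x / 2)"
  have x0: "x \<ge> 0" using assms by (simp add: x_def)
  have e_eq: "e = exp (- (1 - cos \<tau>) * t / 2)" unfolding e_def x_def by (simp only: mult_minus_left)
  have "e \<le> inverse (1 + t * \<tau>\<^sup>2 / pi\<^sup>2)" unfolding e_eq by (rule exp_half_le_lorentz[OF assms])
  moreover have "0 \<le> e" "e \<le> 1" using x0 by (auto simp: e_def)
  ultimately have e: "e \<le> inverse (1 + t * \<tau>\<^sup>2 / pi\<^sup>2)" "0 \<le> e" "e \<le> 1" by auto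
  have G: "heat_mult t \<tau> = e * e"
    proof -
    have "- (1 - cos \<tau>) * t = - x" unfolding x_def by (rule mult_minus_left)
    also have "- x = - x / 2 + - x / 2" by simp
    finally show ?thesis unfolding heat_mult_def e_def exp_add[symmetric] by (rule arg_cong)
  qed
  have ee: "e * e \<le> e" using e mult_left_mono[of e 1 e] by simp
  then show "heat_mult t \<tau> \<le> inverse (1 + t * \<tau>\<^sup>2 / pi\<^sup>2)" using G e by simp
  have "x / 2 * e \<le> 1"
  proof -
    have "x / 2 \<le> exp (x / 2)" using exp_ge_add_one_self[of "x / 2"] by linarith
    then have "x / 2 * e \<le> exp (x / 2) * e" using e by (intro mult_right_mono)
    then show ?thesis by (simp add: e_def exp_minus)
  qed
  then have xe: "x * (e * e) \<le> 2 * e" using mult_right_mono[of "x / 2 * e" 1 e] e by (simp add: mult_ac)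
  have s2: "(sin \<tau>)\<^sup>2 \<le> 2 * (1 - cos \<tau>)"
  proof -
    have "(sin \<tau>)\<^sup>2 = (1 - cos \<tau>) * (1 + cos \<tau>)"
      using sin_squared_eq[of \<tau>] by (simp add: power2_eq_square algebra_simps)
    also have "\<dots> \<le> (1 - cos \<tau>) * 2" by (intro mult_left_mono) auto
    finally show ?thesis by simp
  qed
  have "heat_mult t \<tau> * (t\<^sup>2 * (sin \<tau>)\<^sup>2 + k * t) \<le> e * e * (t\<^sup>2 * (2 * (1 - cos \<tau>)) + \<bar>k\<bar> * t)"
    unfolding G using assms s2 by (intro mult_left_mono add_mono mult_right_mono) auto
  also have "\<dots> = 2 * t * (x * (e * e)) + \<bar>k\<bar> * t * (e * e)"
    by (simp add: x_def power2_eq_square algebra_simps)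
  also have "\<dots> \<le> 2 * t * (2 * e) + \<bar>k\<bar> * t * e"
    using assms by (intro add_mono mult_left_mono xe ee) auto
  also have "\<dots> = (4 + \<bar>k\<bar>) * t * e" by (simp add: algebra_simps)
  also have "\<dots> \<le> (4 + \<bar>k\<bar>) * t * inverse (1 + t * \<tau>\<^sup>2 / pi\<^sup>2)"
    using assms e by (intro mult_left_mono) auto
  finally show "heat_mult t \<tau> * (t\<^sup>2 * (sin \<tau>)\<^sup>2 + k * t) \<le> (4 + \<bar>k\<bar>) * t * inverse (1 + t * \<tau>\<^sup>2 / pi\<^sup>2)" .
qed

lemma heat_mult_le_1: "t > 0 \<Longrightarrow> heat_mult t \<tau> \<le> 1"
  by (simp add: heat_mult_def mult_nonpos_nonneg)

text \<open>Cauchy-Schwarz in the form of Lagrange's identity, the discarded term being the square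
  of \<open>c s' - s c'\<close>.\<close>

lemma pair_density_bound:
  assumes "dirac_energy a b c s \<tau> \<le> B\<^sup>2" "dirac_energy a b c' s' \<tau> \<le> B'\<^sup>2" "B \<ge> 0" "B' \<ge> 0"
  shows "\<bar>pair_density a b c s c' s' \<tau>\<bar> \<le> B * B'"
proof -
  let ?A = "jacobi_density a b \<tau>"
  have "(c \<tau> * c' \<tau> + s \<tau> * s' \<tau>)\<^sup>2 \<le> ((c \<tau>)\<^sup>2 + (s \<tau>)\<^sup>2) * ((c' \<tau>)\<^sup>2 + (s' \<tau>)\<^sup>2)"
    using zero_le_power2[of "c \<tau> * s' \<tau> - s \<tau> * c' \<tau>"] by (simp add: power2_eq_square algebra_simps)
  then have "(pair_density a b c s c' s' \<tau>)\<^sup>2 \<le> ?A\<^sup>2 * (((c \<tau>)\<^sup>2 + (s \<tau>)\<^sup>2) * ((c' \<tau>)\<^sup>2 + (s' \<tau>)\<^sup>2))"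
    unfolding pair_density_def power_mult_distrib by (intro mult_left_mono) auto
  also have "\<dots> = dirac_energy a b c s \<tau> * dirac_energy a b c' s' \<tau>"
    by (simp add: dirac_energy_def power2_eq_square)
  also have "\<dots> \<le> B\<^sup>2 * B'\<^sup>2" using assms by (intro mult_mono) auto
  finally have "(pair_density a b c s c' s' \<tau>)\<^sup>2 \<le> (B * B')\<^sup>2" by (simp add: power_mult_distrib)
  then show ?thesis using assms by (simp add: abs_le_square_iff[symmetric])
qed

text \<open>The bounds serve small times, large times and large spectral gaps. The constants are pi
  < 4, pi * pi/2 < 5, and 5 * (5 + 2 (a + b)); in the third, \<open>t\<close> times the order 1 /
  sqrt t of the Lorentzian integral leaves sqrt t.\<close>

lemma pair_heat_bounds:
  assumes ab: "a \<ge> 0" "b \<ge> 0" and 1: "dirac_pair a b \<mu> c s" and 2: "dirac_pair a b \<nu> c' s'" and t: "t > 0"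
    and B: "B \<ge> 0" "B' \<ge> 0"
    and F: "\<And>\<tau>. 0 < \<tau> \<Longrightarrow> \<tau> < pi \<Longrightarrow> dirac_energy a b c s \<tau> \<le> B\<^sup>2"
    and F': "\<And>\<tau>. 0 < \<tau> \<Longrightarrow> \<tau> < pi \<Longrightarrow> dirac_energy a b c' s' \<tau> \<le> B'\<^sup>2"
  defines "I \<equiv> integral {0..pi} (\<lambda>\<tau>. heat_mult t \<tau> * pair_density a b c s c' s' \<tau>)"
  shows "\<bar>I\<bar> \<le> 4 * (B * B')" and "sqrt t * \<bar>I\<bar> \<le> 5 * (B * B')"
    and "(\<mu> - \<nu>)\<^sup>2 * \<bar>I\<bar> \<le> (25 + 10 * (a + b)) * sqrt t * (B * B')"
proof -
  let ?A = "jacobi_density a b" and ?G = "heat_mult t" and ?P = "pair_density a b c s c' s'"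
    and ?R = "pair_density a b c s c' (\<lambda>\<tau>. - s' \<tau>)" and ?l = "\<lambda>\<tau>. inverse (1 + t * \<tau>\<^sup>2 / pi\<^sup>2)"
  have cont: "continuous_on {0..pi} c" "continuous_on {0..pi} s" "continuous_on {0..pi} c'" "continuous_on {0..pi} s'"
    using 1 2 by (auto simp: dirac_pair_def)
  have contP: "continuous_on {0..pi} ?P" "continuous_on {0..pi} ?R"
    unfolding pair_density_def[abs_def] by (intro continuous_intros cont ab)+
  \<comment> \<open>The energy bounds are assumed on the open interval; continuity carries them to
    its closure.\<close>
  have Fc: "dirac_energy a b c s \<tau> \<le> B\<^sup>2" "dirac_energy a b c' s' \<tau> \<le> B'\<^sup>2" if "0 \<le> \<tau>" "\<tau> \<le> pi" for \<tau>
  proof -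
    have le: "h \<tau> \<le> K" if "continuous_on {0..pi} h" "\<And>x. 0 < x \<Longrightarrow> x < pi \<Longrightarrow> h x \<le> K" "0 \<le> \<tau>" "\<tau> \<le> pi"
      for h :: "real \<Rightarrow> real" and K \<tau>
      using continuous_le_on_closure[of "{0<..<pi}" h \<tau> K] that by simp
    have "continuous_on {0..pi} (dirac_energy a b c s)" "continuous_on {0..pi} (dirac_energy a b c' s')"
      unfolding dirac_energy_def[abs_def] by (intro continuous_intros cont ab)+
    then show "dirac_energy a b c s \<tau> \<le> B\<^sup>2" "dirac_energy a b c' s' \<tau> \<le> B'\<^sup>2"
      using that F F' by (auto intro: le)
  qed
  have P: "\<bar>?P \<tau>\<bar> \<le> B * B'" and R: "\<bar>?R \<tau>\<bar> \<le> B * B'" if "0 \<le> \<tau>" "\<tau> \<le> pi" for \<tau>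
    using Fc[OF that] B by (auto intro!: pair_density_bound simp: dirac_energy_def)
  have int_l: "(\<lambda>\<tau>. K * ?l \<tau>) integrable_on {0..pi}" "integral {0..pi} (\<lambda>\<tau>. K * ?l \<tau>) = K * (pi / sqrt t * arctan (sqrt t))" for K
    using has_integral_mult_right[OF lorentz_integral[OF t], of K]
    by (auto simp: has_integral_iff)
  have lor: "sqrt t * (pi / sqrt t * arctan (sqrt t)) \<le> 5"
  proof -
    have "sqrt t * (pi / sqrt t * arctan (sqrt t)) = pi * arctan (sqrt t)" using t by simp
    also have "\<dots> \<le> 3.15 * (3.15 / 2)"
      using arctan_ubound[of "sqrt t"] t pi_approx by (intro mult_mono) auto
    finally show ?thesis by simp
  qed
  have intGP: "(\<lambda>\<tau>. ?G \<tau> * ?P \<tau>) integrable_on {0..pi}"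
    by (intro integrable_continuous_real continuous_intros contP)
  have BB: "B * B' \<ge> 0" using B by simp
  have "norm I \<le> integral {0..pi} (\<lambda>\<tau>. B * B')"
    unfolding I_def
  proof (rule integral_norm_bound_integral[OF intGP])
    fix \<tau> assume "\<tau> \<in> {0..pi}"
    then have "\<bar>?P \<tau>\<bar> \<le> B * B'" "?G \<tau> \<le> 1" using P heat_mult_le_1[OF t] by auto
    then show "norm (?G \<tau> * ?P \<tau>) \<le> B * B'"
      using mult_mono[of "?G \<tau>" 1 "\<bar>?P \<tau>\<bar>" "B * B'"] by (simp add: abs_mult)
  qed (rule integrable_const_ivl)
  also have "\<dots> = pi * (B * B')" by simp
  also have "\<dots> \<le> 4 * (B * B')" using BB pi_less_4 by (intro mult_right_mono) auto
  finally show "\<bar>I\<bar> \<le> 4 * (B * B')" by simp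
  have "norm I \<le> integral {0..pi} (\<lambda>\<tau>. B * B' * ?l \<tau>)"
    unfolding I_def
  proof (rule integral_norm_bound_integral[OF intGP])
    fix \<tau> assume "\<tau> \<in> {0..pi}"
    then have "\<bar>?P \<tau>\<bar> \<le> B * B'" "?G \<tau> \<le> ?l \<tau>" using P heat_mult_le_lorentz(1)[OF t] by auto
    then show "norm (?G \<tau> * ?P \<tau>) \<le> B * B' * ?l \<tau>"
      using mult_mono[of "?G \<tau>" "?l \<tau>" "\<bar>?P \<tau>\<bar>" "B * B'"] t by (simp add: abs_mult mult.commute)
  qed (rule int_l)
  then have "sqrt t * \<bar>I\<bar> \<le> sqrt t * (B * B' * (pi / sqrt t * arctan (sqrt t)))"
    unfolding int_l(2) using t by (intro mult_left_mono) auto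
  also have "\<dots> = (B * B') * (sqrt t * (pi / sqrt t * arctan (sqrt t)))" by (simp only: mult_ac)
  also have "\<dots> \<le> (B * B') * 5" by (intro mult_left_mono lor BB)
  finally show "sqrt t * \<bar>I\<bar> \<le> 5 * (B * B')" by (simp add: mult.commute)
  define W where "W \<tau> = (t\<^sup>2 * (sin \<tau>)\<^sup>2 - t * cos \<tau>) * ?P \<tau> - t * (a * (1 + cos \<tau>) - b * (1 - cos \<tau>)) * ?R \<tau>" for \<tau>
  have intW: "(\<lambda>\<tau>. ?G \<tau> * W \<tau>) integrable_on {0..pi}"
    unfolding W_def by (intro integrable_continuous_real continuous_intros contP)
  have "integral {0..pi} (\<lambda>\<tau>. (\<mu> - \<nu>)\<^sup>2 * (?G \<tau> * ?P \<tau>) + ?G \<tau> * W \<tau>) = 0"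
    using pair_heat_identity[OF ab 1 2, of t] unfolding W_def by (rule integral_unique)
  then have "(\<mu> - \<nu>)\<^sup>2 * I = - integral {0..pi} (\<lambda>\<tau>. ?G \<tau> * W \<tau>)"
    using integral_add[OF integrable_on_mult_right[OF intGP] intW, of "(\<mu> - \<nu>)\<^sup>2"] by (simp add: I_def)
  then have "(\<mu> - \<nu>)\<^sup>2 * \<bar>I\<bar> = norm (integral {0..pi} (\<lambda>\<tau>. ?G \<tau> * W \<tau>))"
    by (metis abs_minus_cancel abs_mult abs_power2 real_norm_def)
  also have "\<dots> \<le> integral {0..pi} (\<lambda>\<tau>. ((5 + 2 * (a + b)) * t * (B * B')) * ?l \<tau>)"
  proof (rule integral_norm_bound_integral[OF intW])
    fix \<tau> assume "\<tau> \<in> {0..pi}"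
    then have \<tau>: "0 \<le> \<tau>" "\<tau> \<le> pi" by auto
    have "\<bar>W \<tau>\<bar> \<le> \<bar>t\<^sup>2 * (sin \<tau>)\<^sup>2 - t * cos \<tau>\<bar> * \<bar>?P \<tau>\<bar> + \<bar>t * (a * (1 + cos \<tau>) - b * (1 - cos \<tau>))\<bar> * \<bar>?R \<tau>\<bar>"
      unfolding W_def abs_mult[symmetric] by (rule abs_triangle_ineq4)
    also have "\<dots> \<le> (t\<^sup>2 * (sin \<tau>)\<^sup>2 + t) * (B * B') + (t * (2 * (a + b))) * (B * B')"
    proof (intro add_mono mult_mono P R \<tau>)
      have "\<bar>t\<^sup>2 * (sin \<tau>)\<^sup>2 - t * cos \<tau>\<bar> \<le> \<bar>t\<^sup>2 * (sin \<tau>)\<^sup>2\<bar> + \<bar>t * cos \<tau>\<bar>" by (rule abs_triangle_ineq4)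
      also have "\<dots> \<le> t\<^sup>2 * (sin \<tau>)\<^sup>2 + t * 1"
        using t by (intro add_mono) (auto simp: abs_mult)
      finally show "\<bar>t\<^sup>2 * (sin \<tau>)\<^sup>2 - t * cos \<tau>\<bar> \<le> t\<^sup>2 * (sin \<tau>)\<^sup>2 + t" by simp
      have "\<bar>a * (1 + cos \<tau>) - b * (1 - cos \<tau>)\<bar> \<le> \<bar>a * (1 + cos \<tau>)\<bar> + \<bar>b * (1 - cos \<tau>)\<bar>" by (rule abs_triangle_ineq4)
      also have "\<dots> = a * (1 + cos \<tau>) + b * (1 - cos \<tau>)" using ab minus_1_le_cos[of \<tau>] by (simp add: abs_mult)
      also have "\<dots> \<le> a * 2 + b * 2"
        using cos_ge_minus_one[of \<tau>] by (intro add_mono mult_left_mono ab) auto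
      finally show "\<bar>t * (a * (1 + cos \<tau>) - b * (1 - cos \<tau>))\<bar> \<le> t * (2 * (a + b))"
        using t by (simp add: abs_mult)
    qed (use t ab in auto)
    also have "\<dots> = (t\<^sup>2 * (sin \<tau>)\<^sup>2 + (1 + 2 * (a + b)) * t) * (B * B')" by (simp add: algebra_simps)
    finally have "?G \<tau> * \<bar>W \<tau>\<bar> \<le> ?G \<tau> * ((t\<^sup>2 * (sin \<tau>)\<^sup>2 + (1 + 2 * (a + b)) * t) * (B * B'))"
      by (intro mult_left_mono) auto
    also have "\<dots> = (?G \<tau> * (t\<^sup>2 * (sin \<tau>)\<^sup>2 + (1 + 2 * (a + b)) * t)) * (B * B')" by simp
    also have "\<dots> \<le> ((4 + \<bar>1 + 2 * (a + b)\<bar>) * t * ?l \<tau>) * (B * B')"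
      by (intro mult_right_mono heat_mult_le_lorentz t \<tau> BB)
    also have "\<dots> = ((5 + 2 * (a + b)) * t * (B * B')) * ?l \<tau>" using ab by simp
    finally show "norm (?G \<tau> * W \<tau>) \<le> ((5 + 2 * (a + b)) * t * (B * B')) * ?l \<tau>" by (simp add: abs_mult)
  qed (rule int_l)
  also have "\<dots> = (5 + 2 * (a + b)) * (B * B') * sqrt t * (sqrt t * (pi / sqrt t * arctan (sqrt t)))"
  proof -
    have alg: "k * t * c * X = k * c * r * (r * X)" if "t = r * r" for k c r X :: real
      unfolding that by (simp only: mult_ac)
    show ?thesis unfolding int_l(2) by (rule alg) (use t in simp)
  qed
  also have "\<dots> \<le> (5 + 2 * (a + b)) * (B * B') * sqrt t * 5"
    using ab BB B t by (intro mult_left_mono lor mult_nonneg_nonneg) auto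
  finally show "(\<mu> - \<nu>)\<^sup>2 * \<bar>I\<bar> \<le> (25 + 10 * (a + b)) * sqrt t * (B * B')"
    by (simp add: algebra_simps)
qed

section \<open>The heat kernel\<close>

definition jacobi_dphi :: "real \<Rightarrow> real \<Rightarrow> nat \<Rightarrow> real \<Rightarrow> real" where
  "jacobi_dphi \<alpha> \<beta> k \<tau> = - sin \<tau> * jacobi_P' \<alpha> \<beta> k (cos \<tau>) / jacobi_P \<alpha> \<beta> k 1"

definition dunkl_mu :: "real \<Rightarrow> real \<Rightarrow> int \<Rightarrow> real" where
  "dunkl_mu \<alpha> \<beta> n = real_of_int (sgn n) * jacobi_lambda \<alpha> \<beta> (nat \<bar>n\<bar>)"

definition dunkl_c :: "real \<Rightarrow> real \<Rightarrow> int \<Rightarrow> real \<Rightarrow> real" where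
  "dunkl_c \<alpha> \<beta> n \<tau> = jacobi_phi \<alpha> \<beta> (nat \<bar>n\<bar>) \<tau>"

text \<open>\<open>dunkl_mu\<close> is odd in \<open>n\<close>, so the quotient changes sign with
  \<open>n\<close> and the single formula c - i s covers a function and its conjugate. At
  \<open>n = 0\<close> division by zero gives 0, in agreement with e_0 = 1.\<close>

definition dunkl_s :: "real \<Rightarrow> real \<Rightarrow> int \<Rightarrow> real \<Rightarrow> real" where
  "dunkl_s \<alpha> \<beta> n \<tau> = jacobi_dphi \<alpha> \<beta> (nat \<bar>n\<bar>) \<tau> / dunkl_mu \<alpha> \<beta> n"

definition dunkl_norm :: "real \<Rightarrow> real \<Rightarrow> int \<Rightarrow> real" where
  "dunkl_norm \<alpha> \<beta> n = sqrt (LINT \<theta>:{-pi..pi}|lborel. (cmod (dunkl_e \<alpha> \<beta> n \<theta>))\<^sup>2 * jacobi_weight \<alpha> \<beta> \<theta>)"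

lemma jacobi_phi_has_derivative: "(jacobi_phi \<alpha> \<beta> k has_real_derivative jacobi_dphi \<alpha> \<beta> k \<tau>) (at \<tau>)"
  unfolding jacobi_phi_def[abs_def] jacobi_dphi_def
  by (rule DERIV_cong[OF DERIV_cdivide[OF DERIV_chain2[OF jacobi_P_has_derivative DERIV_cos]]]) simp

lemma jacobi_dphi_has_derivative:
  "(jacobi_dphi \<alpha> \<beta> k has_real_derivative
     ((sin \<tau>)\<^sup>2 * jacobi_P'' \<alpha> \<beta> k (cos \<tau>) - cos \<tau> * jacobi_P' \<alpha> \<beta> k (cos \<tau>)) / jacobi_P \<alpha> \<beta> k 1) (at \<tau>)"
  unfolding jacobi_dphi_def[abs_def]
  by (rule DERIV_cong[OF DERIV_cdivide[OF DERIV_mult[OF DERIV_minus[OF DERIV_sin]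
        DERIV_chain2[OF jacobi_P'_has_derivative DERIV_cos]]]]) (simp add: power2_eq_square algebra_simps)

text \<open>The substitution x = cos \<tau> contributes the extra term
  \<open>- cos \<tau> * P'\<close>, which is what shifts both parameters of the drift by
  1/2.\<close>

lemma jacobi_phi_ode:
  assumes "0 < \<tau>" "\<tau> < pi"
  shows "((sin \<tau>)\<^sup>2 * jacobi_P'' \<alpha> \<beta> k (cos \<tau>) - cos \<tau> * jacobi_P' \<alpha> \<beta> k (cos \<tau>)) / jacobi_P \<alpha> \<beta> k 1
    = - (real k * (real k + \<alpha> + \<beta> + 1)) * jacobi_phi \<alpha> \<beta> k \<tau>
      - jacobi_drift (\<alpha> + 1/2) (\<beta> + 1/2) \<tau> * jacobi_dphi \<alpha> \<beta> k \<tau>"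
proof -
  let ?x = "cos \<tau>" and ?y = "jacobi_P \<alpha> \<beta> k (cos \<tau>)" and ?y1 = "jacobi_P' \<alpha> \<beta> k (cos \<tau>)"
    and ?y2 = "jacobi_P'' \<alpha> \<beta> k (cos \<tau>)"
  have s2: "(sin \<tau>)\<^sup>2 = 1 - ?x\<^sup>2" by (simp add: sin_squared_eq)
  have "(sin \<tau>)\<^sup>2 * ?y2 - ?x * ?y1
     = - (real k * (real k + \<alpha> + \<beta> + 1)) * ?y + ((\<alpha> + 1/2) * (1 + ?x) - (\<beta> + 1/2) * (1 - ?x)) * ?y1"
  proof -
    have "(\<alpha> + 1/2) * (1 + ?x) - (\<beta> + 1/2) * (1 - ?x) = - (\<beta> - \<alpha> - (\<alpha> + \<beta> + 2) * ?x) - ?x"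
      by (simp add: field_simps)
    moreover have "u - x * v = - w * y + (- c - x) * v" if "u + c * v + w * y = 0" for u v w x y c :: real
      using that by (simp add: algebra_simps)
    ultimately show ?thesis
      using jacobi_ode[where x = ?x and \<alpha> = \<alpha> and \<beta> = \<beta> and k = k] unfolding s2 by simp
  qed
  also have "\<dots> = - (real k * (real k + \<alpha> + \<beta> + 1)) * ?y
      - jacobi_drift (\<alpha> + 1/2) (\<beta> + 1/2) \<tau> * (- sin \<tau> * ?y1)"
    unfolding sin_times_jacobi_drift[OF assms, symmetric] by simp
  finally show ?thesis
    by (simp add: jacobi_phi_def jacobi_dphi_def diff_divide_distrib add_divide_distrib)
qed

text \<open>\<open>c\<close> is even and \<open>s\<close> is odd: adding the values at \<tau> and -
  \<tau> cancels the imaginary cross terms, so that the heat kernel is real.\<close>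

lemma dirac_product_even_part:
  fixes g x y c s c' s' :: real
  shows "complex_of_real g * ((of_real c - \<i> * of_real s) * of_real x) * cnj ((of_real c' - \<i> * of_real s') * of_real y)
     + complex_of_real g * ((of_real c - \<i> * of_real (- s)) * of_real x) * cnj ((of_real c' - \<i> * of_real (- s')) * of_real y)
     = of_real (g * (x * y) * (2 * (c * c' + s * s')))"
proof -
  have "G * ((u - j * v) * X) * ((u' + j * v') * Y) + G * ((u + j * v) * X) * ((u' - j * v') * Y)
      = G * (X * Y) * (2 * (u * u' + v * v'))" if "j * j = -1" for G X Y u v u' v' j :: complex
    using that by algebra
  from this[of \<i> "of_real g" "of_real c" "of_real s" "of_real x" "of_real c'" "of_real s'" "of_real y"]
  show ?thesis by simp
qed

lemma dunkl_mu_0 [simp]: "dunkl_mu \<alpha> \<beta> 0 = 0"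
  by (simp add: dunkl_mu_def)

lemma dunkl_s_0 [simp]: "dunkl_s \<alpha> \<beta> 0 \<tau> = 0"
  by (simp add: dunkl_s_def)

lemma dunkl_c_0 [simp]: "dunkl_c \<alpha> \<beta> 0 \<tau> = 1"
  by (simp add: dunkl_c_def jacobi_phi_def jacobi_P_def)

context
  fixes \<alpha> \<beta> :: real
  assumes ab: "\<alpha> \<ge> - 1/2" "\<beta> \<ge> - 1/2"
begin

lemma shift_nonneg: "\<alpha> + 1/2 \<ge> 0" "\<beta> + 1/2 \<ge> 0"
  using ab by auto

section \<open>Growth and separation of the eigenvalues\<close>

lemma jacobi_lambda_square: "(jacobi_lambda \<alpha> \<beta> k)\<^sup>2 = real k * (real k + \<alpha> + \<beta> + 1)"
  using ab by (simp add: jacobi_lambda_def)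

lemma jacobi_lambda_ge: "jacobi_lambda \<alpha> \<beta> k \<ge> real k"
  unfolding jacobi_lambda_def using ab
  by (intro real_le_rsqrt) (auto simp: power2_eq_square intro!: mult_left_mono)

text \<open>With \<open>r = (\<alpha> + \<beta> + 1) / 2 \<ge> 0\<close> the square of \<lambda>_k
  is (k + r)^2 - r^2, so \<lambda>_k lies below k + r and has slope at least 1 in k. Squaring
  reduces the claim to \<lambda>_m \<le> m + r.\<close>

lemma jacobi_lambda_diff:
  assumes "m \<le> n"
  shows "real n - real m \<le> jacobi_lambda \<alpha> \<beta> n - jacobi_lambda \<alpha> \<beta> m"
proof -
  define r where "r = (\<alpha> + \<beta> + 1) / 2"
  have r: "r \<ge> 0" using ab by (simp add: r_def)
  define d where "d = real n - real m"
  have d: "d \<ge> 0" "real n = real m + d" using assms by (auto simp: d_def)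
  have sq: "(jacobi_lambda \<alpha> \<beta> k)\<^sup>2 = real k * (real k + 2 * r)" for k
    unfolding jacobi_lambda_square by (simp add: r_def)
  have nn: "jacobi_lambda \<alpha> \<beta> k \<ge> 0" for k using jacobi_lambda_ge[of k] by linarith
  have "jacobi_lambda \<alpha> \<beta> m \<le> real m + r"
  proof (rule power2_le_imp_le)
    show "(jacobi_lambda \<alpha> \<beta> m)\<^sup>2 \<le> (real m + r)\<^sup>2"
      unfolding sq by (simp add: power2_eq_square algebra_simps)
  qed (use r in auto)
  then have "d * jacobi_lambda \<alpha> \<beta> m \<le> d * (real m + r)" using d by (intro mult_left_mono)
  then have "(d + jacobi_lambda \<alpha> \<beta> m)\<^sup>2 \<le> (jacobi_lambda \<alpha> \<beta> n)\<^sup>2"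
    unfolding power2_sum sq d(2) by (simp add: power2_eq_square algebra_simps)
  then have "d + jacobi_lambda \<alpha> \<beta> m \<le> jacobi_lambda \<alpha> \<beta> n" using nn by (rule power2_le_imp_le)
  then show ?thesis by (simp add: d_def)
qed

text \<open>For indices of equal sign this is the separation of the \<lambda>; for opposite signs
  the two \<lambda> add up, and each is at least its index.\<close>

lemma dunkl_mu_diff_ge:
  assumes "m \<le> n"
  shows "real_of_int (n - m) \<le> dunkl_mu \<alpha> \<beta> n - dunkl_mu \<alpha> \<beta> m"
proof -
  consider "m \<ge> 0" | "n \<le> 0" | "m < 0" "n > 0" by linarith
  then show ?thesis
  proof cases
    case 1
    have pos: "dunkl_mu \<alpha> \<beta> k = jacobi_lambda \<alpha> \<beta> (nat k)" if "k \<ge> 0" for k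
      using that by (cases "k = 0") (auto simp: dunkl_mu_def jacobi_lambda_def)
    show ?thesis using 1 assms jacobi_lambda_diff[of "nat m" "nat n"] by (simp add: pos)
  next
    case 2
    have neg: "dunkl_mu \<alpha> \<beta> k = - jacobi_lambda \<alpha> \<beta> (nat (- k))" if "k \<le> 0" for k
      using that by (cases "k = 0") (auto simp: dunkl_mu_def jacobi_lambda_def)
    show ?thesis using 2 assms jacobi_lambda_diff[of "nat (- n)" "nat (- m)"] by (simp add: neg)
  next
    case 3
    then show ?thesis using jacobi_lambda_ge[of "nat n"] jacobi_lambda_ge[of "nat (- m)"]
      by (simp add: dunkl_mu_def)
  qed
qed

lemma dunkl_mu_diff_square: "(real_of_int (n - m))\<^sup>2 \<le> (dunkl_mu \<alpha> \<beta> n - dunkl_mu \<alpha> \<beta> m)\<^sup>2"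
  using dunkl_mu_diff_ge[of m n] dunkl_mu_diff_ge[of n m]
  by (cases "m \<le> n") (auto simp flip: abs_le_square_iff)

lemma dunkl_mu_nonzero: "n \<noteq> 0 \<Longrightarrow> dunkl_mu \<alpha> \<beta> n \<noteq> 0"
  using dunkl_mu_diff_square[of n 0] by auto

lemma dunkl_mu_square: "(dunkl_mu \<alpha> \<beta> n)\<^sup>2 = real (nat \<bar>n\<bar>) * (real (nat \<bar>n\<bar>) + \<alpha> + \<beta> + 1)"
  by (cases "n = 0") (auto simp: dunkl_mu_def power_mult_distrib jacobi_lambda_square sgn_if)

lemma dunkl_c_has_derivative: "(dunkl_c \<alpha> \<beta> n has_real_derivative dunkl_mu \<alpha> \<beta> n * dunkl_s \<alpha> \<beta> n \<tau>) (at \<tau>)"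
proof (cases "n = 0")
  case True
  then show ?thesis by (simp add: dunkl_c_0[abs_def])
next
  case False
  then show ?thesis using jacobi_phi_has_derivative[of \<alpha> \<beta> "nat \<bar>n\<bar>" \<tau>] dunkl_mu_nonzero[OF False]
    by (simp add: dunkl_s_def dunkl_c_def[abs_def])
qed

lemma dunkl_s_has_derivative:
  assumes "0 < \<tau>" "\<tau> < pi"
  shows "(dunkl_s \<alpha> \<beta> n has_real_derivative - dunkl_mu \<alpha> \<beta> n * dunkl_c \<alpha> \<beta> n \<tau>
     - jacobi_drift (\<alpha> + 1/2) (\<beta> + 1/2) \<tau> * dunkl_s \<alpha> \<beta> n \<tau>) (at \<tau>)"
proof (cases "n = 0")
  case True
  then show ?thesis by (simp add: dunkl_s_0[abs_def])
next
  case False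
  have mu: "dunkl_mu \<alpha> \<beta> n \<noteq> 0" by (rule dunkl_mu_nonzero[OF False])
  have mu2: "real (nat \<bar>n\<bar>) * (real (nat \<bar>n\<bar>) + \<alpha> + \<beta> + 1) = dunkl_mu \<alpha> \<beta> n * dunkl_mu \<alpha> \<beta> n"
    using dunkl_mu_square[of n] by (simp add: power2_eq_square)
  have "(dunkl_s \<alpha> \<beta> n has_real_derivative (- (dunkl_mu \<alpha> \<beta> n * dunkl_mu \<alpha> \<beta> n) * dunkl_c \<alpha> \<beta> n \<tau>
      - jacobi_drift (\<alpha> + 1/2) (\<beta> + 1/2) \<tau> * jacobi_dphi \<alpha> \<beta> (nat \<bar>n\<bar>) \<tau>) / dunkl_mu \<alpha> \<beta> n) (at \<tau>)"
    unfolding dunkl_s_def[abs_def] dunkl_c_def mu2[symmetric] jacobi_phi_ode[OF assms, symmetric]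
    by (rule DERIV_cdivide[OF jacobi_dphi_has_derivative])
  then show ?thesis
    by (rule DERIV_cong) (use mu in \<open>simp add: dunkl_s_def field_simps\<close>)
qed

lemma continuous_dunkl_c: "continuous_on S (dunkl_c \<alpha> \<beta> n)"
  by (intro continuous_at_imp_continuous_on ballI DERIV_isCont[OF dunkl_c_has_derivative])

lemma continuous_dunkl_s: "continuous_on S (dunkl_s \<alpha> \<beta> n)"
proof -
  have "continuous_on S (jacobi_dphi \<alpha> \<beta> k)" for k
    by (intro continuous_at_imp_continuous_on ballI DERIV_isCont[OF jacobi_dphi_has_derivative])
  then show ?thesis unfolding dunkl_s_def[abs_def] divide_inverse by (intro continuous_intros)
qed

lemma dunkl_dirac_pair:
  "dirac_pair (\<alpha> + 1/2) (\<beta> + 1/2) (dunkl_mu \<alpha> \<beta> n) (dunkl_c \<alpha> \<beta> n) (dunkl_s \<alpha> \<beta> n)"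
  unfolding dirac_pair_def
  using continuous_dunkl_c continuous_dunkl_s dunkl_c_has_derivative dunkl_s_has_derivative
  by (auto simp: dunkl_s_def jacobi_dphi_def)

lemma dunkl_c_minus [simp]: "dunkl_c \<alpha> \<beta> n (- \<tau>) = dunkl_c \<alpha> \<beta> n \<tau>"
  by (simp add: dunkl_c_def jacobi_phi_def)

lemma dunkl_s_minus [simp]: "dunkl_s \<alpha> \<beta> n (- \<tau>) = - dunkl_s \<alpha> \<beta> n \<tau>"
  by (simp add: dunkl_s_def jacobi_dphi_def)

lemma dunkl_e_eq: "dunkl_e \<alpha> \<beta> n \<tau> = of_real (dunkl_c \<alpha> \<beta> n \<tau>) - \<i> * of_real (dunkl_s \<alpha> \<beta> n \<tau>)"
proof -
  have deriv: "deriv (jacobi_phi \<alpha> \<beta> k) \<tau> = jacobi_dphi \<alpha> \<beta> k \<tau>" for k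
    by (rule DERIV_imp_deriv[OF jacobi_phi_has_derivative])
  have i: "1 / (\<i> * z) = - \<i> / z" for z :: complex
    by (cases "z = 0") (auto simp: field_simps)
  consider "n = 0" | "n > 0" | "n < 0" by linarith
  then show ?thesis
  proof cases
    case 2
    then show ?thesis by (simp add: dunkl_e_def dunkl_pos_def deriv i dunkl_c_def dunkl_s_def dunkl_mu_def)
  next
    case 3
    then show ?thesis by (simp add: dunkl_e_def dunkl_pos_def deriv i dunkl_c_def dunkl_s_def dunkl_mu_def)
  qed (simp add: dunkl_e_def)
qed

lemma continuous_dunkl_e [continuous_intros]: "continuous_on S (dunkl_e \<alpha> \<beta> n)"
  unfolding dunkl_e_eq[abs_def] by (intro continuous_intros continuous_dunkl_c continuous_dunkl_s)

section \<open>Folding the integrals onto [0, pi]\<close>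

text \<open>|sin| is sqrt (1 - cos) * sqrt (1 + cos), half a power for each factor. The zeros of sin
  are exceptional: the weight vanishes there, while the continuous density need not.\<close>

lemma jacobi_weight_eq:
  "jacobi_weight \<alpha> \<beta> \<tau> = (if sin \<tau> = 0 then 0 else jacobi_density (\<alpha> + 1/2) (\<beta> + 1/2) \<tau>)"
proof (cases "sin \<tau> = 0")
  case True
  then show ?thesis by (simp add: jacobi_weight_def)
next
  case False
  have s2: "(sin \<tau>)\<^sup>2 = (1 - cos \<tau>) * (1 + cos \<tau>)"
    using sin_squared_eq[of \<tau>] by (simp add: power2_eq_square algebra_simps)
  have nz: "1 - cos \<tau> \<noteq> 0" "1 + cos \<tau> \<noteq> 0" using s2 False by auto
  then have pos: "1 - cos \<tau> > 0" "1 + cos \<tau> > 0"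
    using cos_le_one[of \<tau>] minus_1_le_cos[of \<tau>] by linarith+
  have cp: "cont_powr c x = x powr c" if "x > 0" for c x using that by (simp add: cont_powr_def)
  have "\<bar>sin \<tau>\<bar> = sqrt (1 - cos \<tau>) * sqrt (1 + cos \<tau>)"
    using real_sqrt_abs[of "sin \<tau>"] unfolding s2 by (simp add: real_sqrt_mult)
  also have "\<dots> = (1 - cos \<tau>) powr (1/2) * (1 + cos \<tau>) powr (1/2)"
    using pos by (simp add: powr_half_sqrt)
  finally show ?thesis
    using False pos by (simp add: jacobi_weight_def jacobi_density_def cp powr_add)
qed

lemma jacobi_density_minus [simp]: "jacobi_density a b (- \<tau>) = jacobi_density a b \<tau>"
  by (simp add: jacobi_density_def)

text \<open>The density is even, so only the even part of \<open>f\<close> contributes, and the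
  zeros of sin are a null set. This passes from the Lebesgue integrals of the definitions to gauge
  integrals on [0, pi], to which the fundamental theorem of calculus was applied.\<close>

lemma LINT_jacobi_weight:
  fixes f :: "real \<Rightarrow> 'a::{real_normed_algebra_1, euclidean_space}"
  assumes f: "continuous_on UNIV f"
  shows "(LINT \<tau>:{-pi..pi}|lborel. f \<tau> * of_real (jacobi_weight \<alpha> \<beta> \<tau>))
     = integral {0..pi} (\<lambda>\<tau>. (f \<tau> + f (- \<tau>)) * of_real (jacobi_density (\<alpha> + 1/2) (\<beta> + 1/2) \<tau>))"
proof -
  let ?A = "jacobi_density (\<alpha> + 1/2) (\<beta> + 1/2)"
  let ?g = "\<lambda>\<tau>. f \<tau> * of_real (?A \<tau>)"
  have gc: "continuous_on S ?g" for S
    by (intro continuous_intros shift_nonneg continuous_on_subset[OF f]) auto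
  have Am: "?A \<in> borel_measurable borel"
    by (intro borel_measurable_continuous_onI continuous_jacobi_density shift_nonneg)
  have fm: "f \<in> borel_measurable borel" by (intro borel_measurable_continuous_onI f)
  have sub: "{\<tau>. sin \<tau> = 0} \<inter> {-pi..pi} \<subseteq> {-pi, 0, pi}"
  proof
    fix \<tau> assume t: "\<tau> \<in> {\<tau>. sin \<tau> = 0} \<inter> {-pi..pi}"
    show "\<tau> \<in> {-pi, 0, pi}"
    proof (rule ccontr)
      assume n: "\<tau> \<notin> {-pi, 0, pi}"
      then have "(0 < \<tau> \<and> \<tau> < pi) \<or> (0 < - \<tau> \<and> - \<tau> < pi)" using t by auto
      then have "sin \<tau> \<noteq> 0" using sin_gt_zero[of \<tau>] sin_gt_zero[of "- \<tau>"] by auto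
      then show False using t by simp
    qed
  qed
  have "(LINT \<tau>:{-pi..pi}|lborel. f \<tau> * of_real (jacobi_weight \<alpha> \<beta> \<tau>)) = (LINT \<tau>:{-pi..pi}|lborel. ?g \<tau>)"
    unfolding set_lebesgue_integral_def
  proof (rule integral_cong_AE)
    have "AE \<tau> in lborel. \<tau> \<notin> {-pi, 0, pi}"
      by (rule AE_not_in[OF finite_imp_null_set_lborel]) simp
    then show "AE \<tau> in lborel. indicator {-pi..pi} \<tau> *\<^sub>R (f \<tau> * of_real (jacobi_weight \<alpha> \<beta> \<tau>)) = indicator {-pi..pi} \<tau> *\<^sub>R ?g \<tau>"
      by eventually_elim (use sub in \<open>auto simp: jacobi_weight_eq indicator_def\<close>)
  qed (use Am fm in \<open>unfold jacobi_weight_eq, measurable\<close>)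
  also have "\<dots> = integral {-pi..pi} ?g"
    by (intro set_borel_integral_eq_integral borel_integrable_atLeastAtMost' gc)
  also have "\<dots> = integral {-pi..0} ?g + integral {0..pi} ?g"
    by (intro Henstock_Kurzweil_Integration.integral_combine[symmetric] integrable_continuous_real gc) auto
  also have "integral {-pi..0} ?g = integral {0..pi} (\<lambda>\<tau>. ?g (- \<tau>))"
    using Henstock_Kurzweil_Integration.integral_reflect_real[where b = pi and a = 0 and f = "\<lambda>\<tau>. ?g (- \<tau>)"] by simp
  also have "\<dots> + integral {0..pi} ?g = integral {0..pi} (\<lambda>\<tau>. ?g (- \<tau>) + ?g \<tau>)"
    by (intro integral_add[symmetric] integrable_continuous_real)
       (auto intro!: continuous_intros shift_nonneg continuous_on_compose2[OF f] continuous_on_subset[OF f])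
  also have "\<dots> = integral {0..pi} (\<lambda>\<tau>. (f \<tau> + f (- \<tau>)) * of_real (?A \<tau>))"
    by (simp add: algebra_simps)
  finally show ?thesis .
qed

lemma cmod_dunkl_e: "(cmod (dunkl_e \<alpha> \<beta> n \<tau>))\<^sup>2 = (dunkl_c \<alpha> \<beta> n \<tau>)\<^sup>2 + (dunkl_s \<alpha> \<beta> n \<tau>)\<^sup>2"
  by (simp add: dunkl_e_eq cmod_power2)

abbreviation (input) dunkl_energy where
  "dunkl_energy n \<equiv> dirac_energy (\<alpha> + 1/2) (\<beta> + 1/2) (dunkl_c \<alpha> \<beta> n) (dunkl_s \<alpha> \<beta> n)"

lemma continuous_dunkl_energy: "continuous_on S (dunkl_energy n)"
  unfolding dirac_energy_def[abs_def]
  by (intro continuous_intros shift_nonneg continuous_dunkl_c continuous_dunkl_s)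

lemma dunkl_norm_eq: "dunkl_norm \<alpha> \<beta> n = sqrt (2 * integral {0..pi} (dunkl_energy n))"
proof -
  have "continuous_on UNIV (\<lambda>\<theta>. (cmod (dunkl_e \<alpha> \<beta> n \<theta>))\<^sup>2)" by (intro continuous_intros)
  from LINT_jacobi_weight[OF this]
  have "(LINT \<theta>:{-pi..pi}|lborel. (cmod (dunkl_e \<alpha> \<beta> n \<theta>))\<^sup>2 * jacobi_weight \<alpha> \<beta> \<theta>)
     = integral {0..pi} (\<lambda>\<tau>. ((cmod (dunkl_e \<alpha> \<beta> n \<tau>))\<^sup>2 + (cmod (dunkl_e \<alpha> \<beta> n (- \<tau>)))\<^sup>2)
          * jacobi_density (\<alpha> + 1/2) (\<beta> + 1/2) \<tau>)" by simp
  also have "\<dots> = integral {0..pi} (\<lambda>\<tau>. 2 * dunkl_energy n \<tau>)"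
    unfolding cmod_dunkl_e dunkl_c_minus dunkl_s_minus dirac_energy_def
    by (rule arg_cong[of _ _ "integral {0..pi}"]) (auto simp: algebra_simps)
  finally show ?thesis by (simp add: dunkl_norm_def)
qed

lemma dunkl_norm_nonneg: "dunkl_norm \<alpha> \<beta> n \<ge> 0"
  unfolding dunkl_norm_eq by (auto intro!: integral_nonneg integrable_continuous_real continuous_dunkl_energy)

lemma dunkl_heat_kernel_eq:
  "dunkl_heat_kernel \<alpha> \<beta> t n m = of_real (2 / (dunkl_norm \<alpha> \<beta> n * dunkl_norm \<alpha> \<beta> m) *
     integral {0..pi} (\<lambda>\<tau>. heat_mult t \<tau> * pair_density (\<alpha> + 1/2) (\<beta> + 1/2)
        (dunkl_c \<alpha> \<beta> n) (dunkl_s \<alpha> \<beta> n) (dunkl_c \<alpha> \<beta> m) (dunkl_s \<alpha> \<beta> m) \<tau>))"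
proof -
  let ?N = "dunkl_norm \<alpha> \<beta>" and ?A = "jacobi_density (\<alpha> + 1/2) (\<beta> + 1/2)"
  let ?P = "pair_density (\<alpha> + 1/2) (\<beta> + 1/2) (dunkl_c \<alpha> \<beta> n) (dunkl_s \<alpha> \<beta> n) (dunkl_c \<alpha> \<beta> m) (dunkl_s \<alpha> \<beta> m)"
  define f where "f \<tau> = complex_of_real (heat_mult t \<tau>) * dunkl_psi \<alpha> \<beta> n \<tau> * cnj (dunkl_psi \<alpha> \<beta> m \<tau>)" for \<tau>
  have psi: "dunkl_psi \<alpha> \<beta> k \<tau> = dunkl_e \<alpha> \<beta> k \<tau> * of_real (inverse (?N k))" for k \<tau>
    by (simp add: dunkl_psi_def dunkl_norm_def divide_inverse)
  have "continuous_on UNIV f"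
    unfolding f_def psi by (intro continuous_intros)
  from LINT_jacobi_weight[OF this]
  have "dunkl_heat_kernel \<alpha> \<beta> t n m = integral {0..pi} (\<lambda>\<tau>. (f \<tau> + f (- \<tau>)) * of_real (?A \<tau>))"
    by (simp add: dunkl_heat_kernel_def f_def heat_mult_def)
  also have "\<dots> = integral {0..pi} (\<lambda>\<tau>. of_real (2 / (?N n * ?N m) * (heat_mult t \<tau> * ?P \<tau>)))"
  proof (rule Henstock_Kurzweil_Integration.integral_cong)
    fix \<tau>
    have hm: "heat_mult t (- \<tau>) = heat_mult t \<tau>" by (simp add: heat_mult_def)
    have f: "f \<tau> + f (- \<tau>) = of_real (heat_mult t \<tau> * (inverse (?N n) * inverse (?N m)) * (2 *
       (dunkl_c \<alpha> \<beta> n \<tau> * dunkl_c \<alpha> \<beta> m \<tau> + dunkl_s \<alpha> \<beta> n \<tau> * dunkl_s \<alpha> \<beta> m \<tau>)))"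
      unfolding f_def psi dunkl_e_eq dunkl_c_minus dunkl_s_minus hm by (rule dirac_product_even_part)
    have alg: "h * (inverse x * inverse y) * (2 * p) * A = 2 / (x * y) * (h * (A * p))" for h x y p A :: real
      by (simp add: divide_inverse)
    show "(f \<tau> + f (- \<tau>)) * of_real (?A \<tau>) = of_real (2 / (?N n * ?N m) * (heat_mult t \<tau> * ?P \<tau>))"
      unfolding f pair_density_def alg[symmetric] by (rule of_real_mult[symmetric])
  qed
  also have "\<dots> = of_real (integral {0..pi} (\<lambda>\<tau>. 2 / (?N n * ?N m) * (heat_mult t \<tau> * ?P \<tau>)))"
  proof (rule integral_unique[OF has_integral_of_real], rule integrable_integral)
    show "(\<lambda>\<tau>. 2 / (?N n * ?N m) * (heat_mult t \<tau> * ?P \<tau>)) integrable_on {0..pi}"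
      unfolding pair_density_def
      by (intro integrable_continuous_real continuous_intros shift_nonneg continuous_dunkl_c continuous_dunkl_s)
  qed
  finally show ?thesis by simp
qed

section \<open>Uniform bounds for normalized eigenfunctions and the kernel\<close>

lemma dunkl_energy_normalized_bound:
  obtains C where "C > 0"
    "\<And>n. \<exists>B\<ge>0. (\<forall>\<tau>. 0 < \<tau> \<longrightarrow> \<tau> < pi \<longrightarrow> dunkl_energy n \<tau> \<le> B\<^sup>2) \<and> B / dunkl_norm \<alpha> \<beta> n \<le> C"
proof -
  obtain C0 L where C0: "C0 > 0" and L: "L > 0" and
    bd: "\<And>l c s x y. L \<le> l \<Longrightarrow> dirac_pair (\<alpha> + 1/2) (\<beta> + 1/2) l c s \<Longrightarrow> 0 < x \<Longrightarrow> x < pi \<Longrightarrow> 1 \<le> y \<Longrightarrow> y \<le> 2 \<Longrightarrow>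
       dirac_energy (\<alpha> + 1/2) (\<beta> + 1/2) c s x \<le> C0 * dirac_energy (\<alpha> + 1/2) (\<beta> + 1/2) c s y"
    by (rule dirac_energy_bound[OF shift_nonneg]) (rule that)
  have en_int: "dunkl_energy n integrable_on {u..v}" for n u v
    by (intro integrable_continuous_real continuous_dunkl_energy)
  \<comment> \<open>The energy comparison is stated for positive eigenvalues; replacing
    \<open>n\<close> by |n| only changes the sign of \<open>s\<close>.\<close>
  have even_energy: "dunkl_energy n = dunkl_energy \<bar>n\<bar>" for n
    by (rule ext) (auto simp: dirac_energy_def dunkl_c_def dunkl_s_def dunkl_mu_def sgn_if power_divide power_mult_distrib)
  have large: "\<exists>B\<ge>0. (\<forall>\<tau>. 0 < \<tau> \<longrightarrow> \<tau> < pi \<longrightarrow> dunkl_energy n \<tau> \<le> B\<^sup>2) \<and> B / dunkl_norm \<alpha> \<beta> n \<le> sqrt C0"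
    if n: "L \<le> real_of_int \<bar>n\<bar>" for n
  proof (intro exI conjI allI impI)
    let ?B = "sqrt C0 * dunkl_norm \<alpha> \<beta> n"
    show "0 \<le> ?B" using C0 dunkl_norm_nonneg by simp
    \<comment> \<open>If the norm is 0 the quotient is 0 by convention, and the bound
      persists.\<close>
    show "?B / dunkl_norm \<alpha> \<beta> n \<le> sqrt C0" using C0 by (cases "dunkl_norm \<alpha> \<beta> n = 0") auto
    fix \<tau> assume t: "0 < \<tau>" "\<tau> < pi"
    have n0: "n \<noteq> 0" using n L by auto
    have "L \<le> dunkl_mu \<alpha> \<beta> \<bar>n\<bar>"
      using n n0 jacobi_lambda_ge[of "nat \<bar>n\<bar>"] by (simp add: dunkl_mu_def)
    then have "dunkl_energy \<bar>n\<bar> \<tau> \<le> C0 * dunkl_energy \<bar>n\<bar> y" if "1 \<le> y" "y \<le> 2" for y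
      using bd[OF _ dunkl_dirac_pair t that] by simp
    then have *: "dunkl_energy n \<tau> \<le> C0 * dunkl_energy n y" if "1 \<le> y" "y \<le> 2" for y
      using that even_energy[of n] by simp
    \<comment> \<open>[1, 2] has length 1, so integrating over \<open>y\<close> turns the pointwise
      comparison into one with the squared norm, which is twice the energy integral over
      [0, pi].\<close>
    have "dunkl_energy n \<tau> = integral {1..2::real} (\<lambda>y. dunkl_energy n \<tau>)" by simp
    also have "\<dots> \<le> integral {1..2} (\<lambda>y. C0 * dunkl_energy n y)"
      by (intro integral_le integrable_on_mult_right en_int integrable_const_ivl) (use * in auto)
    also have "\<dots> = C0 * integral {1..2} (dunkl_energy n)" by simp
    also have "\<dots> \<le> C0 * integral {0..pi} (dunkl_energy n)"
      using C0 pi_gt3 by (intro mult_left_mono integral_subset_le en_int) auto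
    also have "\<dots> \<le> C0 * (2 * integral {0..pi} (dunkl_energy n))"
      using C0 integral_nonneg[OF en_int, of 0 pi n] by (intro mult_left_mono) auto
    also have "\<dots> = ?B\<^sup>2"
      using C0 integral_nonneg[OF en_int, of 0 pi n] by (simp add: dunkl_norm_eq power_mult_distrib)
    finally show "dunkl_energy n \<tau> \<le> ?B\<^sup>2" .
  qed
  have "\<exists>B\<ge>0. \<forall>\<tau>. 0 < \<tau> \<longrightarrow> \<tau> < pi \<longrightarrow> dunkl_energy n \<tau> \<le> B\<^sup>2" for n
  proof -
    have "bounded (dunkl_energy n ` {0..pi})"
      by (intro compact_imp_bounded compact_continuous_image continuous_dunkl_energy) auto
    then obtain M where "\<forall>x\<in>dunkl_energy n ` {0..pi}. \<bar>x\<bar> \<le> M"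
      unfolding bounded_real by blast
    then have M: "dunkl_energy n \<tau> \<le> M" if "0 \<le> \<tau>" "\<tau> \<le> pi" for \<tau>
      using that by (auto simp: abs_le_iff)
    have M0: "M \<ge> 0" using M[of 0] dirac_energy_nonneg order_trans by (metis order_refl pi_ge_zero)
    show ?thesis
    proof (intro exI[of _ "sqrt M"] conjI allI impI)
      show "dunkl_energy n \<tau> \<le> (sqrt M)\<^sup>2" if "0 < \<tau>" "\<tau> < pi" for \<tau>
        using M[of \<tau>] M0 that by simp
    qed (use M0 in simp)
  qed
  then have "\<forall>n. \<exists>B. B \<ge> 0 \<and> (\<forall>\<tau>. 0 < \<tau> \<longrightarrow> \<tau> < pi \<longrightarrow> dunkl_energy n \<tau> \<le> B\<^sup>2)" by blast
  from choice[OF this] obtain B where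
    B': "\<forall>n. B n \<ge> 0 \<and> (\<forall>\<tau>. 0 < \<tau> \<longrightarrow> \<tau> < pi \<longrightarrow> dunkl_energy n \<tau> \<le> (B n)\<^sup>2)" by (elim exE)
  have B: "\<And>n. B n \<ge> 0" "\<And>n \<tau>. 0 < \<tau> \<Longrightarrow> \<tau> < pi \<Longrightarrow> dunkl_energy n \<tau> \<le> (B n)\<^sup>2"
    using B' by blast+
  define S where "S = {n::int. real_of_int \<bar>n\<bar> < L}"
  have "S \<subseteq> {- \<lceil>L\<rceil>..\<lceil>L\<rceil>}" unfolding S_def by (auto; linarith)
  then have fin: "finite S" by (rule finite_subset) auto
  \<comment> \<open>The sum over the finitely many low frequencies stands in for their
    maximum.\<close>
  define C where "C = sqrt C0 + (\<Sum>n\<in>S. B n / dunkl_norm \<alpha> \<beta> n)"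
  have Bn: "B n / dunkl_norm \<alpha> \<beta> n \<ge> 0" for n using B(1) dunkl_norm_nonneg by auto
  have C: "C \<ge> sqrt C0" using Bn by (auto simp: C_def intro!: sum_nonneg)
  show ?thesis
  proof (rule that[of C])
    show "C > 0" using C C0 by (meson less_le_trans real_sqrt_gt_zero)
    fix n
    show "\<exists>B\<ge>0. (\<forall>\<tau>. 0 < \<tau> \<longrightarrow> \<tau> < pi \<longrightarrow> dunkl_energy n \<tau> \<le> B\<^sup>2) \<and> B / dunkl_norm \<alpha> \<beta> n \<le> C"
    proof (cases "n \<in> S")
      case True
      have "B n / dunkl_norm \<alpha> \<beta> n \<le> (\<Sum>n\<in>S. B n / dunkl_norm \<alpha> \<beta> n)"
        using True fin Bn by (intro member_le_sum) auto
      also have "\<dots> \<le> C" using C0 by (simp add: C_def)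
      finally show ?thesis using B by (intro exI[of _ "B n"]) auto
    next
      case False
      then have "L \<le> real_of_int \<bar>n\<bar>" by (simp add: S_def)
      from large[OF this] obtain B where "B \<ge> 0" "\<forall>\<tau>. 0 < \<tau> \<longrightarrow> \<tau> < pi \<longrightarrow> dunkl_energy n \<tau> \<le> B\<^sup>2"
        "B / dunkl_norm \<alpha> \<beta> n \<le> sqrt C0" by (elim exE conjE)
      then show ?thesis using C by (intro exI[of _ B]) auto
    qed
  qed
qed

text \<open>The two normalizing norms cancel the factors \<open>B\<close> and \<open>B'\<close> of
  \<open>pair_heat_bounds\<close>, and the separation of the eigenvalues replaces their gap by the
  distance of the indices.\<close>

lemma dunkl_heat_kernel_bounds:
  obtains C where "C > 0"
    "\<And>t n m. t > 0 \<Longrightarrow> cmod (dunkl_heat_kernel \<alpha> \<beta> t n m) \<le> C"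
    "\<And>t n m. t > 0 \<Longrightarrow> sqrt t * cmod (dunkl_heat_kernel \<alpha> \<beta> t n m) \<le> C"
    "\<And>t n m. t > 0 \<Longrightarrow> (real_of_int (n - m))\<^sup>2 * cmod (dunkl_heat_kernel \<alpha> \<beta> t n m) \<le> C * sqrt t"
proof -
  let ?K = "dunkl_heat_kernel \<alpha> \<beta>"
  obtain C0 where C0: "C0 > 0" and ex:
    "\<And>n. \<exists>B\<ge>0. (\<forall>\<tau>. 0 < \<tau> \<longrightarrow> \<tau> < pi \<longrightarrow> dunkl_energy n \<tau> \<le> B\<^sup>2) \<and> B / dunkl_norm \<alpha> \<beta> n \<le> C0"
    by (rule dunkl_energy_normalized_bound) (rule that)
  define k where "k = 25 + 10 * ((\<alpha> + 1/2) + (\<beta> + 1/2))"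
  have k: "k \<ge> 25" using ab by (simp add: k_def)
  define C where "C = 2 * k * (C0 * C0)"
  have bounds: "cmod (?K t n m) \<le> C \<and>
       sqrt t * cmod (?K t n m) \<le> C \<and>
       (real_of_int (n - m))\<^sup>2 * cmod (?K t n m) \<le> C * sqrt t" if t: "t > 0" for t n m
  proof -
    let ?Nn = "dunkl_norm \<alpha> \<beta> n" and ?Nm = "dunkl_norm \<alpha> \<beta> m"
    obtain B where B: "B \<ge> 0" "\<And>\<tau>. 0 < \<tau> \<Longrightarrow> \<tau> < pi \<Longrightarrow> dunkl_energy n \<tau> \<le> B\<^sup>2" "B / ?Nn \<le> C0"
      using ex[of n] by (elim exE conjE) blast
    obtain B' where B': "B' \<ge> 0" "\<And>\<tau>. 0 < \<tau> \<Longrightarrow> \<tau> < pi \<Longrightarrow> dunkl_energy m \<tau> \<le> B'\<^sup>2" "B' / ?Nm \<le> C0"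
      using ex[of m] by (elim exE conjE) blast
    define I where "I = integral {0..pi} (\<lambda>\<tau>. heat_mult t \<tau> * pair_density (\<alpha> + 1/2) (\<beta> + 1/2)
        (dunkl_c \<alpha> \<beta> n) (dunkl_s \<alpha> \<beta> n) (dunkl_c \<alpha> \<beta> m) (dunkl_s \<alpha> \<beta> m) \<tau>)"
    have I: "\<bar>I\<bar> \<le> 4 * (B * B')"
      unfolding I_def
      by (rule pair_heat_bounds(1)[OF shift_nonneg dunkl_dirac_pair dunkl_dirac_pair t B(1) B'(1)]; rule B(2) B'(2); assumption)
    have I2: "sqrt t * \<bar>I\<bar> \<le> 5 * (B * B')"
      unfolding I_def
      by (rule pair_heat_bounds(2)[OF shift_nonneg dunkl_dirac_pair dunkl_dirac_pair t B(1) B'(1)]; rule B(2) B'(2); assumption)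
    have I3: "(dunkl_mu \<alpha> \<beta> n - dunkl_mu \<alpha> \<beta> m)\<^sup>2 * \<bar>I\<bar> \<le> k * sqrt t * (B * B')"
      unfolding I_def k_def
      by (rule pair_heat_bounds(3)[OF shift_nonneg dunkl_dirac_pair dunkl_dirac_pair t B(1) B'(1)]; rule B(2) B'(2); assumption)
    have K: "cmod (?K t n m) = 2 / (?Nn * ?Nm) * \<bar>I\<bar>"
      unfolding dunkl_heat_kernel_eq I_def[symmetric] norm_of_real abs_mult
      using dunkl_norm_nonneg[of n] dunkl_norm_nonneg[of m] by simp
    have N0: "0 \<le> 2 / (?Nn * ?Nm)" using dunkl_norm_nonneg[of n] dunkl_norm_nonneg[of m] by simp
    have ratio: "2 / (?Nn * ?Nm) * (B * B') \<le> 2 * (C0 * C0)"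
    proof -
      have "(B / ?Nn) * (B' / ?Nm) \<le> C0 * C0"
        using B B' C0 dunkl_norm_nonneg[of n] dunkl_norm_nonneg[of m] by (intro mult_mono) auto
      then show ?thesis by simp
    qed
    \<comment> \<open>One conversion serves all three estimates, with \<open>(x, y)\<close> equal to
      \<open>(1, 1)\<close>, \<open>(sqrt t, 1)\<close> and
      \<open>((n - m)^2, sqrt t)\<close>.\<close>
    have scale: "x * cmod (?K t n m) \<le> C * y"
      if "x * \<bar>I\<bar> \<le> k * y * (B * B')" "y \<ge> 0" for x y
    proof -
      have "x * cmod (?K t n m) = 2 / (?Nn * ?Nm) * (x * \<bar>I\<bar>)" unfolding K by simp
      also have "\<dots> \<le> 2 / (?Nn * ?Nm) * (k * y * (B * B'))" by (intro mult_left_mono that N0)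
      also have "\<dots> = k * y * (2 / (?Nn * ?Nm) * (B * B'))" by simp
      also have "\<dots> \<le> k * y * (2 * (C0 * C0))" using k that by (intro mult_left_mono ratio) auto
      finally show ?thesis by (simp add: C_def mult_ac)
    qed
    have BB: "0 \<le> B * B'" using B B' by simp
    have "4 * (B * B') \<le> k * (B * B')" "5 * (B * B') \<le> k * (B * B')"
      using k BB by (auto intro!: mult_right_mono)
    then have "1 * cmod (?K t n m) \<le> C * 1" "sqrt t * cmod (?K t n m) \<le> C * 1"
      using I I2 by (intro scale; simp)+
    moreover have "(real_of_int (n - m))\<^sup>2 * \<bar>I\<bar> \<le> k * sqrt t * (B * B')"
      using mult_right_mono[OF dunkl_mu_diff_square, of "\<bar>I\<bar>" n m] I3 by linarith
    then have "(real_of_int (n - m))\<^sup>2 * cmod (?K t n m) \<le> C * sqrt t"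
      by (rule scale) (use t in auto)
    ultimately show ?thesis by simp
  qed
  have "C > 0" using k C0 by (simp add: C_def)
  then show ?thesis using bounds by (intro that[of C]) auto
qed

end

section \<open>Weighted maximal functions\<close>

definition wavg :: "(int \<Rightarrow> real) \<Rightarrow> (int \<Rightarrow> real) \<Rightarrow> int \<Rightarrow> int \<Rightarrow> real" where
  "wavg w f a b = (\<Sum>k=a..b. f k * w k) / (\<Sum>k=a..b. w k)"

lemma finite_int_interval_Collect [simp]: "finite {n::int. a \<le> n \<and> n \<le> b \<and> P n}"
  by (rule finite_subset[of _ "{a..b}"]) auto

text \<open>Riesz's leader lemma, a discrete rising sun lemma. If the first point is a leader, take
  its shortest block of nonnegative sum: all proper prefixes are negative, so all tails are
  nonnegative and the block consists of leaders. It splits off with nonnegative sum, and induction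
  treats the rest.\<close>

lemma sum_leader_nonneg:
  fixes g :: "int \<Rightarrow> real"
  shows "0 \<le> sum g {n\<in>{lo..hi}. \<exists>b\<in>{n..hi}. 0 \<le> sum g {n..b}}"
proof (induction "nat (hi + 1 - lo)" arbitrary: lo rule: less_induct)
  case less
  define E where "E lo = {n\<in>{lo..hi}. \<exists>b\<in>{n..hi}. 0 \<le> sum g {n..b}}" for lo
  show ?case
  proof (cases "lo \<in> E lo")
    case False
    show ?thesis
    proof (cases "lo \<le> hi")
      case True
      then have "0 \<le> sum g (E (lo + 1))"
        unfolding E_def by (intro less) auto
      moreover have "E lo = E (lo + 1)"
      proof
        show "E lo \<subseteq> E (lo + 1)"
        proof
          fix n assume n: "n \<in> E lo"
          then have "n \<noteq> lo" using False by auto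
          with n show "n \<in> E (lo + 1)" by (auto simp: E_def)
        qed
      qed (auto simp: E_def)
      ultimately show ?thesis by (simp add: E_def)
    qed (simp add: E_def)
  next
    case True
    then obtain b0 where b0: "lo \<le> b0" "b0 \<le> hi" "0 \<le> sum g {lo..b0}" by (auto simp: E_def)
    define k where "k = (LEAST k::nat. 0 \<le> sum g {lo..lo + int k})"
    have ex: "0 \<le> sum g {lo..lo + int (nat (b0 - lo))}" using b0 by simp
    have k1: "0 \<le> sum g {lo..lo + int k}" unfolding k_def by (rule LeastI[of _ "nat (b0 - lo)"]) (rule ex)
    have k2: "k \<le> nat (b0 - lo)" unfolding k_def by (rule Least_le) (rule ex)
    have k3: "sum g {lo..lo + int j} < 0" if "j < k" for j
      using not_less_Least[of j "\<lambda>k. 0 \<le> sum g {lo..lo + int k}"] that by (simp add: k_def)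
    define b where "b = lo + int k"
    have b: "lo \<le> b" "b \<le> hi" "0 \<le> sum g {lo..b}" using k1 k2 b0 by (auto simp: b_def)
    have before: "sum g {lo..c} < 0" if "lo \<le> c" "c < b" for c
      using k3[of "nat (c - lo)"] that by (auto simp: b_def)
    have tail: "0 \<le> sum g {n..b}" if "lo \<le> n" "n \<le> b" for n
    proof (cases "n = lo")
      case False
      have "sum g {lo..b} = sum g {lo..n - 1} + sum g {n..b}"
        using that by (subst sum.union_disjoint[symmetric]) (auto intro!: sum.cong)
      then show ?thesis using before[of "n - 1"] b False that by auto
    qed (use b in auto)
    have "E lo = {lo..b} \<union> E (b + 1)"
    proof
      show "{lo..b} \<union> E (b + 1) \<subseteq> E lo"
        using tail b by (force simp: E_def)
    qed (auto simp: E_def)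
    then have "sum g (E lo) = sum g {lo..b} + sum g (E (b + 1))"
      by (simp only:) (rule sum.union_disjoint, auto simp: E_def)
    moreover have "0 \<le> sum g (E (b + 1))" unfolding E_def using b by (intro less) auto
    ultimately show ?thesis using b by (simp add: E_def)
  qed
qed

text \<open>The cut at \<open>hi\<close> makes the supremum a finite maximum. All bounds are uniform
  in the window, which finally exhausts the integers.\<close>

definition rmax :: "int \<Rightarrow> (int \<Rightarrow> real) \<Rightarrow> (int \<Rightarrow> real) \<Rightarrow> int \<Rightarrow> real" where
  "rmax hi w f n = Max ((\<lambda>b. wavg w f n b) ` {n..hi})"

definition lmax :: "int \<Rightarrow> (int \<Rightarrow> real) \<Rightarrow> (int \<Rightarrow> real) \<Rightarrow> int \<Rightarrow> real" where
  "lmax lo w f n = rmax (- lo) (\<lambda>k. w (- k)) (\<lambda>k. f (- k)) (- n)"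

definition wmax :: "int \<Rightarrow> int \<Rightarrow> (int \<Rightarrow> real) \<Rightarrow> (int \<Rightarrow> real) \<Rightarrow> int \<Rightarrow> real" where
  "wmax lo hi w f n = Max ((\<lambda>(a, b). wavg w f a b) ` ({lo..n} \<times> {n..hi}))"

lemma sum_int_reflect: "(\<Sum>k=a..b. g (- k)) = (\<Sum>k=-b..-a. g k)" for a b :: int and g :: "int \<Rightarrow> 'a::comm_monoid_add"
  by (rule sum.reindex_bij_witness[of _ uminus uminus]) auto

lemma wavg_reflect: "wavg (\<lambda>k. w (- k)) (\<lambda>k. f (- k)) a b = wavg w f (- b) (- a)"
  by (simp add: wavg_def sum_int_reflect[of "\<lambda>k. f k * w k"] sum_int_reflect[of w])

lemma wavg_nonneg: "(\<And>k. w k > 0) \<Longrightarrow> (\<And>k. f k \<ge> 0) \<Longrightarrow> wavg w f a b \<ge> 0"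
  unfolding wavg_def by (intro divide_nonneg_nonneg sum_nonneg mult_nonneg_nonneg) (auto intro: less_imp_le)

lemma sum_weight_pos: "(\<And>k. w k > 0) \<Longrightarrow> a \<le> b \<Longrightarrow> 0 < (\<Sum>k=a..b. w k)" for w :: "int \<Rightarrow> real"
  by (intro sum_pos) auto

lemma rmax_ge: "n \<le> b \<Longrightarrow> b \<le> hi \<Longrightarrow> wavg w f n b \<le> rmax hi w f n"
  unfolding rmax_def by (intro Max_ge) auto

lemma lmax_ge: "lo \<le> a \<Longrightarrow> a \<le> n \<Longrightarrow> wavg w f a n \<le> lmax lo w f n"
  using rmax_ge[of "- n" "- a" "- lo" "\<lambda>k. w (- k)" "\<lambda>k. f (- k)"] by (simp add: lmax_def wavg_reflect)

lemma rmax_nonneg: "(\<And>k. w k > 0) \<Longrightarrow> (\<And>k. f k \<ge> 0) \<Longrightarrow> n \<le> hi \<Longrightarrow> rmax hi w f n \<ge> 0"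
  by (rule order_trans[OF wavg_nonneg[of w f n n] rmax_ge[of n n hi w f]]) auto

lemma lmax_nonneg: "(\<And>k. w k > 0) \<Longrightarrow> (\<And>k. f k \<ge> 0) \<Longrightarrow> lo \<le> n \<Longrightarrow> lmax lo w f n \<ge> 0"
  by (simp add: lmax_def rmax_nonneg)

lemma wmax_ge: "lo \<le> a \<Longrightarrow> a \<le> n \<Longrightarrow> n \<le> b \<Longrightarrow> b \<le> hi \<Longrightarrow> wavg w f a b \<le> wmax lo hi w f n"
  unfolding wmax_def by (intro Max_ge) auto

lemma wmax_attained:
  assumes "lo \<le> n" "n \<le> hi"
  obtains a b where "lo \<le> a" "a \<le> n" "n \<le> b" "b \<le> hi" "wmax lo hi w f n = wavg w f a b"
proof -
  have "wmax lo hi w f n \<in> (\<lambda>(a, b). wavg w f a b) ` ({lo..n} \<times> {n..hi})"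
    unfolding wmax_def using assms by (intro Max_in) auto
  then show ?thesis using that by auto
qed

lemma wmax_nonneg: "(\<And>k. w k > 0) \<Longrightarrow> (\<And>k. f k \<ge> 0) \<Longrightarrow> lo \<le> n \<Longrightarrow> n \<le> hi \<Longrightarrow> wmax lo hi w f n \<ge> 0"
  by (rule order_trans[OF wavg_nonneg[of w f n n] wmax_ge[of lo n n n hi w f]]) auto

text \<open>An interval through \<open>n\<close> is split at \<open>n\<close>; the smaller
  denominators of the two halves only increase the quotients.\<close>

lemma wmax_le_rmax_lmax:
  assumes w: "\<And>k. w k > 0" and f: "\<And>k. f k \<ge> 0" and n: "lo \<le> n" "n \<le> hi"
  shows "wmax lo hi w f n \<le> rmax hi w f n + lmax lo w f n"
proof -
  obtain a b where ab: "lo \<le> a" "a \<le> n" "n \<le> b" "b \<le> hi" "wmax lo hi w f n = wavg w f a b"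
    using wmax_attained[OF n] by metis
  have fw: "f k * w k \<ge> 0" for k using w[of k] f[of k] by simp
  have W: "(\<Sum>k=n..b. w k) \<le> (\<Sum>k=a..b. w k)" "(\<Sum>k=a..n. w k) \<le> (\<Sum>k=a..b. w k)"
    using ab by (auto intro!: sum_mono2 less_imp_le[OF w])
  have pos: "0 < (\<Sum>k=n..b. w k)" "0 < (\<Sum>k=a..n. w k)" using ab by (auto intro!: sum_weight_pos w)
  have F0: "0 \<le> (\<Sum>k=n..b. f k * w k)" "0 \<le> (\<Sum>k=a..n. f k * w k)" by (auto intro!: sum_nonneg fw)
  have "(\<Sum>k=a..b. f k * w k) \<le> (\<Sum>k\<in>{n..b} \<union> {a..n}. f k * w k)"
    using ab by (intro sum_mono2 fw) auto
  also have "\<dots> \<le> (\<Sum>k=n..b. f k * w k) + (\<Sum>k=a..n. f k * w k)"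
    using sum.union_inter[of "{n..b}" "{a..n}" "\<lambda>k. f k * w k"] sum_nonneg[of "{n..b} \<inter> {a..n}" "\<lambda>k. f k * w k"] fw
    by auto
  finally have "wavg w f a b \<le> ((\<Sum>k=n..b. f k * w k) + (\<Sum>k=a..n. f k * w k)) / (\<Sum>k=a..b. w k)"
    unfolding wavg_def using W pos by (intro divide_right_mono) auto
  also have "\<dots> \<le> wavg w f n b + wavg w f a n"
    unfolding wavg_def add_divide_distrib using W pos F0 by (intro add_mono divide_left_mono) auto
  also have "\<dots> \<le> rmax hi w f n + lmax lo w f n"
    using ab by (intro add_mono rmax_ge lmax_ge)
  finally show ?thesis using ab by simp
qed

text \<open>\<open>s \<le> rmax hi w f n\<close> says that \<open>n\<close> is a leader for
  \<open>g = f w - s w\<close>. Hence the constant 1, whatever the weight.\<close>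

lemma rmax_weak_type:
  assumes w: "\<And>k. w k > 0"
  shows "s * (\<Sum>n\<in>{n\<in>{lo..hi}. s \<le> rmax hi w f n}. w n) \<le> (\<Sum>n\<in>{n\<in>{lo..hi}. s \<le> rmax hi w f n}. f n * w n)"
proof -
  define g where "g k = f k * w k - s * w k" for k
  have "(s \<le> rmax hi w f n) = (\<exists>b\<in>{n..hi}. 0 \<le> sum g {n..b})" if "n \<in> {lo..hi}" for n
  proof -
    have "(s \<le> rmax hi w f n) = (\<exists>b\<in>{n..hi}. s \<le> wavg w f n b)"
      unfolding rmax_def using that by (subst Max_ge_iff) auto
    also have "\<dots> = (\<exists>b\<in>{n..hi}. 0 \<le> sum g {n..b})"
    proof (intro bex_cong refl)
      fix b assume "b \<in> {n..hi}"
      then have "0 < (\<Sum>k=n..b. w k)" by (auto intro!: sum_weight_pos w)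
      then show "(s \<le> wavg w f n b) = (0 \<le> sum g {n..b})"
        by (simp add: wavg_def g_def sum_subtractf field_simps sum_distrib_left)
    qed
    finally show ?thesis .
  qed
  then have "{n\<in>{lo..hi}. s \<le> rmax hi w f n} = {n\<in>{lo..hi}. \<exists>b\<in>{n..hi}. 0 \<le> sum g {n..b}}" by blast
  then have "0 \<le> sum g {n\<in>{lo..hi}. s \<le> rmax hi w f n}"
    using sum_leader_nonneg[of g lo hi] by simp
  then show ?thesis by (simp add: g_def sum_subtractf sum_distrib_left)
qed

lemma lmax_weak_type:
  assumes w: "\<And>k. w k > 0"
  shows "s * (\<Sum>n\<in>{n\<in>{lo..hi}. s \<le> lmax lo w f n}. w n) \<le> (\<Sum>n\<in>{n\<in>{lo..hi}. s \<le> lmax lo w f n}. f n * w n)"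
proof -
  have *: "(\<Sum>n\<in>{n\<in>{- hi..- lo}. s \<le> lmax lo w f (- n)}. g (- n)) = (\<Sum>n\<in>{n\<in>{lo..hi}. s \<le> lmax lo w f n}. g n)"
    for g :: "int \<Rightarrow> real"
    by (rule sum.reindex_bij_witness[of _ uminus uminus]) auto
  show ?thesis
    using rmax_weak_type[of "\<lambda>k. w (- k)" s "- hi" "- lo" "\<lambda>k. f (- k)"] w *[of w] *[of "\<lambda>n. f n * w n"]
    by (simp add: lmax_def)
qed

text \<open>Multiplied by \<open>s^(p - 2)\<close> and integrated over \<open>s\<close>, the weak
  inequality becomes \<open>sum h^p w \<le> q sum f h^(p - 1) w\<close> with
  \<open>q = p / (p - 1)\<close>. A Young-type splitting then lets half of the left side, a finite
  sum, be absorbed.\<close>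

lemma strong_type_of_weak_type:
  fixes f h w :: "'a \<Rightarrow> real" and p :: real
  assumes p: "1 < p" and I: "finite I"
    and w: "\<And>n. n \<in> I \<Longrightarrow> w n \<ge> 0" and f: "\<And>n. n \<in> I \<Longrightarrow> f n \<ge> 0" and h: "\<And>n. n \<in> I \<Longrightarrow> h n \<ge> 0"
    and weak: "\<And>s. s > 0 \<Longrightarrow> s * (\<Sum>n\<in>{n\<in>I. s \<le> h n}. w n) \<le> (\<Sum>n\<in>{n\<in>I. s \<le> h n}. f n * w n)"
  shows "(\<Sum>n\<in>I. h n powr p * w n) \<le> 2 * (2 * (p / (p - 1))) powr p * (\<Sum>n\<in>I. f n powr p * w n)"
proof -
  define H where "H = sum h I"
  have hH: "h n \<le> H" if "n \<in> I" for n unfolding H_def using that I h by (intro member_le_sum) auto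
  have base: "((\<lambda>s. if s \<in> {0..h n} then s powr r else 0) has_integral (h n powr (r + 1) / (r + 1))) {0..H}"
    if "n \<in> I" "r > - 1" for n r
  proof -
    have "((\<lambda>s. s powr r) has_integral (h n powr (r + 1) / (r + 1))) {0..h n}"
      using that h by (intro has_integral_powr_from_0) auto
    then show ?thesis using hH[OF that(1)] by (subst has_integral_restrict) auto
  qed
  have i1: "((\<lambda>s. \<Sum>n\<in>I. w n * (if s \<in> {0..h n} then s powr (p - 1) else 0)) has_integral
      (\<Sum>n\<in>I. w n * (h n powr p / p))) {0..H}"
    using p I base[of _ "p - 1"] by (intro has_integral_sum has_integral_mult_right) auto
  have i2: "((\<lambda>s. \<Sum>n\<in>I. f n * w n * (if s \<in> {0..h n} then s powr (p - 2) else 0)) has_integral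
      (\<Sum>n\<in>I. f n * w n * (h n powr (p - 1) / (p - 1)))) {0..H}"
    using p I base[of _ "p - 2"] by (intro has_integral_sum has_integral_mult_right) auto
  have le: "(\<Sum>n\<in>I. w n * (h n powr p / p)) \<le> (\<Sum>n\<in>I. f n * w n * (h n powr (p - 1) / (p - 1)))"
  proof (rule has_integral_le[OF i1 i2])
    fix s assume s: "s \<in> {0..H}"
    \<comment> \<open>The weak inequality is assumed for positive \<open>s\<close>; at
      \<open>s = 0\<close> both integrands vanish because \<open>0 powr r = 0\<close>.\<close>
    show "(\<Sum>n\<in>I. w n * (if s \<in> {0..h n} then s powr (p - 1) else 0))
       \<le> (\<Sum>n\<in>I. f n * w n * (if s \<in> {0..h n} then s powr (p - 2) else 0))"
    proof (cases "s = 0")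
      case False
      then have s0: "s > 0" using s by simp
      have level: "(\<Sum>n\<in>I. g n * (if s \<in> {0..h n} then c else 0)) = c * (\<Sum>n\<in>{n\<in>I. s \<le> h n}. g n)"
        for g :: "'a \<Rightarrow> real" and c
      proof -
        have "(\<Sum>n\<in>I. g n * (if s \<in> {0..h n} then c else 0)) = (\<Sum>n\<in>I. if s \<le> h n then c * g n else 0)"
          using s0 by (intro sum.cong) (auto simp: mult.commute)
        also have "\<dots> = c * (\<Sum>n\<in>{n\<in>I. s \<le> h n}. g n)"
          unfolding sum_distrib_left by (subst sum.inter_filter[OF I]) simp
        finally show ?thesis .
      qed
      have pw: "s powr (p - 1) = s powr (p - 2) * s"
        using s0 powr_add[of s "p - 2" 1] by simp
      have "(\<Sum>n\<in>I. w n * (if s \<in> {0..h n} then s powr (p - 1) else 0))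
          = s powr (p - 2) * (s * (\<Sum>n\<in>{n\<in>I. s \<le> h n}. w n))"
        unfolding level pw by (simp only: mult.assoc)
      also have "\<dots> \<le> s powr (p - 2) * (\<Sum>n\<in>{n\<in>I. s \<le> h n}. f n * w n)"
        by (intro mult_left_mono weak s0) auto
      also have "\<dots> = (\<Sum>n\<in>I. f n * w n * (if s \<in> {0..h n} then s powr (p - 2) else 0))"
        by (simp only: level)
      finally show ?thesis .
    qed (simp add: if_distrib cong: if_cong)
  qed
  define q where "q = p / (p - 1)"
  have q: "q > 0" using p by (simp add: q_def)
  \<comment> \<open>Either \<open>2 q f \<le> h\<close>, and half of \<open>h^p\<close> suffices, or
    \<open>h < 2 q f\<close>, and \<open>h\<close> is replaced by \<open>2 q f\<close>.\<close>
  have young: "q * (f n * h n powr (p - 1)) \<le> h n powr p / 2 + (2 * q) powr p * f n powr p" if n: "n \<in> I" for n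
  proof -
    have pw: "x * x powr (p - 1) = x powr p" if "x \<ge> 0" for x :: real
      using that p powr_add[of x 1 "p - 1"] by (cases "x = 0") auto
    show ?thesis
    proof (cases "2 * q * f n \<le> h n")
      case True
      then have "q * f n * h n powr (p - 1) \<le> h n / 2 * h n powr (p - 1)" by (intro mult_right_mono) auto
      also have "\<dots> = h n powr p / 2" using pw[OF h[OF n]] by simp
      finally show ?thesis by (simp add: add_increasing2 mult.assoc)
    next
      case False
      then have "q * f n * h n powr (p - 1) \<le> (2 * q * f n) * (2 * q * f n) powr (p - 1)"
        using f[OF n] h[OF n] q p by (intro mult_mono powr_mono2) auto
      also have "\<dots> = (2 * q) powr p * f n powr p"
        using f[OF n] q by (subst pw) (auto simp: powr_mult)
      finally show ?thesis by (simp add: add_increasing mult.assoc)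
    qed
  qed
  have "(\<Sum>n\<in>I. h n powr p * w n) = p * (\<Sum>n\<in>I. w n * (h n powr p / p))"
    using p by (simp add: sum_distrib_left mult.commute)
  also have "\<dots> \<le> p * (\<Sum>n\<in>I. f n * w n * (h n powr (p - 1) / (p - 1)))" using p by (intro mult_left_mono le) auto
  also have "\<dots> = (\<Sum>n\<in>I. q * (f n * h n powr (p - 1)) * w n)"
    by (simp add: sum_distrib_left q_def field_simps)
  also have "\<dots> \<le> (\<Sum>n\<in>I. (h n powr p / 2 + (2 * q) powr p * f n powr p) * w n)"
    by (intro sum_mono mult_right_mono young w)
  also have "\<dots> = (\<Sum>n\<in>I. h n powr p * w n) / 2 + (2 * q) powr p * (\<Sum>n\<in>I. f n powr p * w n)"
    by (simp add: distrib_right sum.distrib sum_distrib_left sum_divide_distrib mult.assoc)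
  finally show ?thesis unfolding q_def by simp
qed

lemma wmax_strong_type:
  fixes p :: real
  assumes p: "1 < p" and w: "\<And>k. w k > 0" and f: "\<And>k. f k \<ge> 0"
  shows "(\<Sum>n=lo..hi. wmax lo hi w f n powr p * w n)
    \<le> 4 * 2 powr p * (2 * (p / (p - 1))) powr p * (\<Sum>n=lo..hi. f n powr p * w n)"
proof -
  let ?C = "2 * (2 * (p / (p - 1))) powr p * (\<Sum>n=lo..hi. f n powr p * w n)"
  have r: "(\<Sum>n=lo..hi. rmax hi w f n powr p * w n) \<le> ?C"
    by (rule strong_type_of_weak_type[OF p _ _ _ _ rmax_weak_type[OF w]]) (auto intro!: rmax_nonneg w f less_imp_le[OF w])
  have l: "(\<Sum>n=lo..hi. lmax lo w f n powr p * w n) \<le> ?C"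
    by (rule strong_type_of_weak_type[OF p _ _ _ _ lmax_weak_type[OF w]]) (auto intro!: lmax_nonneg w f less_imp_le[OF w])
  have "(\<Sum>n=lo..hi. wmax lo hi w f n powr p * w n)
     \<le> (\<Sum>n=lo..hi. 2 powr p * (rmax hi w f n powr p * w n + lmax lo w f n powr p * w n))"
  proof (rule sum_mono)
    fix n assume "n \<in> {lo..hi}"
    then have n: "lo \<le> n" "n \<le> hi" by auto
    let ?r = "rmax hi w f n" and ?l = "lmax lo w f n"
    have nn: "?r \<ge> 0" "?l \<ge> 0" using n by (auto intro: rmax_nonneg lmax_nonneg w f)
    have "wmax lo hi w f n powr p \<le> (2 * max ?r ?l) powr p"
      using wmax_le_rmax_lmax[of w f lo n hi] wmax_nonneg[of w f lo n hi] w f n p by (intro powr_mono2) auto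
    also have "\<dots> = 2 powr p * max ?r ?l powr p" using nn by (simp add: powr_mult)
    also have "\<dots> \<le> 2 powr p * (?r powr p + ?l powr p)" by (intro mult_left_mono) (auto simp: max_def)
    finally show "wmax lo hi w f n powr p * w n \<le> 2 powr p * (?r powr p * w n + ?l powr p * w n)"
      using mult_right_mono[OF _ less_imp_le[OF w[of n]]] by (fastforce simp: algebra_simps)
  qed
  also have "\<dots> = 2 powr p * ((\<Sum>n=lo..hi. rmax hi w f n powr p * w n) + (\<Sum>n=lo..hi. lmax lo w f n powr p * w n))"
    by (simp add: sum.distrib flip: sum_distrib_left)
  also have "\<dots> \<le> 2 powr p * (?C + ?C)" by (intro mult_left_mono add_mono r l) auto
  finally show ?thesis by simp
qed

text \<open>Where the sum of two one-sided maximal functions exceeds \<open>s\<close>, one of them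
  exceeds \<open>s / 2\<close>. The two sides and the halved level contribute a factor 2
  each.\<close>

lemma wmax_weak_type:
  assumes w: "\<And>k. w k > 0" and f: "\<And>k. f k \<ge> 0" and s: "s > 0"
  shows "s * (\<Sum>n\<in>{n\<in>{lo..hi}. s < wmax lo hi w f n}. w n) \<le> 4 * (\<Sum>n=lo..hi. f n * w n)"
proof -
  let ?R = "{n\<in>{lo..hi}. s / 2 \<le> rmax hi w f n}" and ?L = "{n\<in>{lo..hi}. s / 2 \<le> lmax lo w f n}"
  let ?F = "(\<Sum>n=lo..hi. f n * w n)"
  have fw: "f k * w k \<ge> 0" for k using w[of k] f[of k] by simp
  have w': "w k \<ge> 0" for k using w[of k] by simp
  have sub: "{n\<in>{lo..hi}. s < wmax lo hi w f n} \<subseteq> ?R \<union> ?L"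
  proof
    fix n assume n: "n \<in> {n\<in>{lo..hi}. s < wmax lo hi w f n}"
    then have "s < rmax hi w f n + lmax lo w f n"
      using wmax_le_rmax_lmax[of w f lo n hi] w f by auto
    then show "n \<in> ?R \<union> ?L" using n by (auto simp: field_simps)
  qed
  have r: "s / 2 * sum w ?R \<le> ?F"
    using rmax_weak_type[of w "s / 2" lo hi f] w sum_mono2[of "{lo..hi}" ?R "\<lambda>n. f n * w n"] fw by force
  have l: "s / 2 * sum w ?L \<le> ?F"
    using lmax_weak_type[of w "s / 2" lo hi f] w sum_mono2[of "{lo..hi}" ?L "\<lambda>n. f n * w n"] fw by force
  have "sum w {n\<in>{lo..hi}. s < wmax lo hi w f n} \<le> sum w (?R \<union> ?L)"
    by (rule sum_mono2[OF _ sub]) (auto intro: w' finite_subset[of _ "{lo..hi}"])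
  also have "\<dots> \<le> sum w ?R + sum w ?L"
    using sum.union_inter[of ?R ?L w] sum_nonneg[of "?R \<inter> ?L" w] w' by auto
  finally have "s / 2 * sum w {n\<in>{lo..hi}. s < wmax lo hi w f n} \<le> s / 2 * (sum w ?R + sum w ?L)"
    using s by (intro mult_left_mono) auto
  then show ?thesis using r l by (simp add: distrib_left)
qed

text \<open>Lerner's argument: the unweighted average is controlled by two weighted maximal functions, whose bounds do not depend on the weight.\<close>

lemma window_max_Ap:
  fixes p K :: real
  assumes p: "1 < p" and w: "\<And>k. w k > 0" and f: "\<And>k. f k \<ge> 0" and K: "K > 0"
    and Ap: "\<And>m n. m \<le> n \<Longrightarrow> 1 / real_of_int (n - m + 1) powr p * (\<Sum>k=m..n. w k) *
                    (\<Sum>k=m..n. w k powr (- 1 / (p - 1))) powr (p - 1) \<le> K"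
  defines "q \<equiv> p / (p - 1)"
  shows "(\<Sum>n=lo..hi. wmax lo hi (\<lambda>_. 1) f n powr p * w n)
    \<le> K powr q * (4 * 2 powr q * (2 * (q / (q - 1))) powr q) * (4 * 2 powr p * (2 * (p / (p - 1))) powr p)
      * (\<Sum>n=lo..hi. f n powr p * w n)"
proof -
  \<comment> \<open>The dual weight. With \<open>F = f / \<sigma>\<close>, the plain average of
    \<open>f\<close> is a \<sigma>-average of \<open>F\<close> times the plain average of \<sigma>,
    and \<open>F^p \<sigma> = f^p w\<close>.\<close>
  define \<sigma> where "\<sigma> k = w k powr (- 1 / (p - 1))" for k
  have \<sigma>: "\<sigma> k > 0" for k using w[of k] by (simp add: \<sigma>_def)
  define F where "F k = f k / \<sigma> k" for k
  have F: "F k \<ge> 0" for k using \<sigma>[of k] f[of k] by (simp add: F_def)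
  \<comment> \<open>On the window \<open>h w\<close> is the power \<open>p - 1\<close> of the
    \<sigma>-maximal function of \<open>F\<close>, and \<open>h^q w\<close> is its power
    \<open>p\<close> times \<sigma>. The second maximal function, with respect to \<open>w\<close>,
    is applied to this \<open>h\<close>.\<close>
  define h where "h k = (if k \<in> {lo..hi} then wmax lo hi \<sigma> F k powr (p - 1) / w k else 0)" for k
  have h: "h k \<ge> 0" for k using w[of k] by (simp add: h_def)
  have q: "1 < q" using p by (simp add: q_def)
  have pq: "(p - 1) * q = p" using p by (simp add: q_def)
  have key: "wmax lo hi (\<lambda>_. 1) f n powr (p - 1) \<le> K * wmax lo hi w h n" if n: "lo \<le> n" "n \<le> hi" for n
  proof -
    obtain a b where ab: "lo \<le> a" "a \<le> n" "n \<le> b" "b \<le> hi" "wmax lo hi (\<lambda>_. 1) f n = wavg (\<lambda>_. 1) f a b"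
      using wmax_attained[OF n] by metis
    define N where "N = real_of_int (b - a + 1)"
    have N: "N > 0" using ab by (simp add: N_def)
    let ?W = "\<Sum>k=a..b. w k" and ?S = "\<Sum>k=a..b. \<sigma> k"
    have W: "?W > 0" and S: "?S > 0" using ab by (auto intro!: sum_weight_pos w \<sigma>)
    have cardN: "(\<Sum>k=a..b. 1::real) = N" using ab by (simp add: N_def)
    have av: "wavg (\<lambda>_. 1) f a b = ?S / N * wavg \<sigma> F a b"
    proof -
      have "f k = F k * \<sigma> k" for k using \<sigma>[of k] by (simp add: F_def)
      then show ?thesis using S cardN by (simp add: wavg_def)
    qed
    have apk: "(?S / N) powr (p - 1) \<le> K * N / ?W"
    proof -
      have "1 / N powr p * ?W * ?S powr (p - 1) \<le> K"
        using Ap[of a b] ab by (simp add: N_def \<sigma>_def)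
      moreover have "N powr p = N * N powr (p - 1)" using N powr_add[of N 1 "p - 1"] by simp
      ultimately show ?thesis using N W S by (simp add: powr_divide field_simps)
    qed
    \<comment> \<open>At every \<open>k\<close> in [a, b] the interval [a, b] competes in the
      maximal function, which is therefore at least this average.\<close>
    have avh: "N * wavg \<sigma> F a b powr (p - 1) \<le> (\<Sum>k=a..b. h k * w k)"
    proof -
      have "N * wavg \<sigma> F a b powr (p - 1) = (\<Sum>k=a..b. wavg \<sigma> F a b powr (p - 1))"
        unfolding cardN[symmetric] by simp
      also have "\<dots> \<le> (\<Sum>k=a..b. h k * w k)"
      proof (rule sum_mono)
        fix k assume k: "k \<in> {a..b}"
        then have "wavg \<sigma> F a b powr (p - 1) \<le> wmax lo hi \<sigma> F k powr (p - 1)"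
          using ab p by (intro powr_mono2 wmax_ge wavg_nonneg \<sigma> F) auto
        also have "\<dots> = h k * w k" using k ab w[of k] by (simp add: h_def)
        finally show "wavg \<sigma> F a b powr (p - 1) \<le> h k * w k" .
      qed
      finally show ?thesis .
    qed
    have "wavg (\<lambda>_. 1) f a b powr (p - 1) = (?S / N) powr (p - 1) * wavg \<sigma> F a b powr (p - 1)"
      unfolding av using S N by (intro powr_mult)
    also have "\<dots> \<le> K * N / ?W * wavg \<sigma> F a b powr (p - 1)" by (intro mult_right_mono apk) auto
    also have "\<dots> = K / ?W * (N * wavg \<sigma> F a b powr (p - 1))" by simp
    also have "\<dots> \<le> K / ?W * (\<Sum>k=a..b. h k * w k)" using K W by (intro mult_left_mono avh) auto
    also have "\<dots> = K * wavg w h a b" by (simp add: wavg_def)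
    also have "\<dots> \<le> K * wmax lo hi w h n" using K ab by (intro mult_left_mono wmax_ge) auto
    finally show ?thesis using ab by simp
  qed
  have "(\<Sum>n=lo..hi. wmax lo hi (\<lambda>_. 1) f n powr p * w n) \<le> (\<Sum>n=lo..hi. K powr q * (wmax lo hi w h n powr q * w n))"
  proof (rule sum_mono)
    fix n assume "n \<in> {lo..hi}"
    then have n: "lo \<le> n" "n \<le> hi" by auto
    have "wmax lo hi (\<lambda>_. 1) f n powr p = (wmax lo hi (\<lambda>_. 1) f n powr (p - 1)) powr q"
      by (simp add: powr_powr pq)
    also have "\<dots> \<le> (K * wmax lo hi w h n) powr q" using q by (intro powr_mono2 key n) auto
    also have "\<dots> = K powr q * wmax lo hi w h n powr q" using K wmax_nonneg[OF w h n] by (simp add: powr_mult)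
    finally show "wmax lo hi (\<lambda>_. 1) f n powr p * w n \<le> K powr q * (wmax lo hi w h n powr q * w n)"
      using mult_right_mono[OF _ less_imp_le[OF w[of n]]] by (fastforce simp: algebra_simps)
  qed
  also have "\<dots> = K powr q * (\<Sum>n=lo..hi. wmax lo hi w h n powr q * w n)" by (simp add: sum_distrib_left)
  \<comment> \<open>The \<open>w\<close>-maximal function is used with the exponent
    \<open>q\<close>; the \<sigma>-maximal function follows below with the exponent
    \<open>p\<close>.\<close>
  also have "\<dots> \<le> K powr q * (4 * 2 powr q * (2 * (q / (q - 1))) powr q * (\<Sum>n=lo..hi. h n powr q * w n))"
    by (intro mult_left_mono wmax_strong_type q w h) auto
  also have "(\<Sum>n=lo..hi. h n powr q * w n) = (\<Sum>n=lo..hi. wmax lo hi \<sigma> F n powr p * \<sigma> n)"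
  proof (rule sum.cong)
    fix n assume n: "n \<in> {lo..hi}"
    have e: "1 - q = - 1 / (p - 1)" using p by (simp add: q_def field_simps)
    have "h n powr q * w n = (wmax lo hi \<sigma> F n powr (p - 1)) powr q * (w n / w n powr q)"
      using n w[of n] by (simp add: h_def powr_divide)
    also have "w n / w n powr q = \<sigma> n" unfolding \<sigma>_def e[symmetric] using w[of n] by (simp add: powr_diff)
    finally show "h n powr q * w n = wmax lo hi \<sigma> F n powr p * \<sigma> n" by (simp add: powr_powr pq)
  qed simp
  also have "K powr q * (4 * 2 powr q * (2 * (q / (q - 1))) powr q * (\<Sum>n=lo..hi. wmax lo hi \<sigma> F n powr p * \<sigma> n))
     \<le> K powr q * (4 * 2 powr q * (2 * (q / (q - 1))) powr q *
         (4 * 2 powr p * (2 * (p / (p - 1))) powr p * (\<Sum>n=lo..hi. F n powr p * \<sigma> n)))"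
    by (intro mult_left_mono wmax_strong_type p \<sigma> F) auto
  also have "(\<Sum>n=lo..hi. F n powr p * \<sigma> n) = (\<Sum>n=lo..hi. f n powr p * w n)"
  proof (rule sum.cong)
    fix n
    have "F n powr p * \<sigma> n = f n powr p * (\<sigma> n / \<sigma> n powr p)"
      using f[of n] \<sigma>[of n] by (simp add: F_def powr_divide)
    also have "\<sigma> n / \<sigma> n powr p = \<sigma> n powr (1 - p)" using \<sigma>[of n] by (simp add: powr_diff)
    also have "\<dots> = w n"
    proof -
      have "(- 1 / (p - 1)) * (1 - p) = 1" using p by (simp add: field_simps)
      then show ?thesis using w[of n] unfolding \<sigma>_def powr_powr by simp
    qed
    finally show "F n powr p * \<sigma> n = f n powr p * w n" .
  qed simp
  finally show ?thesis by (simp only: mult.assoc)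
qed

text \<open>The A_1 condition gives \<open>1 / N \<le> K * w k / W\<close> at each point of an
  interval, so plain averages are at most \<open>K\<close> times \<open>w\<close>-averages. The weak
  type of the \<open>w\<close>-maximal function is then read off at level
  \<open>s / K\<close>.\<close>

lemma window_max_A1:
  assumes w: "\<And>k. w k > 0" and f: "\<And>k. f k \<ge> 0" and K: "K > 0" and s: "s > 0"
    and A1: "\<And>m n. m \<le> n \<Longrightarrow> 1 / real_of_int (n - m + 1) * (\<Sum>k=m..n. w k) * (MAX k\<in>{m..n}. inverse (w k)) \<le> K"
  shows "s * (\<Sum>n\<in>{n\<in>{lo..hi}. s < wmax lo hi (\<lambda>_. 1) f n}. w n) \<le> 4 * K * (\<Sum>n=lo..hi. f n * w n)"
proof -
  have key: "wmax lo hi (\<lambda>_. 1) f n \<le> K * wmax lo hi w f n" if n: "lo \<le> n" "n \<le> hi" for n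
  proof -
    obtain a b where ab: "lo \<le> a" "a \<le> n" "n \<le> b" "b \<le> hi" "wmax lo hi (\<lambda>_. 1) f n = wavg (\<lambda>_. 1) f a b"
      using wmax_attained[OF n] by metis
    define N where "N = real_of_int (b - a + 1)"
    have N: "N > 0" using ab by (simp add: N_def)
    let ?W = "\<Sum>k=a..b. w k" and ?M = "MAX k\<in>{a..b}. inverse (w k)"
    have W: "?W > 0" using ab by (auto intro!: sum_weight_pos w)
    have NM: "1 / N * ?M \<le> K / ?W" using A1[of a b] ab W N by (simp add: N_def field_simps)
    have "wavg (\<lambda>_. 1) f a b = 1 / N * (\<Sum>k=a..b. f k)" using ab by (simp add: wavg_def N_def)
    also have "(\<Sum>k=a..b. f k) \<le> (\<Sum>k=a..b. ?M * (f k * w k))"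
    proof (rule sum_mono)
      fix k assume "k \<in> {a..b}"
      then have "inverse (w k) \<le> ?M" by (intro Max_ge) auto
      then have "inverse (w k) * (f k * w k) \<le> ?M * (f k * w k)"
        using f[of k] w[of k] by (intro mult_right_mono) auto
      moreover have "inverse (w k) * (f k * w k) = f k" using w[of k] by (simp add: field_simps)
      ultimately show "f k \<le> ?M * (f k * w k)" by simp
    qed
    then have "1 / N * (\<Sum>k=a..b. f k) \<le> 1 / N * (\<Sum>k=a..b. ?M * (f k * w k))" using N by (intro mult_left_mono) auto
    also have "\<dots> = (1 / N * ?M) * (\<Sum>k=a..b. f k * w k)" by (simp add: sum_distrib_left mult.assoc)
    also have "\<dots> \<le> K / ?W * (\<Sum>k=a..b. f k * w k)"
      using f w by (intro mult_right_mono NM sum_nonneg mult_nonneg_nonneg) (auto intro: less_imp_le)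
    also have "\<dots> = K * wavg w f a b" by (simp add: wavg_def)
    also have "\<dots> \<le> K * wmax lo hi w f n" using K ab by (intro mult_left_mono wmax_ge) auto
    finally show ?thesis using ab by simp
  qed
  have "(\<Sum>n\<in>{n\<in>{lo..hi}. s < wmax lo hi (\<lambda>_. 1) f n}. w n) \<le> (\<Sum>n\<in>{n\<in>{lo..hi}. s / K < wmax lo hi w f n}. w n)"
  proof (rule sum_mono2)
    show "{n\<in>{lo..hi}. s < wmax lo hi (\<lambda>_. 1) f n} \<subseteq> {n\<in>{lo..hi}. s / K < wmax lo hi w f n}"
    proof safe
      fix n assume n: "n \<in> {lo..hi}" and "s < wmax lo hi (\<lambda>_. 1) f n"
      then have "s < K * wmax lo hi w f n" using key[of n] by auto
      then show "s / K < wmax lo hi w f n" using K by (simp add: field_simps)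
    qed
  qed (auto intro: less_imp_le[OF w])
  then have "s / K * (\<Sum>n\<in>{n\<in>{lo..hi}. s < wmax lo hi (\<lambda>_. 1) f n}. w n) \<le> s / K * (\<Sum>n\<in>{n\<in>{lo..hi}. s / K < wmax lo hi w f n}. w n)"
    using s K by (intro mult_left_mono) auto
  also have "\<dots> \<le> 4 * (\<Sum>n=lo..hi. f n * w n)" using s K by (intro wmax_weak_type w f) auto
  finally show ?thesis using K by (simp add: field_simps)
qed

section \<open>Domination by the Hardy-Littlewood maximal function\<close>

text \<open>The hypotheses bound \<open>k\<close> by C min (1 / R) (R / (n - m)^2), a profile of
  width \<open>R\<close>. The ball of radius \<open>2^j R\<close> has about \<open>2^j R\<close>
  points and enters with weight of order \<open>4^(-j) / R\<close>, leaving a geometric series. A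
  natural number \<open>R\<close> gives the balls integral endpoints.\<close>

lemma kernel_average_bound:
  fixes f k :: "int \<Rightarrow> real" and R :: nat
  assumes f: "\<And>m. f m \<ge> 0" and C: "C \<ge> 0" and R: "R \<ge> 1"
    and k1: "\<And>m. real R * k m \<le> C" and k2: "\<And>m. (real_of_int (n - m))\<^sup>2 * k m \<le> C * real R"
    and B: "\<And>a b. a \<le> n \<Longrightarrow> n \<le> b \<Longrightarrow> wavg (\<lambda>_. 1) f a b \<le> B"
    and S: "finite S"
  shows "(\<Sum>m\<in>S. f m * k m) \<le> 24 * C * B"
proof -
  have R0: "real R > 0" using R by simp
  have B0: "B \<ge> 0" using B[of n n] f[of n] by (simp add: wavg_def)
  \<comment> \<open>Large enough for the balls up to index \<open>J\<close> to cover the finite set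
    \<open>S\<close>.\<close>
  define J where "J = nat (\<Sum>m\<in>S. \<bar>n - m\<bar>)"
  \<comment> \<open>Outside the ball of index \<open>j - 1\<close> the distance exceeds
    \<open>2^(j - 1) R\<close>; squaring the halved radius costs the factor 4.\<close>
  define b where "b j = 4 * C / (4 ^ j * real R)" for j :: nat
  have b0: "b j \<ge> 0" for j using C by (simp add: b_def)
  define I where "I j = {n - 2 ^ j * int R..n + 2 ^ j * int R}" for j :: nat
  have pointwise: "f m * k m \<le> (\<Sum>j\<le>J. b j * (if m \<in> I j then f m else 0))" if m: "m \<in> S" for m
  proof -
    have "\<bar>n - m\<bar> \<le> (\<Sum>m\<in>S. \<bar>n - m\<bar>)" using m S by (intro member_le_sum) auto
    then have "\<bar>n - m\<bar> \<le> int J" by (simp add: J_def)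
    also have "int J \<le> 2 ^ J * int R"
    proof -
      have "int J \<le> 2 ^ J" by (rule less_imp_le[OF of_nat_less_two_power])
      also have "\<dots> \<le> 2 ^ J * int R" using R by simp
      finally show ?thesis .
    qed
    finally have exJ: "\<bar>n - m\<bar> \<le> 2 ^ J * int R" .
    define i where "i = (LEAST j. \<bar>n - m\<bar> \<le> 2 ^ j * int R)"
    have i1: "\<bar>n - m\<bar> \<le> 2 ^ i * int R" unfolding i_def by (rule LeastI[of _ J]) (rule exJ)
    have i2: "i \<le> J" unfolding i_def by (rule Least_le) (rule exJ)
    have i3: "\<not> \<bar>n - m\<bar> \<le> 2 ^ j * int R" if "j < i" for j using not_less_Least[of j] that by (simp add: i_def)
    have "k m \<le> b i"
    proof (cases i)
      case 0
      have "k m \<le> C / R" using k1[of m] R0 by (simp add: field_simps)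
      also have "\<dots> \<le> b i" using C R0 0 by (simp add: b_def field_simps)
      finally show ?thesis .
    next
      case (Suc j)
      have "2 ^ j * int R < \<bar>n - m\<bar>" using i3[of j] Suc by simp
      then have "real_of_int (2 ^ j * int R) < real_of_int \<bar>n - m\<bar>" by (rule of_int_less_iff[THEN iffD2])
      then have "2 ^ j * real R < \<bar>real_of_int (n - m)\<bar>" by simp
      then have *: "(2 ^ j * real R)\<^sup>2 \<le> \<bar>real_of_int (n - m)\<bar>\<^sup>2" by (intro power_mono) auto
      then have sq: "4 ^ j * (real R)\<^sup>2 \<le> (real_of_int (n - m))\<^sup>2"
      proof -
        have "((2::real) ^ j)\<^sup>2 = 4 ^ j" by (simp add: power2_eq_square flip: power_mult_distrib)
        then show ?thesis using * by (simp only: power_mult_distrib power2_abs)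
      qed
      show ?thesis
      proof (cases "k m \<le> 0")
        case False
        then have "4 ^ j * (real R)\<^sup>2 * k m \<le> C * real R"
          using k2[of m] mult_right_mono[OF sq, of "k m"] by linarith
        then have "k m \<le> C / (4 ^ j * real R)" using R0 by (simp add: power2_eq_square field_simps)
        then show ?thesis using Suc R0 by (simp add: b_def)
      qed (use b0[of i] in linarith)
    qed
    then have "f m * k m \<le> b i * f m" using mult_left_mono[of "k m" "b i" "f m"] f[of m] by (simp add: mult.commute)
    also have "\<dots> = b i * (if m \<in> I i then f m else 0)" using i1 by (auto simp: I_def abs_le_iff)
    also have "\<dots> \<le> (\<Sum>j\<le>J. b j * (if m \<in> I j then f m else 0))"
      using i2 b0 f by (intro member_le_sum) auto
    finally show ?thesis .
  qed
  \<comment> \<open>12 = 4 * 3: the ball has \<open>2 * 2^j R + 1 \<le> 3 * 2^j R\<close> points.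
    The geometric series doubles this to 24.\<close>
  have shell: "b j * (\<Sum>m\<in>S. if m \<in> I j then f m else 0) \<le> 12 * C * B * (1/2) ^ j" for j
  proof -
    have "(\<Sum>m\<in>S. if m \<in> I j then f m else 0) = sum f (S \<inter> I j)" using S by (simp add: sum.inter_restrict)
    also have "\<dots> \<le> sum f (I j)" using f by (intro sum_mono2) (auto simp: I_def)
    also have "\<dots> = (2 * 2 ^ j * real R + 1) * wavg (\<lambda>_. 1) f (n - 2 ^ j * int R) (n + 2 ^ j * int R)"
    proof -
      have "real (card (I j)) = 2 * 2 ^ j * real R + 1" by (simp add: I_def)
      moreover have "0 < 2 * 2 ^ j * real R + 1" using R0 by (simp add: add_pos_pos)
      ultimately show ?thesis by (simp add: wavg_def flip: I_def)
    qed
    also have "\<dots> \<le> (2 * 2 ^ j * real R + 1) * B" by (intro mult_left_mono B) auto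
    also have "\<dots> \<le> (3 * 2 ^ j * real R) * B"
    proof (intro mult_right_mono B0)
      have "1 * 1 \<le> 2 ^ j * real R" using R by (intro mult_mono) auto
      then show "2 * 2 ^ j * real R + 1 \<le> 3 * 2 ^ j * real R" by (simp add: mult.commute)
    qed
    finally have "b j * (\<Sum>m\<in>S. if m \<in> I j then f m else 0) \<le> b j * ((3 * 2 ^ j * real R) * B)"
      by (intro mult_left_mono b0)
    also have "\<dots> = 12 * C * B * (2 ^ j / 4 ^ j)" using R0 by (simp add: b_def)
    also have "(2::real) ^ j / 4 ^ j = (1/2) ^ j" by (simp flip: power_divide)
    finally show ?thesis .
  qed
  have "(\<Sum>m\<in>S. f m * k m) \<le> (\<Sum>m\<in>S. \<Sum>j\<le>J. b j * (if m \<in> I j then f m else 0))"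
    by (intro sum_mono pointwise)
  also have "\<dots> = (\<Sum>j\<le>J. b j * (\<Sum>m\<in>S. if m \<in> I j then f m else 0))"
    by (subst sum.swap) (simp add: sum_distrib_left)
  also have "\<dots> \<le> (\<Sum>j\<le>J. 12 * C * B * (1/2) ^ j)" by (intro sum_mono shell)
  also have "\<dots> = 12 * C * B * (\<Sum>j\<le>J. (1/2) ^ j)" by (simp add: sum_distrib_left)
  also have "\<dots> \<le> 12 * C * B * 2"
  proof (intro mult_left_mono)
    show "(\<Sum>j\<le>J. (1/2::real) ^ j) \<le> 2"
      unfolding sum_gp_basic lessThan_Suc_atMost[symmetric] sum_gp_strict by simp
  qed (use C B0 in simp)
  finally show ?thesis by simp
qed

section \<open>The Hardy-Littlewood maximal function as a limit of windows\<close>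

definition avg_set :: "(int \<Rightarrow> complex) \<Rightarrow> int \<Rightarrow> real set" where
  "avg_set f n = {wavg (\<lambda>_. 1) (\<lambda>k. cmod (f k)) a b | a b. a \<le> n \<and> n \<le> b}"

definition hardy_littlewood :: "(int \<Rightarrow> complex) \<Rightarrow> int \<Rightarrow> real" where
  "hardy_littlewood f n = Sup (avg_set f n)"

abbreviation window_max :: "nat \<Rightarrow> (int \<Rightarrow> complex) \<Rightarrow> int \<Rightarrow> real" where
  "window_max N f \<equiv> wmax (- int N) (int N) (\<lambda>_. 1) (\<lambda>k. cmod (f k))"

text \<open>A real \<open>Sup\<close> is meaningful for bounded sets only; this records that the
  maximal function is finite at every point.\<close>

definition tame :: "(int \<Rightarrow> complex) \<Rightarrow> bool" where
  "tame f \<longleftrightarrow> (\<forall>n. bdd_above (avg_set f n))"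

lemma avg_set_nonempty: "avg_set f n \<noteq> {}"
  by (auto simp: avg_set_def)

lemma avg_le_hardy_littlewood:
  "tame f \<Longrightarrow> a \<le> n \<Longrightarrow> n \<le> b \<Longrightarrow> wavg (\<lambda>_. 1) (\<lambda>k. cmod (f k)) a b \<le> hardy_littlewood f n"
  unfolding hardy_littlewood_def tame_def by (intro cSup_upper) (auto simp: avg_set_def)

lemma wmax_le_hardy_littlewood:
  "tame f \<Longrightarrow> lo \<le> n \<Longrightarrow> n \<le> hi \<Longrightarrow> wmax lo hi (\<lambda>_. 1) (\<lambda>k. cmod (f k)) n \<le> hardy_littlewood f n"
  by (metis wmax_attained avg_le_hardy_littlewood)

text \<open>Every interval is contained in a symmetric window, so bounds uniform in the window
  suffice.\<close>

lemma tame_by_window: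
  assumes "\<And>n. \<exists>M. \<forall>N. \<bar>n\<bar> \<le> int N \<longrightarrow> window_max N f n \<le> M"
  shows "tame f"
  unfolding tame_def
proof
  fix n
  obtain M where M: "\<And>N. \<bar>n\<bar> \<le> int N \<Longrightarrow> window_max N f n \<le> M"
    using assms by metis
  show "bdd_above (avg_set f n)"
  proof (rule bdd_aboveI[of _ M])
    fix x assume "x \<in> avg_set f n"
    then obtain a b where ab: "a \<le> n" "n \<le> b" "x = wavg (\<lambda>_. 1) (\<lambda>k. cmod (f k)) a b" by (auto simp: avg_set_def)
    let ?N = "nat (\<bar>a\<bar> + \<bar>b\<bar>)"
    have "x \<le> window_max ?N f n"
      unfolding ab(3) by (rule wmax_ge) (use ab in auto)
    also have "\<dots> \<le> M" using ab by (intro M) auto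
    finally show "x \<le> M" .
  qed
qed

lemma eventually_wmax_greater:
  assumes "c < hardy_littlewood f n"
  shows "\<forall>\<^sub>F N in sequentially. c < window_max N f n"
proof -
  obtain a b where ab: "a \<le> n" "n \<le> b" "c < wavg (\<lambda>_. 1) (\<lambda>k. cmod (f k)) a b"
    using less_cSupD[OF avg_set_nonempty assms[unfolded hardy_littlewood_def]] by (auto simp: avg_set_def)
  have "c < window_max N f n" if "N \<ge> nat (\<bar>a\<bar> + \<bar>b\<bar>)" for N
    by (rule less_le_trans[OF ab(3) wmax_ge]) (use ab that in auto)
  then show ?thesis unfolding eventually_sequentially by blast
qed

lemma wmax_tendsto_hardy_littlewood:
  assumes "tame f"
  shows "(\<lambda>N. window_max N f n) \<longlonglongrightarrow> hardy_littlewood f n"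
proof (rule order_tendstoI)
  fix c assume "hardy_littlewood f n < c"
  then have "window_max N f n < c" if "N \<ge> nat \<bar>n\<bar>" for N
    by (rule le_less_trans[OF wmax_le_hardy_littlewood[OF assms], rotated 2]) (use that in auto)
  then show "\<forall>\<^sub>F N in sequentially. window_max N f n < c"
    unfolding eventually_sequentially by blast
qed (rule eventually_wmax_greater)

abbreviation lp_mass :: "real \<Rightarrow> (int \<Rightarrow> real) \<Rightarrow> (int \<Rightarrow> complex) \<Rightarrow> real" where
  "lp_mass p w f \<equiv> (\<Sum>\<^sub>\<infinity>n. cmod (f n) powr p * w n)"

lemma lp_window_le:
  assumes "f \<in> lp_space p w" "\<And>k. w k > 0" "finite S"
  shows "(\<Sum>n\<in>S. cmod (f n) powr p * w n) \<le> lp_mass p w f"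
  using assms by (intro finite_sum_le_infsum) (auto simp: lp_space_def less_imp_le)

text \<open>A single term of the uniform window bound already shows finiteness at a point. On a
  finite set of points the windows converge termwise, and the bound passes to the limit.\<close>

lemma hardy_littlewood_Ap:
  fixes p :: real
  assumes p: "1 < p" and w: "w \<in> muckenhoupt_Ap p"
  obtains C where "C > 0"
    "\<And>f. f \<in> lp_space p w \<Longrightarrow> tame f"
    "\<And>f S. f \<in> lp_space p w \<Longrightarrow> finite S \<Longrightarrow>
      (\<Sum>n\<in>S. hardy_littlewood f n powr p * w n) \<le> C * lp_mass p w f"
proof -
  have wpos: "w k > 0" for k using w by (simp add: muckenhoupt_Ap_def)
  obtain K0 where K0: "\<And>m n. m \<le> n \<Longrightarrow> 1 / real_of_int (n - m + 1) powr p * (\<Sum>k=m..n. w k) *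
                    (\<Sum>k=m..n. w k powr (- 1 / (p - 1))) powr (p - 1) \<le> K0"
    using w unfolding muckenhoupt_Ap_def bdd_above_def by blast
  define K where "K = max K0 1"
  have K: "K > 0" "\<And>m n. m \<le> n \<Longrightarrow> 1 / real_of_int (n - m + 1) powr p * (\<Sum>k=m..n. w k) *
                    (\<Sum>k=m..n. w k powr (- 1 / (p - 1))) powr (p - 1) \<le> K"
    using K0 by (auto simp: K_def le_max_iff_disj)
  define q where "q = p / (p - 1)"
  define C where "C = K powr q * (4 * 2 powr q * (2 * (q / (q - 1))) powr q) * (4 * 2 powr p * (2 * (p / (p - 1))) powr p)"
  have q: "q > 1" using p by (simp add: q_def)
  have C: "C > 0" using K(1) p q by (auto simp: C_def)
  have window: "(\<Sum>n\<in>{- int N..int N}. window_max N f n powr p * w n)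
     \<le> C * lp_mass p w f" if f: "f \<in> lp_space p w" for f N
  proof -
    have "(\<Sum>n\<in>{- int N..int N}. window_max N f n powr p * w n)
      \<le> C * (\<Sum>n\<in>{- int N..int N}. cmod (f n) powr p * w n)"
      unfolding C_def q_def by (rule window_max_Ap[OF p wpos _ K]) auto
    also have "\<dots> \<le> C * lp_mass p w f"
      using C by (intro mult_left_mono lp_window_le f wpos) auto
    finally show ?thesis .
  qed
  have wm0: "window_max N f n \<ge> 0" if "\<bar>n\<bar> \<le> int N" for f n N
    using that by (intro wmax_nonneg) auto
  have tame: "tame f" if f: "f \<in> lp_space p w" for f
  proof (rule tame_by_window, intro exI allI impI)
    fix n N assume N: "\<bar>n\<bar> \<le> int N"
    let ?x = "window_max N f n"
    have "?x powr p * w n \<le> (\<Sum>n\<in>{- int N..int N}. window_max N f n powr p * w n)"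
      using N by (intro member_le_sum) (auto intro!: mult_nonneg_nonneg less_imp_le[OF wpos])
    also note window[OF f]
    finally have "?x powr p \<le> C * lp_mass p w f / w n"
      using wpos[of n] by (simp add: field_simps)
    then have "(?x powr p) powr (1 / p) \<le> (C * lp_mass p w f / w n) powr (1 / p)"
      using p by (intro powr_mono2) auto
    then show "?x \<le> (C * lp_mass p w f / w n) powr (1 / p)"
      using p wm0[OF N, of f] by (simp add: powr_powr)
  qed
  have "(\<Sum>n\<in>S. hardy_littlewood f n powr p * w n) \<le> C * lp_mass p w f"
    if f: "f \<in> lp_space p w" and S: "finite S" for f S
  proof (rule LIMSEQ_le_const2)
    have ev: "\<forall>\<^sub>F N in sequentially. \<bar>n\<bar> \<le> int N" for n
      unfolding eventually_sequentially by (intro exI[of _ "nat \<bar>n\<bar>"]) auto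
    show "(\<lambda>N. \<Sum>n\<in>S. window_max N f n powr p * w n)
        \<longlonglongrightarrow> (\<Sum>n\<in>S. hardy_littlewood f n powr p * w n)"
      using p by (intro tendsto_sum tendsto_mult_right tendsto_powr' wmax_tendsto_hardy_littlewood tame f tendsto_const)
         (auto intro: eventually_mono[OF ev] wm0)
    have "\<forall>\<^sub>F N in sequentially. \<forall>n\<in>S. \<bar>n\<bar> \<le> int N" by (intro eventually_ball_finite S ballI ev)
    then have "\<forall>\<^sub>F N in sequentially. (\<Sum>n\<in>S. window_max N f n powr p * w n)
        \<le> C * lp_mass p w f"
    proof eventually_elim
      case (elim N)
      have "(\<Sum>n\<in>S. window_max N f n powr p * w n)
        \<le> (\<Sum>n\<in>{- int N..int N}. window_max N f n powr p * w n)"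
        using elim by (intro sum_mono2) (auto intro!: mult_nonneg_nonneg less_imp_le[OF wpos] simp: abs_le_iff)
      also note window[OF f]
      finally show ?case .
    qed
    then show "\<exists>N0. \<forall>N\<ge>N0. (\<Sum>n\<in>S. window_max N f n powr p * w n)
        \<le> C * lp_mass p w f"
      by (simp add: eventually_sequentially)
  qed
  with C tame show ?thesis by (intro that[of C])
qed

text \<open>Levels are strict because a strict lower bound for a supremum is witnessed by one
  interval and hence holds in all large windows; a non-strict one could fail in each of
  them.\<close>

lemma hardy_littlewood_A1:
  assumes w: "w \<in> muckenhoupt_A1"
  obtains C where "C > 0"
    "\<And>f. f \<in> lp_space 1 w \<Longrightarrow> tame f"
    "\<And>f S s. f \<in> lp_space 1 w \<Longrightarrow> finite S \<Longrightarrow> s > 0 \<Longrightarrow> \<forall>n\<in>S. s < hardy_littlewood f n \<Longrightarrow>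
      s * (\<Sum>n\<in>S. w n) \<le> C * lp_mass 1 w f"
proof -
  have wpos: "w k > 0" for k using w by (simp add: muckenhoupt_A1_def)
  obtain K0 where K0: "\<And>m n. m \<le> n \<Longrightarrow> 1 / real_of_int (n - m + 1) * (\<Sum>k=m..n. w k) * (MAX k\<in>{m..n}. inverse (w k)) \<le> K0"
    using w unfolding muckenhoupt_A1_def bdd_above_def by blast
  define K where "K = max K0 1"
  have K: "K > 0" "\<And>m n. m \<le> n \<Longrightarrow> 1 / real_of_int (n - m + 1) * (\<Sum>k=m..n. w k) * (MAX k\<in>{m..n}. inverse (w k)) \<le> K"
    using K0 by (auto simp: K_def le_max_iff_disj)
  define C where "C = 4 * K"
  have C: "C > 0" using K(1) by (simp add: C_def)
  have window: "s * (\<Sum>n\<in>{n\<in>{- int N..int N}. s < window_max N f n}. w n)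
     \<le> C * lp_mass 1 w f" if f: "f \<in> lp_space 1 w" and s: "s > 0" for f N s
  proof -
    have "s * (\<Sum>n\<in>{n\<in>{- int N..int N}. s < window_max N f n}. w n)
      \<le> C * (\<Sum>n\<in>{- int N..int N}. cmod (f n) * w n)"
      unfolding C_def by (rule window_max_A1[OF wpos _ K(1) s K(2)]) auto
    also have "\<dots> = C * (\<Sum>n\<in>{- int N..int N}. cmod (f n) powr 1 * w n)" by simp
    also have "\<dots> \<le> C * lp_mass 1 w f"
      using C by (intro mult_left_mono lp_window_le f wpos) auto
    finally show ?thesis .
  qed
  have tame: "tame f" if f: "f \<in> lp_space 1 w" for f
  proof (rule tame_by_window, intro exI allI impI)
    fix n N assume N: "\<bar>n\<bar> \<le> int N"
    let ?x = "window_max N f n"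
    have F0: "0 \<le> lp_mass 1 w f" by (intro infsum_nonneg) (auto intro!: mult_nonneg_nonneg less_imp_le[OF wpos])
    \<comment> \<open>The point belongs to the strict level set for every \<open>s\<close> below
      \<open>?x\<close>, and the resulting bound survives as \<open>s\<close> increases to
      \<open>?x\<close>.\<close>
    show "?x \<le> C * lp_mass 1 w f / w n"
    proof (rule dense_le)
      fix s assume s: "s < ?x"
      show "s \<le> C * lp_mass 1 w f / w n"
      proof (cases "s > 0")
        case True
        have "s * w n \<le> s * (\<Sum>n\<in>{n\<in>{- int N..int N}. s < window_max N f n}. w n)"
          using N s True by (intro mult_left_mono member_le_sum) (auto intro!: mult_nonneg_nonneg less_imp_le[OF wpos])
        also note window[OF f True]
        finally show ?thesis using wpos[of n] by (simp add: field_simps)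
      next
        case False
        have "0 \<le> C * lp_mass 1 w f / w n"
          using C F0 wpos[of n] by (intro divide_nonneg_nonneg mult_nonneg_nonneg) auto
        then show ?thesis using False by linarith
      qed
    qed
  qed
  have weak: "s * (\<Sum>n\<in>S. w n) \<le> C * lp_mass 1 w f"
    if f: "f \<in> lp_space 1 w" and S: "finite S" and s: "s > 0" and big: "\<forall>n\<in>S. s < hardy_littlewood f n" for f S s
  proof -
    have "\<forall>\<^sub>F N in sequentially. \<forall>n\<in>S. s < window_max N f n"
      by (intro eventually_ball_finite S ballI eventually_wmax_greater) (use big in blast)
    moreover have "\<forall>\<^sub>F N in sequentially. \<forall>n\<in>S. \<bar>n\<bar> \<le> int N"
    proof (intro eventually_ball_finite S ballI)
      fix n :: int
      show "\<forall>\<^sub>F N in sequentially. \<bar>n\<bar> \<le> int N"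
        unfolding eventually_sequentially by (intro exI[of _ "nat \<bar>n\<bar>"]) auto
    qed
    ultimately have "\<forall>\<^sub>F N in sequentially. s * (\<Sum>n\<in>S. w n) \<le> C * lp_mass 1 w f"
    proof eventually_elim
      case (elim N)
      have "s * (\<Sum>n\<in>S. w n) \<le> s * (\<Sum>n\<in>{n\<in>{- int N..int N}. s < window_max N f n}. w n)"
        using elim s by (intro mult_left_mono sum_mono2) (auto intro!: mult_nonneg_nonneg less_imp_le[OF wpos] simp: abs_le_iff)
      also note window[OF f s]
      finally show ?case .
    qed
    then show ?thesis by simp
  qed
  show ?thesis by (rule that[OF C tame weak])
qed

section \<open>Weighted spaces and the extension\<close>

text \<open>An integral version of the diffusion length: rounding up a number that is at least 1 at
  most doubles it.\<close>

lemma heat_kernel_width: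
  assumes t: "t > 0"
  obtains R :: nat where "R \<ge> 1" "sqrt t \<le> real R" "real R \<le> 2 * max 1 (sqrt t)"
proof (rule that[of "nat \<lceil>max 1 (sqrt t)\<rceil>"])
  let ?x = "max 1 (sqrt t)"
  have c: "1 \<le> \<lceil>?x\<rceil>" by (simp add: le_max_iff_disj one_le_ceiling)
  then show "1 \<le> nat \<lceil>?x\<rceil>" by linarith
  have r: "real (nat \<lceil>?x\<rceil>) = real_of_int \<lceil>?x\<rceil>" using c by (intro of_nat_nat) linarith
  have "sqrt t \<le> ?x" "1 \<le> ?x" by (rule max.cobounded2, rule max.cobounded1)
  moreover have "?x \<le> real_of_int \<lceil>?x\<rceil>" "real_of_int \<lceil>?x\<rceil> \<le> ?x + 1"
    by (rule le_of_int_ceiling, rule of_int_ceiling_le_add_one)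
  ultimately show "sqrt t \<le> real (nat \<lceil>?x\<rceil>)" "real (nat \<lceil>?x\<rceil>) \<le> 2 * ?x"
    unfolding r by linarith+
qed

text \<open>Convergence and bound hold for every \<open>tame\<close> sequence, square-summable or
  not; hence the defining series makes sense on the whole weighted space. The constant
  \<open>2 * C\<close> pays for rounding the width.\<close>

lemma dunkl_heat_hardy_littlewood:
  assumes "\<alpha> \<ge> - 1/2" "\<beta> \<ge> - 1/2"
  obtains D where "D > 0"
    "\<And>t f n. t > 0 \<Longrightarrow> tame f \<Longrightarrow> (\<lambda>m. f m * dunkl_heat_kernel \<alpha> \<beta> t n m) summable_on UNIV"
    "\<And>t f n. t > 0 \<Longrightarrow> tame f \<Longrightarrow> cmod (dunkl_heat \<alpha> \<beta> t f n) \<le> D * hardy_littlewood f n"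
proof -
  let ?K = "dunkl_heat_kernel \<alpha> \<beta>"
  obtain C where C: "C > 0"
    and k1: "\<And>t n m. t > 0 \<Longrightarrow> cmod (?K t n m) \<le> C"
    and k2: "\<And>t n m. t > 0 \<Longrightarrow> sqrt t * cmod (?K t n m) \<le> C"
    and k3: "\<And>t n m. t > 0 \<Longrightarrow> (real_of_int (n - m))\<^sup>2 * cmod (?K t n m) \<le> C * sqrt t"
    by (rule dunkl_heat_kernel_bounds[OF assms]) (rule that)
  have fin: "(\<Sum>m\<in>S. cmod (f m) * cmod (?K t n m)) \<le> 24 * (2 * C) * hardy_littlewood f n"
    if t: "t > 0" and f: "tame f" and S: "finite S" for t f n S
  proof -
    obtain R :: nat where R: "R \<ge> 1" "sqrt t \<le> real R" "real R \<le> 2 * max 1 (sqrt t)"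
      using heat_kernel_width[OF t] .
    show ?thesis
    proof (rule kernel_average_bound[OF _ _ R(1) _ _ _ S])
      show "real R * cmod (?K t n m) \<le> 2 * C" for m
      proof -
        have "real R * cmod (?K t n m) \<le> 2 * max 1 (sqrt t) * cmod (?K t n m)"
          using R by (intro mult_right_mono) auto
        also have "\<dots> \<le> 2 * C" using k1[OF t, of n m] k2[OF t, of n m] by (auto simp: max_def)
        finally show ?thesis .
      qed
      show "(real_of_int (n - m))\<^sup>2 * cmod (?K t n m) \<le> 2 * C * real R" for m
      proof -
        have "C * sqrt t \<le> C * real R" using R C by (intro mult_left_mono) auto
        also have "\<dots> \<le> 2 * C * real R" using C by simp
        finally show ?thesis using k3[OF t, of n m] by linarith
      qed
    qed (use C avg_le_hardy_littlewood[OF f] in auto)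
  qed
  have sums: "(\<lambda>m. norm (f m * ?K t n m)) summable_on UNIV" if "t > 0" "tame f" for t f n
  proof (rule nonneg_bounded_partial_sums_imp_summable_on)
    show "\<forall>\<^sub>F S in finite_subsets_at_top UNIV. (\<Sum>m\<in>S. norm (f m * ?K t n m)) \<le> 24 * (2 * C) * hardy_littlewood f n"
      unfolding norm_mult by (intro eventually_finite_subsets_at_top_weakI fin that)
  qed simp
  have "cmod (dunkl_heat \<alpha> \<beta> t f n) \<le> 24 * (2 * C) * hardy_littlewood f n" if "t > 0" "tame f" for t f n
  proof -
    have "cmod (dunkl_heat \<alpha> \<beta> t f n) \<le> (\<Sum>\<^sub>\<infinity>m. norm (f m * ?K t n m))"
      unfolding dunkl_heat_def by (rule norm_infsum_bound) (rule sums[OF that])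
    also have "\<dots> \<le> 24 * (2 * C) * hardy_littlewood f n"
      by (rule infsum_le_finite_sums[OF sums[OF that]]) (unfold norm_mult, rule fin[OF that])
    finally show ?thesis .
  qed
  moreover have "24 * (2 * C) > 0" using C by simp
  ultimately show ?thesis
    using abs_summable_summable[OF sums] by (intro that[of "24 * (2 * C)"])
qed

section \<open>Sublinearity of the maximal heat operator\<close>

context
  fixes \<alpha> \<beta> :: real
  assumes ab: "\<alpha> \<ge> - 1/2" "\<beta> \<ge> - 1/2"
begin

lemma bdd_dunkl_heat: "tame f \<Longrightarrow> bdd_above ((\<lambda>t. cmod (dunkl_heat \<alpha> \<beta> t f n)) ` {0<..})"
proof -
  assume f: "tame f"
  obtain D where D: "\<And>t f n. t > 0 \<Longrightarrow> tame f \<Longrightarrow> cmod (dunkl_heat \<alpha> \<beta> t f n) \<le> D * hardy_littlewood f n"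
    by (rule dunkl_heat_hardy_littlewood[OF ab]) (rule that)
  show ?thesis by (rule bdd_aboveI2[of _ _ "D * hardy_littlewood f n"]) (use D f in auto)
qed

lemma cmod_dunkl_heat_le_max: "tame f \<Longrightarrow> t > 0 \<Longrightarrow> cmod (dunkl_heat \<alpha> \<beta> t f n) \<le> (SUP t\<in>{0<..}. cmod (dunkl_heat \<alpha> \<beta> t f n))"
  by (rule cSUP_upper[OF _ bdd_dunkl_heat]) auto

lemma cmod_dunkl_max: "tame f \<Longrightarrow> cmod (dunkl_max \<alpha> \<beta> f n) = (SUP t\<in>{0<..}. cmod (dunkl_heat \<alpha> \<beta> t f n))"
  using order_trans[OF norm_ge_zero cmod_dunkl_heat_le_max[of f 1 n]] by (simp add: dunkl_max_def)

lemma cmod_dunkl_max_le: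
  assumes "tame f" "\<And>t. t > 0 \<Longrightarrow> cmod (dunkl_heat \<alpha> \<beta> t f n) \<le> B"
  shows "cmod (dunkl_max \<alpha> \<beta> f n) \<le> B"
  unfolding cmod_dunkl_max[OF assms(1)] by (rule cSUP_least) (use assms in auto)

lemma dunkl_heat_add:
  assumes "tame f" "tame g" "t > 0"
  shows "dunkl_heat \<alpha> \<beta> t (\<lambda>m. f m + g m) n = dunkl_heat \<alpha> \<beta> t f n + dunkl_heat \<alpha> \<beta> t g n"
proof -
  have "(\<lambda>m. f m * dunkl_heat_kernel \<alpha> \<beta> t n m) summable_on UNIV" if "tame f" for f
    by (rule dunkl_heat_hardy_littlewood[OF ab]) (use that assms in blast)
  then show ?thesis using assms by (simp add: dunkl_heat_def distrib_right infsum_add)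
qed

lemma dunkl_heat_cmult: "dunkl_heat \<alpha> \<beta> t (\<lambda>m. c * f m) n = c * dunkl_heat \<alpha> \<beta> t f n"
  by (simp add: dunkl_heat_def mult.assoc infsum_cmult_right')

lemma dunkl_max_triangle:
  assumes f: "tame f" and g: "tame g" and fg: "tame (\<lambda>m. f m + g m)"
  shows "cmod (dunkl_max \<alpha> \<beta> (\<lambda>m. f m + g m) n) \<le> cmod (dunkl_max \<alpha> \<beta> f n) + cmod (dunkl_max \<alpha> \<beta> g n)"
proof (rule cmod_dunkl_max_le[OF fg])
  let ?T = "dunkl_max \<alpha> \<beta>"
  fix t :: real assume t: "t > 0"
  have "cmod (dunkl_heat \<alpha> \<beta> t (\<lambda>m. f m + g m) n) \<le> cmod (dunkl_heat \<alpha> \<beta> t f n) + cmod (dunkl_heat \<alpha> \<beta> t g n)"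
    unfolding dunkl_heat_add[OF f g t] by (rule norm_triangle_ineq)
  also have "\<dots> \<le> cmod (?T f n) + cmod (?T g n)"
    unfolding cmod_dunkl_max[OF f] cmod_dunkl_max[OF g] by (intro add_mono cmod_dunkl_heat_le_max f g t)
  finally show "cmod (dunkl_heat \<alpha> \<beta> t (\<lambda>m. f m + g m) n) \<le> cmod (?T f n) + cmod (?T g n)" .
qed

lemma dunkl_max_cmult:
  assumes f: "tame f" and cf: "tame (\<lambda>m. c * f m)"
  shows "cmod (dunkl_max \<alpha> \<beta> (\<lambda>m. c * f m) n) = cmod c * cmod (dunkl_max \<alpha> \<beta> f n)"
proof (rule antisym)
  let ?T = "dunkl_max \<alpha> \<beta>"
  show "cmod (?T (\<lambda>m. c * f m) n) \<le> cmod c * cmod (?T f n)"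
    unfolding cmod_dunkl_max[OF f]
    by (intro cmod_dunkl_max_le[OF cf]) (simp add: dunkl_heat_cmult norm_mult mult_left_mono cmod_dunkl_heat_le_max[OF f])
  show "cmod c * cmod (?T f n) \<le> cmod (?T (\<lambda>m. c * f m) n)"
  proof (cases "c = 0")
    case False
    have "cmod (?T f n) \<le> cmod (?T (\<lambda>m. c * f m) n) / cmod c"
    proof (rule cmod_dunkl_max_le[OF f])
      fix t :: real assume "t > 0"
      then have "cmod (dunkl_heat \<alpha> \<beta> t (\<lambda>m. c * f m) n) \<le> cmod (?T (\<lambda>m. c * f m) n)"
        unfolding cmod_dunkl_max[OF cf] by (rule cmod_dunkl_heat_le_max[OF cf])
      then show "cmod (dunkl_heat \<alpha> \<beta> t f n) \<le> cmod (?T (\<lambda>m. c * f m) n) / cmod c"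
        using False by (simp add: dunkl_heat_cmult norm_mult field_simps)
    qed
    then show ?thesis using False by (simp add: field_simps)
  qed simp
qed

text \<open>Sublinearity in both directions bounds the difference of the moduli. The values are
  nonnegative reals embedded in the complex numbers, so this is also the modulus of the
  difference.\<close>

lemma dunkl_max_diff:
  assumes f: "tame f" and g: "tame g" and d: "tame (\<lambda>m. g m - f m)"
  shows "cmod (dunkl_max \<alpha> \<beta> g n - dunkl_max \<alpha> \<beta> f n) \<le> cmod (dunkl_max \<alpha> \<beta> (\<lambda>m. g m - f m) n)"
proof -
  let ?T = "dunkl_max \<alpha> \<beta>"
  have re: "?T h n = of_real (cmod (?T h n))" if "tame h" for h
    by (subst cmod_dunkl_max[OF that]) (rule dunkl_max_def)
  have mf: "tame (\<lambda>m. f m - g m)" and neg: "(\<lambda>m. f m - g m) = (\<lambda>m. - 1 * (g m - f m))"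
    using d by (auto simp: tame_def avg_set_def norm_minus_commute)
  have "cmod (?T g n) \<le> cmod (?T f n) + cmod (?T (\<lambda>m. g m - f m) n)"
    using dunkl_max_triangle[OF f d, of n] g by simp
  moreover have "cmod (?T f n) \<le> cmod (?T g n) + cmod (?T (\<lambda>m. f m - g m) n)"
    using dunkl_max_triangle[OF g mf, of n] f by simp
  moreover have "cmod (?T (\<lambda>m. f m - g m) n) = cmod (?T (\<lambda>m. g m - f m) n)"
    using dunkl_max_cmult[OF d, of "- 1" n] mf unfolding neg by simp
  ultimately have "\<bar>cmod (?T g n) - cmod (?T f n)\<bar> \<le> cmod (?T (\<lambda>m. g m - f m) n)" by linarith
  moreover have "cmod (?T g n - ?T f n) = \<bar>cmod (?T g n) - cmod (?T f n)\<bar>"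
    by (subst re[OF f], subst re[OF g]) (simp flip: of_real_diff del: of_real_diff)
  ultimately show ?thesis by simp
qed

end

section \<open>A criterion for unique extension\<close>

text \<open>No triangle inequality is asked of \<open>NY\<close>, as weak l^1 has only a quasi-norm.
  Uniqueness is argued coordinatewise instead: \<open>coord\<close> makes coordinates continuous on
  \<open>Y\<close>, and two continuous extensions agreeing on the dense set \<open>D\<close> agree
  at each coordinate. Continuity of \<open>T\<close> itself comes from \<open>Tdiff\<close> and
  \<open>solid\<close>.\<close>

lemma extends_uniquelyI:
  assumes DX: "D \<subseteq> X" and TY: "\<And>f. f \<in> X \<Longrightarrow> T f \<in> Y"
    and NX0: "\<And>f. f \<in> X \<Longrightarrow> NX f \<ge> 0"
    and bound: "\<And>f. f \<in> X \<Longrightarrow> NY (T f) \<le> C * NX f"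
    and dens: "\<And>f \<epsilon>. f \<in> X \<Longrightarrow> \<epsilon> > 0 \<Longrightarrow> \<exists>g\<in>D. NX (\<lambda>m. g m - f m) < \<epsilon>"
    and Xdiff: "\<And>f g. f \<in> X \<Longrightarrow> g \<in> X \<Longrightarrow> (\<lambda>m. g m - f m) \<in> X"
    and Tdiff: "\<And>f g n. f \<in> X \<Longrightarrow> g \<in> X \<Longrightarrow> cmod (T g n - T f n) \<le> cmod (T (\<lambda>m. g m - f m) n)"
    and solid: "\<And>h h'. h \<in> Y \<Longrightarrow> (\<And>n. cmod (h' n) \<le> cmod (h n)) \<Longrightarrow> NY h' \<le> NY h"
    and Ydiff: "\<And>h h'. h \<in> Y \<Longrightarrow> h' \<in> Y \<Longrightarrow> (\<lambda>m. h m - h' m) \<in> Y"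
    and coord: "\<And>n. \<exists>c\<ge>0. \<forall>h\<in>Y. cmod (h n) \<le> c * NY h"
    and sub: "sublinear_on X T"
  shows "extends_uniquely D T X NX Y NY"
  unfolding extends_uniquely_def
proof (intro exI conjI allI impI ballI)
  show "sublinear_on X T" by (rule sub)
  show bext: "bounded_extension D T X NX Y NY T"
    unfolding bounded_extension_def
  proof (intro conjI ballI allI impI)
    show "T \<in> X \<rightarrow> Y" using TY by auto
    show "\<exists>C. \<forall>f\<in>X. NY (T f) \<le> C * NX f" using bound by blast
    fix f and \<epsilon> :: real assume f: "f \<in> X" and e: "\<epsilon> > 0"
    \<comment> \<open>The sign of \<open>C\<close> is unknown; \<open>|C| + 1\<close> is positive
      and dominates it.\<close>
    show "\<exists>\<delta>>0. \<forall>g\<in>X. NX (\<lambda>m. g m - f m) < \<delta> \<longrightarrow> NY (\<lambda>m. T g m - T f m) < \<epsilon>"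
    proof (intro exI[of _ "\<epsilon> / (\<bar>C\<bar> + 1)"] conjI ballI impI)
      fix g assume g: "g \<in> X" and lt: "NX (\<lambda>m. g m - f m) < \<epsilon> / (\<bar>C\<bar> + 1)"
      have d: "(\<lambda>m. g m - f m) \<in> X" by (rule Xdiff[OF f g])
      have "NY (\<lambda>m. T g m - T f m) \<le> NY (T (\<lambda>m. g m - f m))"
        by (rule solid[OF TY[OF d]]) (rule Tdiff[OF f g])
      also have "\<dots> \<le> C * NX (\<lambda>m. g m - f m)" by (rule bound[OF d])
      also have "\<dots> \<le> (\<bar>C\<bar> + 1) * NX (\<lambda>m. g m - f m)" using NX0[OF d] by (intro mult_right_mono) auto
      also have "\<dots> < \<epsilon>" using lt by (simp add: field_simps)
      finally show "NY (\<lambda>m. T g m - T f m) < \<epsilon>" .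
    qed (use e in auto)
  qed auto
  fix T' f assume T': "bounded_extension D T X NX Y NY T'" and f: "f \<in> X"
  have T'Y: "T' h \<in> Y" if "h \<in> X" for h using T' that by (auto simp: bounded_extension_def)
  show "T' f = T f"
  proof (rule ext, rule ccontr)
    fix n assume ne: "T' f n \<noteq> T f n"
    obtain c where c: "c \<ge> 0" "\<And>h. h \<in> Y \<Longrightarrow> cmod (h n) \<le> c * NY h" using coord[of n] by blast
    define d where "d = cmod (T' f n - T f n)"
    have d: "d > 0" using ne by (simp add: d_def)
    \<comment> \<open>Each of the two approximations costs at most \<open>c * e\<close>, and
      \<open>2 * c * e < d\<close> gives the contradiction.\<close>
    define e where "e = d / (2 * (c + 1))"
    have e: "e > 0" using d c by (simp add: e_def)
    have cont: "\<exists>\<delta>>0. \<forall>g\<in>X. NX (\<lambda>m. g m - f m) < \<delta> \<longrightarrow> NY (\<lambda>m. S g m - S f m) < e"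
      if "bounded_extension D T X NX Y NY S" for S
      using that f e unfolding bounded_extension_def by blast
    obtain \<delta>1 where d1: "\<delta>1 > 0" "\<And>g. g \<in> X \<Longrightarrow> NX (\<lambda>m. g m - f m) < \<delta>1 \<Longrightarrow> NY (\<lambda>m. T' g m - T' f m) < e"
      using cont[OF T'] by blast
    obtain \<delta>2 where d2: "\<delta>2 > 0" "\<And>g. g \<in> X \<Longrightarrow> NX (\<lambda>m. g m - f m) < \<delta>2 \<Longrightarrow> NY (\<lambda>m. T g m - T f m) < e"
      using cont[OF bext] by blast
    obtain g where g: "g \<in> D" "NX (\<lambda>m. g m - f m) < min \<delta>1 \<delta>2" using dens[OF f, of "min \<delta>1 \<delta>2"] d1 d2 by auto
    have gX: "g \<in> X" using g DX by auto
    have eq: "T' g = T g" using T' g by (auto simp: bounded_extension_def)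
    have "cmod (T' g n - T' f n) \<le> c * NY (\<lambda>m. T' g m - T' f m)"
      using c(2)[OF Ydiff[OF T'Y[OF gX] T'Y[OF f]]] by simp
    also have "\<dots> \<le> c * e" using d1(2)[OF gX] g c by (intro mult_left_mono) auto
    finally have 1: "cmod (T' g n - T' f n) \<le> c * e" .
    have "cmod (T g n - T f n) \<le> c * NY (\<lambda>m. T g m - T f m)"
      using c(2)[OF Ydiff[OF TY[OF gX] TY[OF f]]] by simp
    also have "\<dots> \<le> c * e" using d2(2)[OF gX] g c by (intro mult_left_mono) auto
    finally have 2: "cmod (T g n - T f n) \<le> c * e" .
    have "d = cmod ((T g n - T f n) - (T' g n - T' f n))" by (simp add: d_def eq)
    also have "\<dots> \<le> c * e + c * e" using norm_triangle_ineq4[of "T g n - T f n" "T' g n - T' f n"] 1 2 by linarith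
    also have "\<dots> < 2 * (c + 1) * e" using e by (simp add: algebra_simps)
    also have "\<dots> = d" using c by (simp add: e_def)
    finally show False by simp
  qed
qed

section \<open>Weighted l^p spaces\<close>

context
  fixes p :: real and w :: "int \<Rightarrow> real"
  assumes p: "1 \<le> p" and w: "\<And>n. w n > 0"
begin

lemma lp_term_nonneg: "cmod (f n) powr p * w n \<ge> 0"
  using w[of n] by simp

lemma lp_spaceI:
  assumes "\<And>S. finite S \<Longrightarrow> (\<Sum>n\<in>S. cmod (f n) powr p * w n) \<le> B"
  shows "f \<in> lp_space p w" "lp_mass p w f \<le> B"
proof -
  have s: "(\<lambda>n. cmod (f n) powr p * w n) summable_on UNIV"
    by (rule nonneg_bounded_partial_sums_imp_summable_on[of _ _ B])
       (use assms lp_term_nonneg in \<open>auto intro!: eventually_finite_subsets_at_top_weakI\<close>)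
  then show "f \<in> lp_space p w" by (simp add: lp_space_def)
  show "lp_mass p w f \<le> B" by (rule infsum_le_finite_sums[OF s]) (rule assms)
qed

lemma lp_sum_nonneg: "lp_mass p w f \<ge> 0"
  by (intro infsum_nonneg lp_term_nonneg)

lemma lp_sum_le: "f \<in> lp_space p w \<Longrightarrow> finite S \<Longrightarrow> (\<Sum>n\<in>S. cmod (f n) powr p * w n) \<le> lp_mass p w f"
  by (rule lp_window_le[OF _ w])

text \<open>The crude bound \<open>(x + y)^p \<le> 2^p * max x y ^ p\<close> suffices for
  membership; this form covers sums and differences alike.\<close>

lemma lp_space_combination:
  assumes f: "f \<in> lp_space p w" and g: "g \<in> lp_space p w" and h: "\<And>n. cmod (h n) \<le> cmod (f n) + cmod (g n)"
  shows "h \<in> lp_space p w"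
proof (rule lp_spaceI(1))
  fix S :: "int set" assume S: "finite S"
  have pw: "cmod (h n) powr p \<le> 2 powr p * (cmod (f n) powr p + cmod (g n) powr p)" for n
  proof -
    have "cmod (h n) powr p \<le> (2 * max (cmod (f n)) (cmod (g n))) powr p"
      using h[of n] p by (intro powr_mono2) auto
    also have "\<dots> = 2 powr p * max (cmod (f n)) (cmod (g n)) powr p" by (simp add: powr_mult)
    also have "\<dots> \<le> 2 powr p * (cmod (f n) powr p + cmod (g n) powr p)"
      by (intro mult_left_mono) (auto simp: max_def)
    finally show ?thesis .
  qed
  have "(\<Sum>n\<in>S. cmod (h n) powr p * w n) \<le> (\<Sum>n\<in>S. 2 powr p * (cmod (f n) powr p + cmod (g n) powr p) * w n)"
    by (intro sum_mono mult_right_mono pw less_imp_le[OF w])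
  also have "\<dots> = 2 powr p * ((\<Sum>n\<in>S. cmod (f n) powr p * w n) + (\<Sum>n\<in>S. cmod (g n) powr p * w n))"
    by (simp add: sum_distrib_left distrib_left distrib_right sum.distrib mult.assoc)
  also have "\<dots> \<le> 2 powr p * (lp_mass p w f + lp_mass p w g)"
    by (intro mult_left_mono add_mono lp_sum_le f g S) auto
  finally show "(\<Sum>n\<in>S. cmod (h n) powr p * w n)
    \<le> 2 powr p * (lp_mass p w f + lp_mass p w g)" .
qed

lemma lp_space_cmult:
  assumes f: "f \<in> lp_space p w"
  shows "(\<lambda>m. c * f m) \<in> lp_space p w"
proof (rule lp_spaceI(1))
  fix S :: "int set" assume S: "finite S"
  have "(\<Sum>n\<in>S. cmod (c * f n) powr p * w n) = cmod c powr p * (\<Sum>n\<in>S. cmod (f n) powr p * w n)"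
    by (simp add: norm_mult powr_mult sum_distrib_left mult.assoc)
  also have "\<dots> \<le> cmod c powr p * lp_mass p w f"
    by (intro mult_left_mono lp_sum_le f S) auto
  finally show "(\<Sum>n\<in>S. cmod (c * f n) powr p * w n) \<le> cmod c powr p * lp_mass p w f" .
qed

lemma lp_norm_nonneg: "lp_norm p w f \<ge> 0"
  by (simp add: lp_norm_def)

lemma lp_norm_mono:
  assumes h: "h \<in> lp_space p w" and le: "\<And>n. cmod (h' n) \<le> cmod (h n)"
  shows "lp_norm p w h' \<le> lp_norm p w h"
proof -
  have "(\<Sum>n\<in>S. cmod (h' n) powr p * w n) \<le> lp_mass p w h" if "finite S" for S
  proof -
    have "(\<Sum>n\<in>S. cmod (h' n) powr p * w n) \<le> (\<Sum>n\<in>S. cmod (h n) powr p * w n)"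
      using p le by (intro sum_mono mult_right_mono powr_mono2 less_imp_le[OF w]) auto
    also have "\<dots> \<le> lp_mass p w h" by (rule lp_sum_le[OF h that])
    finally show ?thesis .
  qed
  then show ?thesis unfolding lp_norm_def
    using p by (intro powr_mono2 lp_spaceI(2) lp_sum_nonneg) auto
qed

lemma lp_norm_coordinate: "\<exists>c\<ge>0. \<forall>h\<in>lp_space p w. cmod (h n) \<le> c * lp_norm p w h"
proof (intro exI[of _ "(1 / w n) powr (1 / p)"] conjI ballI)
  fix h assume h: "h \<in> lp_space p w"
  have "cmod (h n) powr p * w n \<le> lp_mass p w h" using lp_sum_le[OF h, of "{n}"] by simp
  then have "cmod (h n) powr p \<le> 1 / w n * lp_mass p w h" using w[of n] by (simp add: field_simps)
  then have "(cmod (h n) powr p) powr (1 / p) \<le> (1 / w n * lp_mass p w h) powr (1 / p)"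
    using p by (intro powr_mono2) auto
  then show "cmod (h n) \<le> (1 / w n) powr (1 / p) * lp_norm p w h"
    using p unfolding lp_norm_def powr_mult by (simp add: powr_powr)
qed auto

text \<open>Truncation to a large finite set leaves a small tail, and a finitely supported sequence
  lies in every weighted space, in particular in l^2.\<close>

lemma lp_finite_support_dense:
  assumes f: "f \<in> lp_space p w" and e: "\<epsilon> > 0"
  shows "\<exists>g \<in> l2_space \<inter> lp_space p w. lp_norm p w (\<lambda>m. g m - f m) < \<epsilon>"
proof -
  let ?F = "\<lambda>n. cmod (f n) powr p * w n"
  have s: "?F summable_on UNIV" using f by (simp add: lp_space_def)
  have ep: "\<epsilon> powr p > 0" using e by simp
  have "(sum ?F \<longlongrightarrow> infsum ?F UNIV) (finite_subsets_at_top UNIV)"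
    using has_sum_infsum[OF s] by (simp add: has_sum_def)
  then have "\<forall>\<^sub>F S in finite_subsets_at_top UNIV. infsum ?F UNIV - \<epsilon> powr p < sum ?F S"
    by (rule order_tendstoD(1)) (use ep in simp)
  then obtain S where S: "finite S" "infsum ?F UNIV - \<epsilon> powr p < sum ?F S"
    unfolding eventually_finite_subsets_at_top by blast
  define g where "g n = (if n \<in> S then f n else 0)" for n
  have gl: "g \<in> lp_space r v" for r v
    unfolding lp_space_def mem_Collect_eq
    by (rule summable_on_cong_neutral[THEN iffD1, OF _ _ _ summable_on_finite[OF S(1)]]) (auto simp: g_def)
  have "(\<Sum>\<^sub>\<infinity>n. cmod (g n - f n) powr p * w n) = infsum ?F (- S)"
    by (rule infsum_cong_neutral) (auto simp: g_def)
  also have "\<dots> = infsum ?F UNIV - infsum ?F S"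
    unfolding Compl_eq_Diff_UNIV by (rule infsum_Diff[OF s summable_on_finite[OF S(1)]]) simp
  also have "\<dots> < \<epsilon> powr p" using S by simp
  finally have "lp_norm p w (\<lambda>m. g m - f m) < (\<epsilon> powr p) powr (1 / p)"
    unfolding lp_norm_def using p by (intro powr_less_mono2 lp_sum_nonneg) auto
  also have "\<dots> = \<epsilon>" using p e by (simp add: powr_powr)
  finally show ?thesis using gl by blast
qed

end

section \<open>Weighted weak l^1\<close>

context
  fixes w :: "int \<Rightarrow> real"
  assumes w: "\<And>n. w n > 0"
begin

text \<open>Finite subsets of strict level sets determine the weak norm, so later estimates can work
  with finite sums; \<open>weak_l1_norm_ge\<close> is the converse.\<close>

lemma weak_l1I:
  assumes "\<And>s S. s > 0 \<Longrightarrow> finite S \<Longrightarrow> (\<And>n. n \<in> S \<Longrightarrow> s < cmod (h n)) \<Longrightarrow> s * (\<Sum>n\<in>S. w n) \<le> B"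
  shows "h \<in> weak_l1_space w" "weak_l1_norm w h \<le> B"
proof -
  have fin: "(\<Sum>n\<in>S. w n) \<le> B / s" if "s > 0" "finite S" "S \<subseteq> {m. s < cmod (h m)}" for s S
    using assms[of s S] that by (auto simp: field_simps)
  have s: "w summable_on {m. s < cmod (h m)}" if "s > 0" for s
    by (rule nonneg_bounded_partial_sums_imp_summable_on[of _ _ "B / s"])
       (use fin[OF that] less_imp_le[OF w] in \<open>auto intro!: eventually_finite_subsets_at_top_weakI\<close>)
  have le: "s * (\<Sum>\<^sub>\<infinity>m\<in>{m. s < cmod (h m)}. w m) \<le> B" if "s > 0" for s
  proof -
    have "(\<Sum>\<^sub>\<infinity>m\<in>{m. s < cmod (h m)}. w m) \<le> B / s"
      by (rule infsum_le_finite_sums[OF s[OF that]]) (rule fin[OF that])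
    then show ?thesis using that by (simp add: field_simps)
  qed
  show "h \<in> weak_l1_space w" using s le by (auto simp: weak_l1_space_def intro!: bdd_aboveI2)
  show "weak_l1_norm w h \<le> B" unfolding weak_l1_norm_def by (rule cSUP_least) (use le in auto)
qed

lemma weak_l1_norm_ge:
  assumes h: "h \<in> weak_l1_space w" and s: "s > 0" and S: "finite S" "\<And>n. n \<in> S \<Longrightarrow> s < cmod (h n)"
  shows "s * (\<Sum>n\<in>S. w n) \<le> weak_l1_norm w h"
proof -
  have "(\<Sum>n\<in>S. w n) \<le> (\<Sum>\<^sub>\<infinity>m\<in>{m. s < cmod (h m)}. w m)"
    using h s S by (intro finite_sum_le_infsum) (auto simp: weak_l1_space_def less_imp_le[OF w])
  then have "s * (\<Sum>n\<in>S. w n) \<le> s * (\<Sum>\<^sub>\<infinity>m\<in>{m. s < cmod (h m)}. w m)" using s by simp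
  also have "\<dots> \<le> weak_l1_norm w h"
    unfolding weak_l1_norm_def using h s by (intro cSUP_upper) (auto simp: weak_l1_space_def)
  finally show ?thesis .
qed

lemma weak_l1_norm_mono:
  assumes h: "h \<in> weak_l1_space w" and le: "\<And>n. cmod (h' n) \<le> cmod (h n)"
  shows "weak_l1_norm w h' \<le> weak_l1_norm w h"
  by (rule weak_l1I(2)) (use weak_l1_norm_ge[OF h] le in \<open>meson less_le_trans\<close>)

text \<open>Where the difference exceeds \<open>s\<close>, one of the sequences exceeds
  \<open>s / 2\<close>; this is the quasi-triangle inequality with factor 2.\<close>

lemma weak_l1_diff:
  assumes h: "h \<in> weak_l1_space w" and h': "h' \<in> weak_l1_space w"
  shows "(\<lambda>m. h m - h' m) \<in> weak_l1_space w"
proof (rule weak_l1I(1))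
  fix s :: real and S :: "int set"
  assume s: "s > 0" and S: "finite S" and big: "\<And>n. n \<in> S \<Longrightarrow> s < cmod (h n - h' n)"
  let ?A = "{n\<in>S. s / 2 < cmod (h n)}" and ?B = "{n\<in>S. s / 2 < cmod (h' n)}"
  have "S \<subseteq> ?A \<union> ?B"
  proof
    fix n assume n: "n \<in> S"
    have "s < cmod (h n) + cmod (h' n)" using big[OF n] norm_triangle_ineq4[of "h n" "h' n"] by linarith
    then show "n \<in> ?A \<union> ?B" using n by auto
  qed
  then have "sum w S \<le> sum w (?A \<union> ?B)" using S by (intro sum_mono2) (auto intro: less_imp_le[OF w])
  also have "\<dots> \<le> sum w ?A + sum w ?B"
    using sum.union_inter[of ?A ?B w] sum_nonneg[of "?A \<inter> ?B" w] S less_imp_le[OF w] by force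
  finally have "s / 2 * sum w S \<le> s / 2 * (sum w ?A + sum w ?B)" using s by simp
  also have "\<dots> \<le> weak_l1_norm w h + weak_l1_norm w h'"
    unfolding distrib_left using s S by (intro add_mono weak_l1_norm_ge h h') auto
  finally show "s * sum w S \<le> 2 * (weak_l1_norm w h + weak_l1_norm w h')" by simp
qed

text \<open>The singleton of \<open>n\<close> serves as test set, at every positive level below the
  modulus of \<open>h n\<close>.\<close>

lemma weak_l1_coordinate: "\<exists>c\<ge>0. \<forall>h\<in>weak_l1_space w. cmod (h n) \<le> c * weak_l1_norm w h"
proof (intro exI[of _ "1 / w n"] conjI ballI)
  show "0 \<le> 1 / w n" using w[of n] by simp
  fix h assume h: "h \<in> weak_l1_space w"
  have N0: "0 \<le> weak_l1_norm w h" using weak_l1_norm_ge[OF h, of 1 "{}"] by simp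
  show "cmod (h n) \<le> 1 / w n * weak_l1_norm w h"
  proof (rule dense_le)
    fix s assume s: "s < cmod (h n)"
    show "s \<le> 1 / w n * weak_l1_norm w h"
    proof (cases "s > 0")
      case True
      then show ?thesis using weak_l1_norm_ge[OF h True, of "{n}"] s w[of n] by (simp add: field_simps)
    next
      case False
      moreover have "0 \<le> 1 / w n * weak_l1_norm w h" using N0 w[of n] by simp
      ultimately show ?thesis by linarith
    qed
  qed
qed

end

section \<open>Weighted bounds for the maximal heat operator\<close>

lemma sublinear_dunkl_max:
  assumes ab: "\<alpha> \<ge> - 1/2" "\<beta> \<ge> - 1/2" and p: "1 \<le> p" and w: "\<And>n. w n > 0"
    and tame: "\<And>f. f \<in> lp_space p w \<Longrightarrow> tame f"
  shows "sublinear_on (lp_space p w) (dunkl_max \<alpha> \<beta>)"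
  unfolding sublinear_on_def
proof (intro conjI ballI allI)
  fix f g n assume f: "f \<in> lp_space p w" and g: "g \<in> lp_space p w"
  have "(\<lambda>m. f m + g m) \<in> lp_space p w" by (rule lp_space_combination[OF p w f g]) (rule norm_triangle_ineq)
  then show "cmod (dunkl_max \<alpha> \<beta> (\<lambda>m. f m + g m) n) \<le> cmod (dunkl_max \<alpha> \<beta> f n) + cmod (dunkl_max \<alpha> \<beta> g n)"
    by (intro dunkl_max_triangle ab tame f g)
next
  fix f c n assume f: "f \<in> lp_space p w"
  then show "cmod (dunkl_max \<alpha> \<beta> (\<lambda>m. c * f m) n) = cmod c * cmod (dunkl_max \<alpha> \<beta> f n)"
    by (intro dunkl_max_cmult ab tame lp_space_cmult p w f)
qed

lemma lp_space_diff:
  assumes p: "1 \<le> p" and w: "\<And>n. w n > 0" and "f \<in> lp_space p w" "g \<in> lp_space p w"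
  shows "(\<lambda>m. g m - f m) \<in> lp_space p w"
  by (rule lp_space_combination[OF p w assms(4,3)]) (rule norm_triangle_ineq4)

lemma dunkl_max_strong_type:
  assumes ab: "\<alpha> \<ge> - 1/2" "\<beta> \<ge> - 1/2" and p: "1 < p" and w: "w \<in> muckenhoupt_Ap p"
  obtains C where "\<And>f. f \<in> lp_space p w \<Longrightarrow> tame f"
    "\<And>f. f \<in> lp_space p w \<Longrightarrow> dunkl_max \<alpha> \<beta> f \<in> lp_space p w"
    "\<And>f. f \<in> lp_space p w \<Longrightarrow> lp_norm p w (dunkl_max \<alpha> \<beta> f) \<le> C * lp_norm p w f"
proof -
  let ?T = "dunkl_max \<alpha> \<beta>"
  have wpos: "w k > 0" for k using w by (simp add: muckenhoupt_Ap_def)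
  have p1: "1 \<le> p" using p by simp
  obtain C where C: "C > 0" and tame: "\<And>f. f \<in> lp_space p w \<Longrightarrow> tame f"
    and hl: "\<And>f S. f \<in> lp_space p w \<Longrightarrow> finite S \<Longrightarrow>
      (\<Sum>n\<in>S. hardy_littlewood f n powr p * w n) \<le> C * lp_mass p w f"
    by (rule hardy_littlewood_Ap[OF p w]) (rule that)
  obtain D where D: "D > 0"
    and heat: "\<And>t f n. t > 0 \<Longrightarrow> tame f \<Longrightarrow> cmod (dunkl_heat \<alpha> \<beta> t f n) \<le> D * hardy_littlewood f n"
    by (rule dunkl_heat_hardy_littlewood[OF ab]) (rule that)
  have fin: "(\<Sum>n\<in>S. cmod (?T f n) powr p * w n) \<le> D powr p * C * lp_mass p w f"
    if f: "f \<in> lp_space p w" and S: "finite S" for f S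
  proof -
    have "(\<Sum>n\<in>S. cmod (?T f n) powr p * w n) \<le> (\<Sum>n\<in>S. (D * hardy_littlewood f n) powr p * w n)"
      using p by (intro sum_mono mult_right_mono powr_mono2 less_imp_le[OF wpos] cmod_dunkl_max_le ab tame f heat) auto
    also have "\<dots> = D powr p * (\<Sum>n\<in>S. hardy_littlewood f n powr p * w n)"
      by (simp add: powr_mult sum_distrib_left mult.assoc)
    also have "\<dots> \<le> D powr p * (C * lp_mass p w f)"
      by (intro mult_left_mono hl f S) auto
    finally show ?thesis by (simp add: mult.assoc)
  qed
  show ?thesis
  proof (rule that[of "(D powr p * C) powr (1 / p)"])
    fix f assume f: "f \<in> lp_space p w"
    show "tame f" by (rule tame[OF f])
    show "?T f \<in> lp_space p w" by (rule lp_spaceI(1)[OF p1 wpos fin[OF f]])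
    have "lp_mass p w (?T f) powr (1 / p)
       \<le> (D powr p * C * lp_mass p w f) powr (1 / p)"
      using p by (intro powr_mono2 lp_spaceI(2)[OF p1 wpos fin[OF f]] lp_sum_nonneg[OF p1 wpos]) auto
    then show "lp_norm p w (?T f) \<le> (D powr p * C) powr (1 / p) * lp_norm p w f"
      unfolding lp_norm_def by (simp only: powr_mult)
  qed
qed

text \<open>Pointwise domination puts a level set at \<open>s\<close> inside the one of the
  Hardy-Littlewood function at \<open>s / D\<close>. For exponent 1 the norm is the mass
  itself.\<close>

lemma dunkl_max_weak_type:
  assumes ab: "\<alpha> \<ge> - 1/2" "\<beta> \<ge> - 1/2" and w: "w \<in> muckenhoupt_A1"
  obtains C where "\<And>f. f \<in> lp_space 1 w \<Longrightarrow> tame f"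
    "\<And>f. f \<in> lp_space 1 w \<Longrightarrow> dunkl_max \<alpha> \<beta> f \<in> weak_l1_space w"
    "\<And>f. f \<in> lp_space 1 w \<Longrightarrow> weak_l1_norm w (dunkl_max \<alpha> \<beta> f) \<le> C * lp_norm 1 w f"
proof -
  let ?T = "dunkl_max \<alpha> \<beta>"
  have wpos: "w k > 0" for k using w by (simp add: muckenhoupt_A1_def)
  obtain C where C: "C > 0" and tame: "\<And>f. f \<in> lp_space 1 w \<Longrightarrow> tame f"
    and hl: "\<And>f S s. f \<in> lp_space 1 w \<Longrightarrow> finite S \<Longrightarrow> s > 0 \<Longrightarrow> \<forall>n\<in>S. s < hardy_littlewood f n \<Longrightarrow>
      s * (\<Sum>n\<in>S. w n) \<le> C * lp_mass 1 w f"
    by (rule hardy_littlewood_A1[OF w]) (rule that)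
  obtain D where D: "D > 0"
    and heat: "\<And>t f n. t > 0 \<Longrightarrow> tame f \<Longrightarrow> cmod (dunkl_heat \<alpha> \<beta> t f n) \<le> D * hardy_littlewood f n"
    by (rule dunkl_heat_hardy_littlewood[OF ab]) (rule that)
  have fin: "s * (\<Sum>n\<in>S. w n) \<le> D * C * lp_norm 1 w f"
    if f: "f \<in> lp_space 1 w" and s: "s > 0" and S: "finite S" and big: "\<And>n. n \<in> S \<Longrightarrow> s < cmod (?T f n)" for f s S
  proof -
    have "s / D < hardy_littlewood f n" if "n \<in> S" for n
    proof -
      have "cmod (?T f n) \<le> D * hardy_littlewood f n"
        by (intro cmod_dunkl_max_le ab tame f heat)
      then show ?thesis using big[OF that] D by (simp add: field_simps)
    qed
    then have "s / D * (\<Sum>n\<in>S. w n) \<le> C * lp_mass 1 w f"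
      using s D by (intro hl f S) auto
    moreover have "lp_norm 1 w f = lp_mass 1 w f"
      using lp_sum_nonneg[of 1 w f, OF _ wpos] by (simp add: lp_norm_def)
    ultimately show ?thesis using D by (simp add: field_simps)
  qed
  show ?thesis
    by (rule that[OF tame weak_l1I(1)[OF wpos fin] weak_l1I(2)[OF wpos fin]])
qed

theorem theorem2:
  fixes \<alpha> \<beta> :: real
  assumes "\<alpha> \<ge> - 1 / 2" and "\<beta> \<ge> - 1 / 2"
  shows
    "(\<forall>(p::real) \<omega>. 1 < p \<longrightarrow> \<omega> \<in> muckenhoupt_Ap p \<longrightarrow>
        (\<exists>C::real. \<forall>f \<in> l2_space \<inter> lp_space p \<omega>.
           (\<forall>n. bdd_above ((\<lambda>t. cmod (dunkl_heat \<alpha> \<beta> t f n)) ` {0<..})) \<and>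
           dunkl_max \<alpha> \<beta> f \<in> lp_space p \<omega> \<and>
           lp_norm p \<omega> (dunkl_max \<alpha> \<beta> f) \<le> C * lp_norm p \<omega> f) \<and>
        extends_uniquely (l2_space \<inter> lp_space p \<omega>) (dunkl_max \<alpha> \<beta>)
          (lp_space p \<omega>) (lp_norm p \<omega>) (lp_space p \<omega>) (lp_norm p \<omega>)) \<and>
     (\<forall>\<omega>. \<omega> \<in> muckenhoupt_A1 \<longrightarrow>
        (\<exists>C::real. \<forall>f \<in> l2_space \<inter> lp_space 1 \<omega>.
           (\<forall>n. bdd_above ((\<lambda>t. cmod (dunkl_heat \<alpha> \<beta> t f n)) ` {0<..})) \<and>
           dunkl_max \<alpha> \<beta> f \<in> weak_l1_space \<omega> \<and>
           weak_l1_norm \<omega> (dunkl_max \<alpha> \<beta> f) \<le> C * lp_norm 1 \<omega> f) \<and>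
        extends_uniquely (l2_space \<inter> lp_space 1 \<omega>) (dunkl_max \<alpha> \<beta>)
          (lp_space 1 \<omega>) (lp_norm 1 \<omega>) (weak_l1_space \<omega>) (weak_l1_norm \<omega>))"
proof (intro conjI allI impI)
  fix p :: real and \<omega>
  assume p: "1 < p" and w: "\<omega> \<in> muckenhoupt_Ap p"
  have wpos: "\<omega> k > 0" for k using w by (simp add: muckenhoupt_Ap_def)
  have p1: "1 \<le> p" using p by simp
  obtain C where tame: "\<And>f. f \<in> lp_space p \<omega> \<Longrightarrow> tame f"
    and T: "\<And>f. f \<in> lp_space p \<omega> \<Longrightarrow> dunkl_max \<alpha> \<beta> f \<in> lp_space p \<omega>"
    and bound: "\<And>f. f \<in> lp_space p \<omega> \<Longrightarrow> lp_norm p \<omega> (dunkl_max \<alpha> \<beta> f) \<le> C * lp_norm p \<omega> f"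
    by (rule dunkl_max_strong_type[OF assms p w]) (rule that)
  show "\<exists>C::real. \<forall>f \<in> l2_space \<inter> lp_space p \<omega>.
           (\<forall>n. bdd_above ((\<lambda>t. cmod (dunkl_heat \<alpha> \<beta> t f n)) ` {0<..})) \<and>
           dunkl_max \<alpha> \<beta> f \<in> lp_space p \<omega> \<and>
           lp_norm p \<omega> (dunkl_max \<alpha> \<beta> f) \<le> C * lp_norm p \<omega> f"
  proof (intro exI[of _ C] ballI conjI allI)
    fix f n assume "f \<in> l2_space \<inter> lp_space p \<omega>"
    then have f: "f \<in> lp_space p \<omega>" by (rule IntD2)
    show "bdd_above ((\<lambda>t. cmod (dunkl_heat \<alpha> \<beta> t f n)) ` {0<..})" by (rule bdd_dunkl_heat[OF assms tame[OF f]])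
  qed (rule T bound, erule IntD2)+
  show "extends_uniquely (l2_space \<inter> lp_space p \<omega>) (dunkl_max \<alpha> \<beta>)
          (lp_space p \<omega>) (lp_norm p \<omega>) (lp_space p \<omega>) (lp_norm p \<omega>)"
  proof (rule extends_uniquelyI[where C = C])
    show "sublinear_on (lp_space p \<omega>) (dunkl_max \<alpha> \<beta>)" by (rule sublinear_dunkl_max[OF assms p1 wpos tame])
    show "cmod (dunkl_max \<alpha> \<beta> g n - dunkl_max \<alpha> \<beta> f n) \<le> cmod (dunkl_max \<alpha> \<beta> (\<lambda>m. g m - f m) n)"
      if "f \<in> lp_space p \<omega>" "g \<in> lp_space p \<omega>" for f g n
      by (intro dunkl_max_diff assms tame that lp_space_diff p1 wpos)
  qed (rule Int_lower2 T bound lp_norm_nonneg[OF p1 wpos] lp_finite_support_dense[OF p1 wpos] lp_space_diff[OF p1 wpos]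
        lp_norm_mono[OF p1 wpos] lp_norm_coordinate[OF p1 wpos]; assumption?)+
next
  fix \<omega>
  assume w: "\<omega> \<in> muckenhoupt_A1"
  have wpos: "\<omega> k > 0" for k using w by (simp add: muckenhoupt_A1_def)
  obtain C where tame: "\<And>f. f \<in> lp_space 1 \<omega> \<Longrightarrow> tame f"
    and T: "\<And>f. f \<in> lp_space 1 \<omega> \<Longrightarrow> dunkl_max \<alpha> \<beta> f \<in> weak_l1_space \<omega>"
    and bound: "\<And>f. f \<in> lp_space 1 \<omega> \<Longrightarrow> weak_l1_norm \<omega> (dunkl_max \<alpha> \<beta> f) \<le> C * lp_norm 1 \<omega> f"
    by (rule dunkl_max_weak_type[OF assms w]) (rule that)
  show "\<exists>C::real. \<forall>f \<in> l2_space \<inter> lp_space 1 \<omega>.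
           (\<forall>n. bdd_above ((\<lambda>t. cmod (dunkl_heat \<alpha> \<beta> t f n)) ` {0<..})) \<and>
           dunkl_max \<alpha> \<beta> f \<in> weak_l1_space \<omega> \<and>
           weak_l1_norm \<omega> (dunkl_max \<alpha> \<beta> f) \<le> C * lp_norm 1 \<omega> f"
  proof (intro exI[of _ C] ballI conjI allI)
    fix f n assume "f \<in> l2_space \<inter> lp_space 1 \<omega>"
    then have f: "f \<in> lp_space 1 \<omega>" by (rule IntD2)
    show "bdd_above ((\<lambda>t. cmod (dunkl_heat \<alpha> \<beta> t f n)) ` {0<..})" by (rule bdd_dunkl_heat[OF assms tame[OF f]])
  qed (rule T bound, erule IntD2)+
  show "extends_uniquely (l2_space \<inter> lp_space 1 \<omega>) (dunkl_max \<alpha> \<beta>)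
          (lp_space 1 \<omega>) (lp_norm 1 \<omega>) (weak_l1_space \<omega>) (weak_l1_norm \<omega>)"
  proof (rule extends_uniquelyI[where C = C])
    show "sublinear_on (lp_space 1 \<omega>) (dunkl_max \<alpha> \<beta>)" by (rule sublinear_dunkl_max[OF assms order_refl wpos tame])
    show "cmod (dunkl_max \<alpha> \<beta> g n - dunkl_max \<alpha> \<beta> f n) \<le> cmod (dunkl_max \<alpha> \<beta> (\<lambda>m. g m - f m) n)"
      if "f \<in> lp_space 1 \<omega>" "g \<in> lp_space 1 \<omega>" for f g n
      by (intro dunkl_max_diff assms tame that lp_space_diff order_refl wpos)
  qed (rule Int_lower2 T bound lp_norm_nonneg[OF order_refl wpos] lp_finite_support_dense[OF order_refl wpos]
        lp_space_diff[OF order_refl wpos] weak_l1_norm_mono[OF wpos] weak_l1_diff[OF wpos] weak_l1_coordinate[OF wpos]; assumption?)+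
qed

end
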